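(* The broken ray transform is injective in the following manifolds (with or without corners): (1) The quadrant of a sphere $A=\{x\in S^n\subset\mathbb{R}^{n+1}:x_1\ge0,\ x_2\ge0\}$ with $n\ge3$ and the set of tomography $E=\{x\in A:x_1=0,\ x_2>0\}$, in the class $\{f\in L^2(A):\operatorname{spt}f\cap\overline{E}=\emptyset\}$. (2) The same quadrant $A$ with $n=2$ and the same $E$, in the class $\{f\in C^\infty(A):\operatorname{spt}f\cap\overline{E}=\emptyset$ and $f$ is $\infty$-even at $\{x_2=0\}\}$. (3) The hemisphere $M=\{x\in S^2\subset\mathbb{R}^3:x_2\ge0\}$ with the set of tomography $E=\{x\in\partial M:x_1<\varepsilon\}$ for some $\varepsilon>0$, in the class $\{f\in C^\infty(M):f$ is $\infty$-even at $\{x_2=0\}\}$.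
   Context: Spheres carry the standard round metric. On a compact Riemannian manifold (possibly with corners) with a set of tomography $E$ in the boundary, the rest of the boundary being reflecting, a broken ray is a piecewise geodesic path that starts and ends in $\overline{E}$, is a geodesic in the interior, and is reflected on the reflecting part $R$ of the boundary (the interior of the complement of $E$ in the boundary) according to the usual reflection law (angle of incidence equals angle of reflection). The broken ray transform (without attenuation) of $f$ maps a unit speed broken ray $\gamma:[0,L]\to M$ to $\int_0^L f(\gamma(t))\,dt$; injectivity on a class means that a function in the class is determined by these integrals. A smooth function $f$ is $\infty$-even at a subset $B$ of the boundary if $\partial_\nu^i f|_B=0$ for all odd $i$, where $\partial_\nu$ is the normal derivative.
   Formalization: In (3) the claim is proved only as existence of an ε (in effect ε ≥ 1, where the closure of E is the whole boundary circle); for any given 0 < ε < 1 it fails, since some nonzero ∞-even smooth functions odd under (x1,x2,x3)→(−x1,x2,−x3) have all broken ray integrals zero. *)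

theory Defs
  imports "HOL-Analysis.Analysis"
begin

text \<open>
  The unit sphere \<open>sphere 0 1\<close> of a Euclidean space carries the round metric, i.e. the one induced
  by the inner product of the ambient space. All manifolds below are closed domains \<open>M\<close> in this
  sphere whose boundary consists of pieces of great hyperspheres (\<open>domain with great walls\<close>);
  tangent vectors are represented by vectors of the ambient space.
\<close>

section \<open>Boundary, reflecting part, geodesics\<close>

definition mfd_interior :: "'a::euclidean_space set \<Rightarrow> 'a set"
  where "mfd_interior M = (top_of_set (sphere 0 1)) interior_of M"

definition mfd_boundary :: "'a::euclidean_space set \<Rightarrow> 'a set"
  where "mfd_boundary M = (top_of_set (sphere 0 1)) frontier_of M"

definition reflecting_part :: "'a::euclidean_space set \<Rightarrow> 'a set \<Rightarrow> 'a set"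
  where "reflecting_part M E =
    (top_of_set (mfd_boundary M)) interior_of (mfd_boundary M - E)"

text \<open>
  \<open>\<nu>\<close> is the inward unit normal at the boundary point \<open>x\<close>: it is a unit tangent vector of the sphere
  at \<open>x\<close>, and near \<open>x\<close> the domain is the half sphere determined by \<open>\<nu>\<close>. In particular there is no
  inward unit normal at a corner.
\<close>

definition inward_unit_normal :: "'a::euclidean_space set \<Rightarrow> 'a \<Rightarrow> 'a \<Rightarrow> bool"
  where "inward_unit_normal M x \<nu> \<longleftrightarrow>
    norm \<nu> = 1 \<and> \<nu> \<bullet> x = 0 \<and>
    (\<exists>U. open U \<and> x \<in> U \<and> M \<inter> U = {y \<in> sphere 0 1 \<inter> U. 0 \<le> \<nu> \<bullet> y})"

definition reflect_velocity :: "'a::real_inner \<Rightarrow> 'a \<Rightarrow> 'a"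
  where "reflect_velocity \<nu> v = v - (2 * (v \<bullet> \<nu>)) *\<^sub>R \<nu>"

text \<open>
  The covariant derivative of the velocity \<open>v\<close> along \<open>c\<close> is the tangential part of the acceleration
  \<open>a\<close>; the normal space of the sphere at \<open>c t\<close> is spanned by \<open>c t\<close>.
\<close>

definition unit_speed_geodesic_on :: "real set \<Rightarrow> (real \<Rightarrow> 'a::euclidean_space) \<Rightarrow> bool"
  where "unit_speed_geodesic_on I c \<longleftrightarrow>
    (\<exists>v a. \<forall>t\<in>I. c t \<in> sphere 0 1 \<and>
       (c has_vector_derivative v t) (at t within I) \<and>
       (v has_vector_derivative a t) (at t within I) \<and>
       norm (v t) = 1 \<and> a t - (a t \<bullet> c t) *\<^sub>R c t = 0)"

section \<open>Broken rays and the broken ray transform\<close>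

text \<open>
  A broken ray \<open>\<gamma>\<close> on \<open>[0, L]\<close> runs in the interior of \<open>M\<close> except for its two end points, which lie in
  the closure of \<open>E\<close>, and its finitely many break points \<open>\<tau> 1, \<dots>, \<tau> (k - 1)\<close>, at which it is
  reflected on the reflecting part of the boundary.
\<close>

definition broken_ray ::
  "'a::euclidean_space set \<Rightarrow> 'a set \<Rightarrow> real \<Rightarrow> (real \<Rightarrow> 'a) \<Rightarrow> bool"
  where "broken_ray M E L \<gamma> \<longleftrightarrow>
    0 < L \<and> \<gamma> ` {0..L} \<subseteq> M \<and> \<gamma> 0 \<in> closure E \<and> \<gamma> L \<in> closure E \<and>
    (\<exists>(k::nat) (\<tau>::nat \<Rightarrow> real). 0 < k \<and> \<tau> 0 = 0 \<and> \<tau> k = L \<and>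
      (\<forall>i<k. \<tau> i < \<tau> (Suc i) \<and>
         unit_speed_geodesic_on {\<tau> i..\<tau> (Suc i)} \<gamma> \<and>
         \<gamma> ` {\<tau> i<..<\<tau> (Suc i)} \<subseteq> mfd_interior M) \<and>
      (\<forall>i. 0 < i \<and> i < k \<longrightarrow>
         \<gamma> (\<tau> i) \<in> reflecting_part M E \<and>
         (\<exists>\<nu>. inward_unit_normal M (\<gamma> (\<tau> i)) \<nu> \<and>
            vector_derivative \<gamma> (at_right (\<tau> i)) =
            reflect_velocity \<nu> (vector_derivative \<gamma> (at_left (\<tau> i))))))"

definition broken_ray_transform ::
  "('a::euclidean_space \<Rightarrow> real) \<Rightarrow> real \<Rightarrow> (real \<Rightarrow> 'a) \<Rightarrow> real"
  where "broken_ray_transform f L \<gamma> = (LINT t:{0..L}|lborel. f (\<gamma> t))"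

text \<open>Injectivity on a class of functions (not equivalence classes) on \<open>M\<close>.\<close>

definition brt_injective ::
  "'a::euclidean_space set \<Rightarrow> 'a set \<Rightarrow> ('a \<Rightarrow> real) set \<Rightarrow> bool"
  where "brt_injective M E C \<longleftrightarrow>
    (\<forall>f\<in>C. \<forall>g\<in>C.
       (\<forall>L \<gamma>. broken_ray M E L \<gamma> \<longrightarrow> broken_ray_transform f L \<gamma> = broken_ray_transform g L \<gamma>)
       \<longrightarrow> (\<forall>x\<in>M. f x = g x))"

section \<open>Square integrable functions\<close>

text \<open>
  By polar coordinates, the surface area of a subset of the unit sphere of an \<open>N\<close>-dimensional space
  is \<open>N\<close> times the volume of the cone over it in the unit ball. (The value \<open>sgn 0 = 0\<close> outside the
  sphere is taken on a null set only.)
\<close>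

definition sphere_measure :: "'a::euclidean_space measure"
  where "sphere_measure =
    scale_measure (ennreal (real DIM('a)))
      (distr (restrict_space lborel (ball 0 1)) borel sgn)"

definition surface_measure :: "'a::euclidean_space set \<Rightarrow> 'a measure"
  where "surface_measure M = restrict_space sphere_measure M"

definition square_integrable :: "'a::euclidean_space set \<Rightarrow> ('a \<Rightarrow> real) set"
  where "square_integrable M =
    {f \<in> borel_measurable (surface_measure M). integrable (surface_measure M) (\<lambda>x. (f x)\<^sup>2)}"

definition essential_support :: "'a::euclidean_space set \<Rightarrow> ('a \<Rightarrow> real) \<Rightarrow> 'a set"
  where "essential_support M f =
    {x \<in> M. \<forall>U. open U \<and> x \<in> U \<longrightarrow> \<not> (AE y in surface_measure M. y \<in> U \<longrightarrow> f y = 0)}"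

text \<open>
  The Liouville measure (up to a constant factor) on the unit tangent bundle of \<open>M\<close>, as a measure on
  pairs of a point \<open>x\<close> and a unit tangent vector at \<open>x\<close>: for \<open>w\<close> uniformly distributed on the unit
  sphere, the normalized projection of \<open>w\<close> to the tangent space at \<open>x\<close> is uniformly distributed on
  the unit sphere of that tangent space.
\<close>

definition liouville_measure :: "'a::euclidean_space set \<Rightarrow> ('a \<times> 'a) measure"
  where "liouville_measure M =
    distr (surface_measure M \<Otimes>\<^sub>M sphere_measure) borel
      (\<lambda>(x, w). (x, sgn (w - (w \<bullet> x) *\<^sub>R x)))"

text \<open>
  The integral of an element of \<open>L\<^sup>2(M)\<close> is meaningful for almost every broken ray only. A property
  holds for almost every broken ray if it holds for all broken rays passing through \<open>(x, v)\<close>, for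
  almost every unit tangent vector \<open>(x, v)\<close>.
\<close>

definition AE_broken_ray ::
  "'a::euclidean_space set \<Rightarrow> 'a set \<Rightarrow> (real \<Rightarrow> (real \<Rightarrow> 'a) \<Rightarrow> bool) \<Rightarrow> bool"
  where "AE_broken_ray M E P \<longleftrightarrow>
    (AE (x, v) in liouville_measure M.
       \<forall>L \<gamma>. broken_ray M E L \<gamma> \<and>
         (\<exists>t\<in>{0<..<L}. \<gamma> t = x \<and> (\<gamma> has_vector_derivative v) (at t)) \<longrightarrow> P L \<gamma>)"

text \<open>Injectivity on a class of functions on \<open>M\<close> that are identified if they agree a.e.\<close>

definition brt_injective_AE ::
  "'a::euclidean_space set \<Rightarrow> 'a set \<Rightarrow> ('a \<Rightarrow> real) set \<Rightarrow> bool"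
  where "brt_injective_AE M E C \<longleftrightarrow>
    (\<forall>f\<in>C. \<forall>g\<in>C.
       AE_broken_ray M E (\<lambda>L \<gamma>. broken_ray_transform f L \<gamma> = broken_ray_transform g L \<gamma>)
       \<longrightarrow> (AE x in surface_measure M. f x = g x))"

section \<open>Smooth functions\<close>

fun Ck_on :: "nat \<Rightarrow> 'a::euclidean_space set \<Rightarrow> ('a \<Rightarrow> real) \<Rightarrow> bool"
  where
    "Ck_on 0 U F \<longleftrightarrow> continuous_on U F"
  | "Ck_on (Suc k) U F \<longleftrightarrow>
       (\<forall>x\<in>U. F differentiable (at x)) \<and>
       (\<forall>h. Ck_on k U (\<lambda>x. frechet_derivative F (at x) h))"

text \<open>
  Smoothness up to the boundary (and corners): \<open>f\<close> is locally the restriction of a smooth function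
  on an open set of the ambient space.
\<close>

definition smooth_on_mfd :: "'a::euclidean_space set \<Rightarrow> ('a \<Rightarrow> real) \<Rightarrow> bool"
  where "smooth_on_mfd M f \<longleftrightarrow>
    (\<forall>x\<in>M. \<exists>U F. open U \<and> x \<in> U \<and> (\<forall>k. Ck_on k U F) \<and> (\<forall>y\<in>M \<inter> U. F y = f y))"

definition fun_support :: "'a::euclidean_space set \<Rightarrow> ('a \<Rightarrow> real) \<Rightarrow> 'a set"
  where "fun_support M f = M \<inter> closure {x \<in> M. f x \<noteq> 0}"

text \<open>
  The \<open>i\<close>-th normal derivative at \<open>x\<close> is the \<open>i\<close>-th one-sided derivative at \<open>0\<close> along the geodesic that
  leaves \<open>x\<close> in the direction of the unit normal \<open>\<nu>\<close>.
\<close>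

definition normal_derivative ::
  "nat \<Rightarrow> 'a::euclidean_space \<Rightarrow> ('a \<Rightarrow> real) \<Rightarrow> 'a \<Rightarrow> real"
  where "normal_derivative i \<nu> f x =
    ((\<lambda>h t. vector_derivative h (at t within {0..})) ^^ i)
      (\<lambda>t. f (cos t *\<^sub>R x + sin t *\<^sub>R \<nu>)) 0"

text \<open>\<open>\<nu>\<close> is the normal along the wall \<open>B\<close>; on a great hypersphere \<open>{x. \<nu> \<bullet> x = 0}\<close> it is constant.\<close>

definition infinitely_even :: "'a::euclidean_space set \<Rightarrow> 'a \<Rightarrow> ('a \<Rightarrow> real) \<Rightarrow> bool"
  where "infinitely_even B \<nu> f \<longleftrightarrow> (\<forall>i. odd i \<longrightarrow> (\<forall>x\<in>B. normal_derivative i \<nu> f x = 0))"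

section \<open>The manifolds\<close>

definition quadrant :: "'n \<Rightarrow> 'n \<Rightarrow> (real ^ 'n::finite) set"
  where "quadrant a b = {x \<in> sphere 0 1. 0 \<le> x $ a \<and> 0 \<le> x $ b}"

definition quadrant_tomography :: "'n \<Rightarrow> 'n \<Rightarrow> (real ^ 'n::finite) set"
  where "quadrant_tomography a b = {x \<in> quadrant a b. x $ a = 0 \<and> 0 < x $ b}"

definition hemisphere :: "(real ^ 3) set"
  where "hemisphere = {x \<in> sphere 0 1. 0 \<le> x $ 2}"

text \<open>
  For \<open>1 < \<epsilon>\<close> this is the whole boundary circle. For \<open>0 < \<epsilon> < 1\<close> a ray starting at \<open>x\<close> with \<open>x $ 1 < - \<epsilon>\<close>
  is reflected at \<open>- x\<close> and returns to \<open>x\<close>, so that only the sum of two semicircle integrals is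
  available there; functions that are odd under \<open>(x\<^sub>1, x\<^sub>2, x\<^sub>3) \<mapsto> (- x\<^sub>1, x\<^sub>2, - x\<^sub>3)\<close> are annihilated by
  these sums, and some of them also by the integrals over all other rays.
\<close>

definition hemisphere_tomography :: "real \<Rightarrow> (real ^ 3) set"
  where "hemisphere_tomography \<epsilon> = {x \<in> mfd_boundary hemisphere. x $ 1 < \<epsilon>}"

end

theory Submission
  imports Defs
begin

text \<open>
  A great semicircle that starts and ends in the wall \<open>{x. x $ a = 0}\<close>, folded along the reflecting
  wall by \<open>x $ b \<mapsto> \<bar>x $ b\<bar>\<close>, is a broken ray with at most one reflection (\<open>quadrant_ray_through\<close>,
  \<open>hemisphere_ray_through\<close>). Unfolding a function \<open>f\<close> on the quadrant therefore gives an even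
  function on the sphere whose integrals over almost all great circles are determined by the broken
  ray transform of \<open>f\<close> (\<open>circle_integrals_agree\<close>). The half sphere of the third part is the quadrant
  with \<open>a = b\<close>, and with \<open>1 < \<epsilon>\<close> its rays are the great semicircles themselves. So all three parts
  follow from the injectivity of the great circle transform on even functions on a sphere of
  dimension at least 2 (\<open>circle_integrals_determine\<close>); in the smooth case, continuous functions that
  agree almost everywhere agree.

  That transform is inverted by moments. Extend an even function on the sphere to a function \<open>F\<close> on
  the ambient space that is homogeneous of degree 0. Lebesgue measure on the pairs \<open>(u, w)\<close> of
  vectors is invariant under rotations of the pair in its plane. If \<open>F u / (norm u)\<^sup>2\<close> is integrated
  over all pairs against a rotation invariant weight, averaging over these rotations replaces it by
  the integral of \<open>F\<close> over the great circle in the plane of \<open>u\<close> and \<open>w\<close>, up to the area of the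
  parallelogram spanned by them (\<open>weighted_integral_rotate\<close>, \<open>plane_integral_eq_circle_integral\<close>).
  Hence the integral is determined by the circle integrals of \<open>F\<close>. As weight take, essentially, the
  \<open>2 k\<close>-th power of the length of the projection of a unit vector \<open>\<omega>\<close> to that plane. Averaged over
  \<open>w\<close> it is a polynomial of degree \<open>k\<close> in \<open>(\<omega> \<bullet> sgn u)\<^sup>2\<close> (\<open>integral_plane_weight\<close>), and its leading
  coefficient is positive if the ambient dimension is at least 3 (\<open>angular_moment_pos\<close>). By
  induction on \<open>k\<close> the moments of \<open>F\<close> on the sphere against the even powers of \<open>\<omega> \<bullet> x\<close> are
  determined; those against odd powers vanish. These moments are the Taylor coefficients of the
  integrals against \<open>exp (\<omega> \<bullet> x)\<close>, and the exponentials span an algebra that separates points, so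
  the theorem of Stone and Weierstrass identifies \<open>F\<close> (\<open>AE_zero_if_moments_zero\<close>).
\<close>

section \<open>Orthogonal transformations and Lebesgue measure\<close>

definition orthonormal_pair :: "'a::real_inner \<Rightarrow> 'a \<Rightarrow> bool"
  where "orthonormal_pair x v \<longleftrightarrow> norm x = 1 \<and> norm v = 1 \<and> x \<bullet> v = 0"

lemma nn_integral_lborel_translate:
  fixes f :: "'a::euclidean_space \<Rightarrow> ennreal"
  assumes "f \<in> borel_measurable borel"
  shows "(\<integral>\<^sup>+x. f (c + x) \<partial>lborel) = (\<integral>\<^sup>+x. f x \<partial>lborel)"
  using nn_integral_distr[of "(+) c" lborel borel f] assms by (simp add: lborel_distr_plus)

text \<open>
  Two translation invariant measures are proportional. With \<open>B\<close> the unit ball, which \<open>T\<close> preserves,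
  the double integral of \<open>indicator B y * indicator A (T x)\<close> is evaluated twice: directly, and after
  moving \<open>A\<close> to the variable \<open>y\<close> by translations in \<open>x\<close> and in \<open>y\<close>. Cancelling the measure of \<open>B\<close>
  leaves the claim.
\<close>

lemma lborel_distr_orthogonal:
  fixes T :: "'a::euclidean_space \<Rightarrow> 'a"
  assumes T: "orthogonal_transformation T"
  shows "distr lborel borel T = lborel"
proof (rule measure_eqI)
  fix A assume "A \<in> sets (distr lborel borel T)"
  then have A[measurable]: "A \<in> sets borel" by simp
  have lin: "linear T" and bij: "bij T"
    using T orthogonal_transformation_linear orthogonal_transformation_bij by auto
  have contT: "continuous_on UNIV T"
    using lin linear_continuous_on linear_conv_bounded_linear by blast
  have T_meas[measurable]: "T \<in> borel_measurable borel"
    by (intro borel_measurable_continuous_onI contT)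
  define S where "S = inv T"
  have TS: "T (S y) = y" for y unfolding S_def using bij by (simp add: bij_is_surj surj_f_inv_f)
  let ?B = "ball (0::'a) 1"
  have [measurable]: "?B \<in> sets borel" by simp
  have B0: "emeasure lborel ?B \<noteq> 0" "emeasure lborel ?B \<noteq> \<infinity>"
    using emeasure_lborel_ball_finite[of "0::'a" 1] by (auto simp: emeasure_ball unit_ball_vol_pos less_imp_neq[symmetric])
  \<comment> \<open>\<open>T\<close> is an isometry, so a translate of the ball is pulled back to a translate of the ball.\<close>
  have ball_meas: "(\<integral>\<^sup>+x. indicator ?B (y - T x) \<partial>lborel) = emeasure lborel ?B" for y
  proof -
    have "norm (y - T x) = norm (x - S y)" for x
    proof -
      have "y - T x = T (S y - x)" using lin by (simp add: TS linear_diff)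
      then show ?thesis using T by (simp add: orthogonal_transformation_norm norm_minus_commute)
    qed
    then have "(\<integral>\<^sup>+x. indicator ?B (y - T x) \<partial>lborel) = (\<integral>\<^sup>+x. indicator ?B (- S y + x) \<partial>lborel)"
      by (intro nn_integral_cong) (auto simp: indicator_def norm_minus_commute)
    also have "\<dots> = (\<integral>\<^sup>+x. indicator ?B x \<partial>lborel)"
      by (rule nn_integral_lborel_translate) measurable
    finally show ?thesis by simp
  qed
  have "emeasure lborel ?B * (\<integral>\<^sup>+x. indicator A (T x) \<partial>lborel)
      = (\<integral>\<^sup>+y. indicator ?B y * (\<integral>\<^sup>+x. indicator A (T x) \<partial>lborel) \<partial>lborel)"
    by (subst nn_integral_multc) auto
  also have "\<dots> = (\<integral>\<^sup>+y. (\<integral>\<^sup>+x. indicator ?B y * indicator A (y + T x) \<partial>lborel) \<partial>lborel)"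
  proof (rule nn_integral_cong)
    fix y :: 'a
    have "(\<integral>\<^sup>+x. indicator A (T x) \<partial>lborel) = (\<integral>\<^sup>+x. indicator A (T (S y + x)) \<partial>lborel)"
      by (rule nn_integral_lborel_translate[symmetric]) simp
    also have "\<dots> = (\<integral>\<^sup>+x. indicator A (y + T x) \<partial>lborel)"
      using lin by (simp add: linear_add TS)
    finally show "indicator ?B y * (\<integral>\<^sup>+x. indicator A (T x) \<partial>lborel)
        = (\<integral>\<^sup>+x. indicator ?B y * indicator A (y + T x) \<partial>lborel)"
      by (subst nn_integral_cmult) auto
  qed
  also have "\<dots> = (\<integral>\<^sup>+x. (\<integral>\<^sup>+y. indicator ?B y * indicator A (y + T x) \<partial>lborel) \<partial>lborel)"
    by (rule lborel_pair.Fubini') measurable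
  also have "\<dots> = (\<integral>\<^sup>+x. (\<integral>\<^sup>+y. indicator ?B (y - T x) * indicator A y \<partial>lborel) \<partial>lborel)"
  proof (rule nn_integral_cong)
    fix x :: 'a
    have "(\<integral>\<^sup>+y. indicator ?B (T x + y - T x) * indicator A (T x + y) \<partial>lborel)
       = (\<integral>\<^sup>+y. indicator ?B (y - T x) * indicator A y \<partial>lborel)"
      by (rule nn_integral_lborel_translate) measurable
    then show "(\<integral>\<^sup>+y. indicator ?B y * indicator A (y + T x) \<partial>lborel)
       = (\<integral>\<^sup>+y. indicator ?B (y - T x) * indicator A y \<partial>lborel)"
      by (simp add: add.commute)
  qed
  also have "\<dots> = (\<integral>\<^sup>+y. (\<integral>\<^sup>+x. indicator ?B (y - T x) * indicator A y \<partial>lborel) \<partial>lborel)"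
    by (rule lborel_pair.Fubini') measurable
  also have "\<dots> = (\<integral>\<^sup>+y. emeasure lborel ?B * indicator A y \<partial>lborel)"
    by (intro nn_integral_cong) (subst nn_integral_multc, auto simp: ball_meas)
  also have "\<dots> = emeasure lborel ?B * emeasure lborel A"
    by (subst nn_integral_cmult) auto
  finally have "(\<integral>\<^sup>+x. indicator A (T x) \<partial>lborel) = emeasure lborel A"
    using B0 by (simp add: ennreal_mult_cancel_left)
  moreover have "(\<integral>\<^sup>+x. indicator A (T x) \<partial>lborel) = (\<integral>\<^sup>+x. indicator A x \<partial>distr lborel borel T)"
    by (rule nn_integral_distr[symmetric]) auto
  ultimately show "emeasure (distr lborel borel T) A = emeasure lborel A" by simp
qed simp

lemma borel_measurable_orthogonal_transformation:
  fixes T :: "'a::euclidean_space \<Rightarrow> 'a"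
  assumes "orthogonal_transformation T"
  shows "T \<in> borel_measurable borel"
  using assms orthogonal_transformation_linear linear_continuous_on linear_conv_bounded_linear
    borel_measurable_continuous_onI by blast

lemma integral_lborel_orthogonal:
  fixes G :: "'a::euclidean_space \<Rightarrow> real"
  assumes T: "orthogonal_transformation (T :: 'a \<Rightarrow> 'a)" and G: "G \<in> borel_measurable borel"
  shows "(\<integral>z. G (T z) \<partial>lborel) = (\<integral>z. G z \<partial>lborel)"
  using integral_distr[of T lborel borel G] borel_measurable_orthogonal_transformation[OF T] G
  by (simp add: lborel_distr_orthogonal[OF T])

lemma integrable_lborel_orthogonal:
  fixes G :: "'a::euclidean_space \<Rightarrow> real"
  assumes T: "orthogonal_transformation (T :: 'a \<Rightarrow> 'a)" and G: "integrable lborel G"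
  shows "integrable lborel (\<lambda>z. G (T z))"
  using integrable_distr_eq[of T lborel borel G] borel_measurable_orthogonal_transformation[OF T] G
  by (simp add: lborel_distr_orthogonal[OF T])

lemma AE_lborel_orthogonal:
  fixes T :: "'a::euclidean_space \<Rightarrow> 'a"
  assumes T: "orthogonal_transformation T" and P: "AE z in lborel. P z"
  shows "AE z in lborel. P (T z)"
proof -
  have "T \<in> lborel \<rightarrow>\<^sub>M borel"
    using borel_measurable_orthogonal_transformation[OF T] by simp
  moreover have "AE z in distr lborel borel T. P z"
    by (subst lborel_distr_orthogonal[OF T]) (rule P)
  ultimately show ?thesis by (rule AE_distrD)
qed

lemma integral_lborel_scaleR:
  fixes G :: "'a::euclidean_space \<Rightarrow> real"
  assumes c: "0 < c" and [measurable]: "G \<in> borel_measurable borel"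
  shows "(\<integral>w. G w \<partial>lborel) = c ^ DIM('a) * (\<integral>w. G (c *\<^sub>R w) \<partial>lborel)"
proof -
  have "(\<integral>w. G w \<partial>lborel)
      = (\<integral>w. G w \<partial>density (distr lborel borel (\<lambda>x::'a. 0 + c *\<^sub>R x)) (\<lambda>_. ennreal (\<bar>c\<bar> ^ DIM('a))))"
    using lborel_affine[of c "0::'a"] c by simp
  also have "\<dots> = (\<integral>w. \<bar>c\<bar> ^ DIM('a) *\<^sub>R G w \<partial>distr lborel borel (\<lambda>x::'a. 0 + c *\<^sub>R x))"
    by (rule integral_density) auto
  also have "\<dots> = (\<integral>w. \<bar>c\<bar> ^ DIM('a) *\<^sub>R G (0 + c *\<^sub>R w) \<partial>lborel)"
    by (rule integral_distr) auto
  finally show ?thesis using c by simp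
qed

definition hyperplane_reflection :: "'a::real_inner \<Rightarrow> 'a \<Rightarrow> 'a"
  where "hyperplane_reflection d y = y - (2 * (y \<bullet> d) / (d \<bullet> d)) *\<^sub>R d"

lemma orthogonal_transformation_hyperplane_reflection:
  "orthogonal_transformation (hyperplane_reflection d)"
  unfolding orthogonal_transformation_def
proof (intro conjI allI)
  show "linear (hyperplane_reflection d)"
    unfolding hyperplane_reflection_def
    by (rule linearI) (auto simp: inner_add_left algebra_simps add_divide_distrib)
  fix v w
  show "hyperplane_reflection d v \<bullet> hyperplane_reflection d w = v \<bullet> w"
  proof (cases "d = 0")
    case False
    then show ?thesis
      by (simp add: hyperplane_reflection_def inner_diff_left inner_diff_right inner_commute field_simps)
  qed (simp add: hyperplane_reflection_def)
qed

lemma hyperplane_reflection_swaps: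
  assumes "norm x = norm y"
  shows "hyperplane_reflection (y - x) x = y"
proof (cases "x = y")
  case False
  then have "(y - x) \<bullet> (y - x) \<noteq> 0" by simp
  moreover have "x \<bullet> x = y \<bullet> y" using assms by (simp add: norm_eq)
  then have "2 * (x \<bullet> (y - x)) = - ((y - x) \<bullet> (y - x))"
    by (simp add: inner_diff_left inner_diff_right inner_commute)
  ultimately have "2 * (x \<bullet> (y - x)) / ((y - x) \<bullet> (y - x)) = - 1" by (simp add: field_simps)
  then show ?thesis by (simp add: hyperplane_reflection_def)
qed (simp add: hyperplane_reflection_def)

text \<open>
  The first reflection takes \<open>x\<close> to \<open>x'\<close>; the second one corrects the image of \<open>e\<close> and fixes \<open>x'\<close>,
  because \<open>x'\<close> is orthogonal to the difference that it reverses.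
\<close>

lemma orthogonal_transformation_orthonormal_pair:
  fixes x e x' e' :: "'a::real_inner"
  assumes "orthonormal_pair x e" "orthonormal_pair x' e'"
  obtains T :: "'a \<Rightarrow> 'a" where "orthogonal_transformation T" "T x = x'" "T e = e'"
proof
  define S where "S = hyperplane_reflection (x' - x)"
  define R where "R = hyperplane_reflection (e' - S e)"
  have S: "orthogonal_transformation S" and R: "orthogonal_transformation R"
    by (simp_all add: S_def R_def orthogonal_transformation_hyperplane_reflection)
  show "orthogonal_transformation (R \<circ> S)"
    using R S by (rule orthogonal_transformation_compose)
  have Sx: "S x = x'" using assms by (simp add: S_def hyperplane_reflection_swaps orthonormal_pair_def)
  have "x' \<bullet> S e = S x \<bullet> S e" by (simp add: Sx)
  also have "\<dots> = x \<bullet> e" using S by (simp add: orthogonal_transformation_def)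
  finally have "x' \<bullet> (e' - S e) = 0" using assms by (simp add: orthonormal_pair_def inner_diff_right)
  then show "(R \<circ> S) x = x'" by (simp add: Sx R_def hyperplane_reflection_def)
  have "norm (S e) = norm e'"
    using S assms by (simp add: orthogonal_transformation_norm orthonormal_pair_def)
  then show "(R \<circ> S) e = e'" by (simp add: R_def hyperplane_reflection_swaps)
qed

section \<open>Functions determined by their moments\<close>

text \<open>
  The algebra generated by the functions \<open>\<lambda>x. exp (\<omega> \<bullet> x)\<close>. Since a product of two of them is a
  third, linear combinations suffice.
\<close>

inductive exponential_sum :: "('a::euclidean_space \<Rightarrow> real) \<Rightarrow> bool" where
  single: "exponential_sum (\<lambda>x. a * exp (\<omega> \<bullet> x))"
| add: "exponential_sum f \<Longrightarrow> exponential_sum g \<Longrightarrow> exponential_sum (\<lambda>x. f x + g x)"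

lemma exponential_sum_mult:
  assumes f: "exponential_sum f" and g: "exponential_sum g"
  shows "exponential_sum (\<lambda>x. f x * g x)"
  using f
proof induction
  case (single a \<omega>)
  from g show ?case
  proof induction
    case (single b \<eta>)
    show ?case
      using exponential_sum.single[of "a * b" "\<omega> + \<eta>"]
      by (simp add: inner_add_left exp_add mult_ac)
  next
    case (add g h)
    then show ?case by (simp add: distrib_left exponential_sum.add)
  qed
next
  case (add f h)
  then show ?case by (simp add: distrib_right exponential_sum.add)
qed

lemma exponential_sum_dense:
  fixes K :: "'a::euclidean_space set"
  assumes "compact K" "continuous_on K \<psi>" "0 < e"
  shows "\<exists>g. exponential_sum g \<and> (\<forall>x\<in>K. \<bar>\<psi> x - g x\<bar> < e)"
proof -
  have cont: "continuous_on K f" if "exponential_sum f" for f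
    using that by induction (intro continuous_intros; assumption)+
  interpret function_ring_on "Collect exponential_sum" K
  proof
    fix x y :: 'a assume "x \<noteq> y"
    moreover have "(x - y) \<bullet> x = (x - y) \<bullet> y \<longleftrightarrow> x = y"
      by (metis eq_iff_diff_eq_0 inner_diff_right inner_eq_zero_iff)
    ultimately show "\<exists>f\<in>Collect exponential_sum. f x \<noteq> f y"
      using exponential_sum.single[of 1 "x - y"] by (intro bexI[of _ "\<lambda>z. 1 * exp ((x - y) \<bullet> z)"]) auto
  next
    fix c :: real
    show "(\<lambda>_. c) \<in> Collect exponential_sum"
      using exponential_sum.single[of c 0] by simp
  qed (use \<open>compact K\<close> cont in \<open>auto intro: exponential_sum.add exponential_sum_mult\<close>)
  show ?thesis using Stone_Weierstrass_basic[OF assms(2,3)] by auto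
qed

text \<open>
  Expanding the exponential series, \<open>H\<close> is orthogonal to all \<open>exp (\<omega> \<bullet> x)\<close>, hence by the theorem of
  Stone and Weierstrass to all continuous functions. Distance functions approximate the indicator of
  a closed set, and closed sets generate the Borel sets, so that the signed measure with density \<open>H\<close>
  vanishes.
\<close>

lemma AE_zero_if_moments_zero:
  fixes \<mu> :: "'a::euclidean_space measure" and H :: "'a \<Rightarrow> real"
  assumes fin: "finite_measure \<mu>"
    and sets[measurable_cong]: "sets \<mu> = sets borel"
    and K: "compact K" "AE x in \<mu>. x \<in> K"
    and int: "integrable \<mu> H"
    and mom: "\<And>\<omega> k. (\<integral>x. H x * (\<omega> \<bullet> x) ^ k \<partial>\<mu>) = 0"
  shows "AE x in \<mu>. H x = 0"
proof -
  interpret finite_measure \<mu> by (rule fin)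
  have H_meas[measurable]: "H \<in> borel_measurable \<mu>" using int by simp
  have int_mult: "integrable \<mu> (\<lambda>x. H x * \<phi> x)"
    if "\<phi> \<in> borel_measurable borel" "AE x in \<mu>. \<bar>\<phi> x\<bar> \<le> C" for \<phi> C
  proof (rule Bochner_Integration.integrable_bound)
    show "integrable \<mu> (\<lambda>x. C * H x)" using int by simp
    show "(\<lambda>x. H x * \<phi> x) \<in> borel_measurable \<mu>" using that(1) by measurable
    show "AE x in \<mu>. norm (H x * \<phi> x) \<le> norm (C * H x)"
      using that(2)
    proof eventually_elim
      fix x assume "\<bar>\<phi> x\<bar> \<le> C"
      then have "\<bar>\<phi> x\<bar> * \<bar>H x\<bar> \<le> \<bar>C\<bar> * \<bar>H x\<bar>" by (intro mult_right_mono) auto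
      then show "norm (H x * \<phi> x) \<le> norm (C * H x)" by (simp add: abs_mult mult.commute)
    qed
  qed
  obtain B where B: "\<And>x. x \<in> K \<Longrightarrow> norm x \<le> B" "0 < B"
    using K(1) compact_imp_bounded bounded_pos by metis
  have exp0: "(\<integral>x. H x * exp (\<omega> \<bullet> x) \<partial>\<mu>) = 0" for \<omega>
  proof -
    define f where "f n x = H x * (\<omega> \<bullet> x) ^ n / fact n" for n x
    have bnd: "\<bar>\<omega> \<bullet> x\<bar> \<le> norm \<omega> * B" if "x \<in> K" for x
      using Cauchy_Schwarz_ineq2[of \<omega> x] B(1)[OF that] mult_left_mono[of "norm x" B "norm \<omega>"]
      by simp
    have int_f: "integrable \<mu> (f n)" for n
    proof -
      have "integrable \<mu> (\<lambda>x. H x * ((\<omega> \<bullet> x) ^ n / fact n))"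
      proof (rule int_mult)
        show "AE x in \<mu>. \<bar>(\<omega> \<bullet> x) ^ n / fact n\<bar> \<le> (norm \<omega> * B) ^ n / fact n"
          using K(2) by eventually_elim (auto simp: power_abs intro!: divide_right_mono power_mono bnd)
      qed measurable
      then show ?thesis by (simp add: f_def[abs_def])
    qed
    have sums: "(\<lambda>n. f n x) sums (H x * exp (\<omega> \<bullet> x))" for x
      using sums_mult[OF exp_converges[of "\<omega> \<bullet> x"], of "H x"] by (simp add: f_def[abs_def] field_simps)
    have "(\<lambda>n. integral\<^sup>L \<mu> (f n)) sums (\<integral>x. (\<Sum>n. f n x) \<partial>\<mu>)"
    proof (rule sums_integral[OF int_f])
      show "AE x in \<mu>. summable (\<lambda>n. norm (f n x))"
      proof (rule AE_I2)
        fix x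
        have "summable (\<lambda>n. \<bar>H x\<bar> * norm ((\<omega> \<bullet> x) ^ n /\<^sub>R fact n))"
          by (intro summable_mult summable_norm_exp)
        then show "summable (\<lambda>n. norm (f n x))" by (simp add: f_def abs_mult field_simps)
      qed
      show "summable (\<lambda>n. \<integral>x. norm (f n x) \<partial>\<mu>)"
      proof (rule summable_comparison_test')
        show "summable (\<lambda>n. (norm \<omega> * B) ^ n /\<^sub>R fact n * (\<integral>x. \<bar>H x\<bar> \<partial>\<mu>))"
          by (intro summable_mult2 summable_exp_generic)
        fix n :: nat
        have "(\<integral>x. norm (f n x) \<partial>\<mu>) \<le> (\<integral>x. (norm \<omega> * B) ^ n / fact n * \<bar>H x\<bar> \<partial>\<mu>)"
        proof (rule integral_mono_AE)
          show "AE x in \<mu>. norm (f n x) \<le> (norm \<omega> * B) ^ n / fact n * \<bar>H x\<bar>"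
            using K(2)
          proof eventually_elim
            fix x assume "x \<in> K"
            then have "\<bar>\<omega> \<bullet> x\<bar> ^ n * \<bar>H x\<bar> \<le> (norm \<omega> * B) ^ n * \<bar>H x\<bar>"
              by (intro mult_right_mono power_mono bnd) auto
            then show "norm (f n x) \<le> (norm \<omega> * B) ^ n / fact n * \<bar>H x\<bar>"
              by (simp add: f_def abs_mult power_abs field_simps)
          qed
        qed (use int int_f in auto)
        then show "norm (\<integral>x. norm (f n x) \<partial>\<mu>) \<le> (norm \<omega> * B) ^ n /\<^sub>R fact n * (\<integral>x. \<bar>H x\<bar> \<partial>\<mu>)"
          by (simp add: field_simps)
      qed
    qed
    moreover have "integral\<^sup>L \<mu> (f n) = 0" for n
      using mom[of \<omega> n] by (simp add: f_def[abs_def])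
    moreover have "(\<Sum>n. f n x) = H x * exp (\<omega> \<bullet> x)" for x
      by (metis sums sums_unique)
    ultimately show ?thesis by (simp add: sums_0 sums_unique2)
  qed
  have exp_bounded: "\<exists>C. \<forall>x\<in>K. \<bar>g x\<bar> \<le> C" if "continuous_on K g" for g :: "'a \<Rightarrow> real"
    using compact_imp_bounded[OF compact_continuous_image[OF that K(1)]]
    by (auto simp: bounded_iff)
  have I: "integrable \<mu> (\<lambda>x. H x * h x)" if h: "continuous_on UNIV h" for h
  proof -
    obtain C where "\<forall>x\<in>K. \<bar>h x\<bar> \<le> C"
      using exp_bounded[OF continuous_on_subset[OF h subset_UNIV]] by blast
    then show ?thesis
      using K(2) by (intro int_mult[of h C] borel_measurable_continuous_onI h) auto
  qed
  have exponential_sum_zero: "continuous_on UNIV g \<and> (\<integral>x. H x * g x \<partial>\<mu>) = 0"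
    if "exponential_sum g" for g
    using that
  proof induction
    case (single a \<omega>)
    have "(\<integral>x. H x * (a * exp (\<omega> \<bullet> x)) \<partial>\<mu>) = (\<integral>x. a * (H x * exp (\<omega> \<bullet> x)) \<partial>\<mu>)"
      by (simp only: mult.left_commute)
    then have "(\<integral>x. H x * (a * exp (\<omega> \<bullet> x)) \<partial>\<mu>) = 0" using exp0[of \<omega>] by simp
    moreover have "continuous_on UNIV (\<lambda>x. a * exp (\<omega> \<bullet> x))" by (intro continuous_intros)
    ultimately show ?case by blast
  next
    case (add f g)
    have "(\<integral>x. H x * (f x + g x) \<partial>\<mu>) = 0" using add I by (simp add: distrib_left)
    moreover have "continuous_on UNIV (\<lambda>x. f x + g x)" using add by (intro continuous_intros) auto
    ultimately show ?case by blast
  qed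
  have cont0: "(\<integral>x. H x * \<psi> x \<partial>\<mu>) = 0" if \<psi>: "continuous_on UNIV \<psi>" for \<psi>
  proof -
    have "\<bar>\<integral>x. H x * \<psi> x \<partial>\<mu>\<bar> \<le> e * (\<integral>x. \<bar>H x\<bar> \<partial>\<mu>)" if e: "0 < e" for e
    proof -
      obtain g where g: "exponential_sum g" "\<And>x. x \<in> K \<Longrightarrow> \<bar>\<psi> x - g x\<bar> < e"
        using exponential_sum_dense[OF K(1) continuous_on_subset[OF \<psi> subset_UNIV] e] by blast
      note g0 = exponential_sum_zero[OF g(1)]
      have "(\<integral>x. H x * \<psi> x \<partial>\<mu>) = (\<integral>x. H x * \<psi> x - H x * g x \<partial>\<mu>)"
        using g0 I \<psi> by simp
      also have "\<bar>\<dots>\<bar> \<le> (\<integral>x. \<bar>H x * \<psi> x - H x * g x\<bar> \<partial>\<mu>)"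
        by (rule integral_abs_bound)
      also have "\<dots> \<le> (\<integral>x. e * \<bar>H x\<bar> \<partial>\<mu>)"
      proof (rule integral_mono_AE)
        show "AE x in \<mu>. \<bar>H x * \<psi> x - H x * g x\<bar> \<le> e * \<bar>H x\<bar>"
          using K(2)
        proof eventually_elim
          fix x assume "x \<in> K"
          then have "\<bar>\<psi> x - g x\<bar> * \<bar>H x\<bar> \<le> e * \<bar>H x\<bar>"
            using g(2) by (intro mult_right_mono) (auto intro: less_imp_le)
          then show "\<bar>H x * \<psi> x - H x * g x\<bar> \<le> e * \<bar>H x\<bar>"
            by (simp add: right_diff_distrib[symmetric] abs_mult mult.commute)
        qed
      qed (use int I g0 \<psi> in auto)
      finally show ?thesis by simp
    qed
    note small = this
    define J where "J = (\<integral>x. \<bar>H x\<bar> \<partial>\<mu>)"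
    have J: "0 \<le> J" unfolding J_def by simp
    have "\<bar>\<integral>x. H x * \<psi> x \<partial>\<mu>\<bar> \<le> e" if "0 < e" for e
    proof -
      have "e / (J + 1) * J \<le> e" using J that by (simp add: field_simps)
      moreover have "0 < e / (J + 1)" using J that by simp
      ultimately show ?thesis using small[of "e / (J + 1)"] unfolding J_def by linarith
    qed
    then show ?thesis by (metis abs_le_zero_iff field_le_epsilon add_0)
  qed
  have closed0: "(\<integral>x. H x * indicator C x \<partial>\<mu>) = 0" if C: "closed C" for C
  proof (cases "C = {}")
    case False
    define \<psi> where "\<psi> n x = max 0 (1 - real n * infdist x C)" for n x
    have \<psi>cont: "continuous_on UNIV (\<psi> n)" for n
      unfolding \<psi>_def by (intro continuous_intros)
    have [measurable]: "\<psi> n \<in> borel_measurable borel" for n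
      by (rule borel_measurable_continuous_onI[OF \<psi>cont])
    have [measurable]: "C \<in> sets borel" using C by simp
    have "(\<lambda>n. \<integral>x. H x * \<psi> n x \<partial>\<mu>) \<longlonglongrightarrow> (\<integral>x. H x * indicator C x \<partial>\<mu>)"
    proof (rule integral_dominated_convergence[where w="\<lambda>x. \<bar>H x\<bar>"])
      show "integrable \<mu> (\<lambda>x. \<bar>H x\<bar>)" using int by simp
      show "AE x in \<mu>. norm (H x * \<psi> n x) \<le> \<bar>H x\<bar>" for n
      proof (rule AE_I2)
        fix x
        have "\<bar>H x\<bar> * \<bar>\<psi> n x\<bar> \<le> \<bar>H x\<bar> * 1"
          using infdist_nonneg[of x C] by (intro mult_left_mono) (auto simp: \<psi>_def)
        then show "norm (H x * \<psi> n x) \<le> \<bar>H x\<bar>" by (simp add: abs_mult)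
      qed
      show "AE x in \<mu>. (\<lambda>n. H x * \<psi> n x) \<longlonglongrightarrow> H x * indicator C x"
      proof (rule AE_I2, rule tendsto_mult_left)
        fix x
        show "(\<lambda>n. \<psi> n x) \<longlonglongrightarrow> indicator C x"
        proof (cases "x \<in> C")
          case True
          then show ?thesis by (simp add: \<psi>_def)
        next
          case x: False
          then have pos: "0 < infdist x C"
            using C False infdist_pos_not_in_closed by blast
          obtain N where N: "1 / infdist x C < real N" using reals_Archimedean2 by blast
          have "\<psi> n x = 0" if "n \<ge> N" for n
          proof -
            have "1 / infdist x C < real n" using N that by linarith
            then show ?thesis using pos by (simp add: \<psi>_def field_simps)
          qed
          then have "eventually (\<lambda>n. \<psi> n x = indicator C x) sequentially"
            using x by (auto simp: eventually_sequentially)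
          then show ?thesis by (rule tendsto_eventually)
        qed
      qed
    qed measurable
    moreover have "(\<integral>x. H x * \<psi> n x \<partial>\<mu>) = 0" for n by (rule cont0[OF \<psi>cont])
    ultimately show ?thesis by (simp add: LIMSEQ_const_iff)
  qed simp
  show ?thesis
  proof (rule density_zero[OF int])
    fix A assume "A \<in> sets \<mu>"
    then have A: "A \<in> sigma_sets UNIV (Collect closed)"
      by (simp add: sets borel_eq_closed)
    have sm: "A \<in> sets \<mu>" if "A \<in> sigma_sets UNIV (Collect closed)" for A :: "'a set"
      using that by (simp add: sets borel_eq_closed)
    have si: "set_integrable \<mu> A H" if "A \<in> sets \<mu>" for A
      unfolding set_integrable_def by (rule integrable_mult_indicator[OF that int])
    have st: "Int_stable (Collect (closed :: 'a set \<Rightarrow> bool))" "Collect (closed :: 'a set \<Rightarrow> bool) \<subseteq> Pow UNIV"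
      by (auto simp: Int_stable_def)
    from st A show "(LINT x:A|\<mu>. H x) = 0"
    proof (induction rule: sigma_sets_induct_disjoint)
      case (basic A)
      then show ?case using closed0[of A] by (simp add: set_lebesgue_integral_def mult.commute)
    next
      case (compl A)
      have "(LINT x:(UNIV - A) \<union> A|\<mu>. H x) = (LINT x:(UNIV - A)|\<mu>. H x) + (LINT x:A|\<mu>. H x)"
        by (rule set_integral_Un) (use sm[OF compl(1)] si in \<open>auto simp: sets\<close>)
      moreover have "(LINT x:(UNIV - A) \<union> A|\<mu>. H x) = 0"
        using mom[of 0 0] by (simp add: set_lebesgue_integral_def)
      ultimately show ?case using compl(2) by simp
    next
      case (union A)
      have "(LINT x:(\<Union>i. A i)|\<mu>. H x) = (\<Sum>i. (LINT x:(A i)|\<mu>. H x))"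
      proof (rule lebesgue_integral_countable_add)
        show "A i \<in> sets \<mu>" for i using union(2) sm by blast
        then show "set_integrable \<mu> (\<Union>i. A i) H" by (intro si sets.countable_UN) auto
        show "A i \<inter> A j = {}" if "i \<noteq> j" for i j
          using union(1) that by (auto simp: disjoint_family_on_def)
      qed
      then show ?case using union(3) by simp
    qed (auto simp: set_lebesgue_integral_def)
  qed
qed

section \<open>Integrals over great circles\<close>

definition great_circle :: "'a::real_vector \<Rightarrow> 'a \<Rightarrow> real \<Rightarrow> 'a"
  where "great_circle x v t = cos t *\<^sub>R x + sin t *\<^sub>R v"

lemma norm_great_circle: "orthonormal_pair x v \<Longrightarrow> norm (great_circle x v t) = 1"
proof -
  assume o: "orthonormal_pair x v"
  then have "x \<bullet> x = 1" "v \<bullet> v = 1" "x \<bullet> v = 0" "v \<bullet> x = 0"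
    by (auto simp: orthonormal_pair_def inner_commute dot_square_norm)
  then have "great_circle x v t \<bullet> great_circle x v t = 1"
    by (simp add: great_circle_def inner_add_left inner_add_right power2_eq_square[symmetric])
  then show ?thesis by (simp add: norm_eq_sqrt_inner)
qed

lemma nn_integral_periodic_shift:
  fixes \<psi> :: "real \<Rightarrow> ennreal"
  assumes [measurable]: "\<psi> \<in> borel_measurable borel"
    and per: "\<And>t. \<psi> (t + p) = \<psi> t" and c: "0 \<le> c" "c \<le> p"
  shows "(\<integral>\<^sup>+t. \<psi> (t + c) * indicator {0..<p} t \<partial>lborel) = (\<integral>\<^sup>+t. \<psi> t * indicator {0..<p} t \<partial>lborel)"
proof -
  have "(\<integral>\<^sup>+t. \<psi> (t + c) * indicator {0..<p} t \<partial>lborel)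
      = (\<integral>\<^sup>+t. \<psi> (c + t) * indicator {c..<p + c} (c + t) \<partial>lborel)"
    by (intro nn_integral_cong) (auto simp: indicator_def add.commute)
  also have "\<dots> = (\<integral>\<^sup>+t. \<psi> t * indicator {c..<p + c} t \<partial>lborel)"
    by (rule nn_integral_lborel_translate) measurable
  also have "\<dots> = (\<integral>\<^sup>+t. \<psi> t * indicator {c..<p} t + \<psi> t * indicator {p..<p + c} t \<partial>lborel)"
    using c by (intro nn_integral_cong) (auto simp: indicator_def)
  also have "\<dots> = (\<integral>\<^sup>+t. \<psi> t * indicator {c..<p} t \<partial>lborel) + (\<integral>\<^sup>+t. \<psi> t * indicator {p..<p + c} t \<partial>lborel)"
    by (rule nn_integral_add) measurable
  also have "(\<integral>\<^sup>+t. \<psi> t * indicator {p..<p + c} t \<partial>lborel)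
      = (\<integral>\<^sup>+t. \<psi> (p + t) * indicator {p..<p + c} (p + t) \<partial>lborel)"
    by (rule nn_integral_lborel_translate[symmetric]) measurable
  also have "\<dots> = (\<integral>\<^sup>+t. \<psi> t * indicator {0..<c} t \<partial>lborel)"
    using per by (intro nn_integral_cong) (auto simp: indicator_def add.commute)
  also have "(\<integral>\<^sup>+t. \<psi> t * indicator {c..<p} t \<partial>lborel) + (\<integral>\<^sup>+t. \<psi> t * indicator {0..<c} t \<partial>lborel)
      = (\<integral>\<^sup>+t. \<psi> t * indicator {c..<p} t + \<psi> t * indicator {0..<c} t \<partial>lborel)"
    by (rule nn_integral_add[symmetric]) measurable
  also have "\<dots> = (\<integral>\<^sup>+t. \<psi> t * indicator {0..<p} t \<partial>lborel)"
    using c by (intro nn_integral_cong) (auto simp: indicator_def)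
  finally show ?thesis .
qed

text \<open>
  The values of \<open>\<phi>\<close> and of its shift over a period have the same distribution. Arguing with
  distributions covers functions that are not integrable, to which the integral assigns the value 0.
\<close>

lemma integral_periodic_shift:
  fixes \<phi> :: "real \<Rightarrow> real"
  assumes [measurable]: "\<phi> \<in> borel_measurable borel"
    and per: "\<And>t. \<phi> (t + p) = \<phi> t" and c: "0 \<le> c" "c \<le> p"
  shows "(LINT t:{0..<p}|lborel. \<phi> (t + c)) = (LINT t:{0..<p}|lborel. \<phi> t)"
proof -
  let ?D = "density lborel (indicator {0..<p})"
  have "distr ?D borel (\<lambda>t. \<phi> (t + c)) = distr ?D borel \<phi>"
  proof (rule measure_eqI)
    fix A assume "A \<in> sets (distr ?D borel (\<lambda>t. \<phi> (t + c)))"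
    then have A[measurable]: "A \<in> sets borel" by simp
    have E: "emeasure (distr ?D borel \<psi>) A = (\<integral>\<^sup>+t. indicator A (\<psi> t) * indicator {0..<p} t \<partial>lborel)"
      if [measurable]: "\<psi> \<in> borel_measurable borel" for \<psi>
    proof -
      have "emeasure (distr ?D borel \<psi>) A = (\<integral>\<^sup>+y. indicator A y \<partial>distr ?D borel \<psi>)" by simp
      also have "\<dots> = (\<integral>\<^sup>+t. indicator A (\<psi> t) \<partial>?D)" by (rule nn_integral_distr) auto
      also have "\<dots> = (\<integral>\<^sup>+t. indicator {0..<p} t * indicator A (\<psi> t) \<partial>lborel)"
        by (rule nn_integral_density) auto
      finally show ?thesis by (simp add: mult.commute)
    qed
    show "emeasure (distr ?D borel (\<lambda>t. \<phi> (t + c))) A = emeasure (distr ?D borel \<phi>) A"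
      by (subst (1 2) E, measurable)
        (rule nn_integral_periodic_shift[of "\<lambda>t. indicator A (\<phi> t)"], measurable, auto simp: per c)
  qed simp
  moreover have "(\<integral>y. y \<partial>distr ?D borel \<psi>) = (LINT t:{0..<p}|lborel. \<psi> t)"
    if [measurable]: "\<psi> \<in> borel_measurable borel" for \<psi> :: "real \<Rightarrow> real"
  proof -
    have D: "?D = density lborel (\<lambda>t. ennreal (indicat_real {0..<p} t))"
      by (simp add: ennreal_indicator)
    have "(\<integral>y. y \<partial>distr ?D borel \<psi>) = (\<integral>t. \<psi> t \<partial>?D)" by (rule integral_distr) auto
    also note D
    also have "(\<integral>t. \<psi> t \<partial>density lborel (\<lambda>t. ennreal (indicat_real {0..<p} t))) = (\<integral>t. indicat_real {0..<p} t *\<^sub>R \<psi> t \<partial>lborel)"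
      by (rule integral_density) auto
    finally show ?thesis by (simp only: D set_lebesgue_integral_def)
  qed
  moreover have "(\<lambda>t. \<phi> (t + c)) \<in> borel_measurable borel" by measurable
  ultimately show ?thesis using assms(1) by metis
qed

lemma LINT_Icc_eq_Ico: "(LINT t:{a..b}|lborel. f t) = (LINT t:{a..<b::real}|lborel. f t)"
  for f :: "real \<Rightarrow> real"
  unfolding set_lebesgue_integral_def
  by (rule integral_discrete_difference[of "{b}"]) (auto simp: indicator_def)

text \<open>
  The substitution \<open>p = cot t\<close>. A density that is homogeneous of degree \<open>- 2\<close> defines a measure on
  the projective line, which can be evaluated on the circle or on the affine line \<open>q = 1\<close>.
\<close>

lemma integral_half_circle_projective:
  fixes h :: "real \<Rightarrow> real \<Rightarrow> real"
  assumes meas[measurable]: "case_prod h \<in> borel_measurable borel"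
    and hom: "\<And>c p q. c \<noteq> 0 \<Longrightarrow> h (c * p) (c * q) = h p q / c\<^sup>2"
  shows "(LINT t:{0..pi}|lborel. h (cos t) (sin t)) = (\<integral>p. h p 1 \<partial>lborel)"
proof -
  \<comment> \<open>The inverse of the cotangent; unlike \<open>arctan (1 / p)\<close> it is smooth at \<open>p = 0\<close>.\<close>
  define g where "g p = pi / 2 - arctan p" for p
  define f where "f t = h (cos t) (sin t)" for t
  have hm: "(\<lambda>t. h (a t) (b t)) \<in> borel_measurable borel"
    if "a \<in> borel_measurable borel" "b \<in> borel_measurable borel" for a b :: "real \<Rightarrow> real"
    using measurable_compose[OF borel_measurable_Pair[OF that] meas] by simp
  have f_meas[measurable]: "f \<in> borel_measurable borel"
    unfolding f_def by (rule hm) measurable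
  have h1_meas[measurable]: "(\<lambda>p. h p 1) \<in> borel_measurable borel"
    by (rule hm) measurable
  have img: "range g = {0<..<pi}"
  proof (intro equalityI subsetI)
    fix t assume "t \<in> {0<..<pi}"
    then have "g (tan (pi / 2 - t)) = t" unfolding g_def by (subst arctan_tan) auto
    then show "t \<in> range g" by (metis rangeI)
  next
    fix t assume "t \<in> range g"
    then obtain p where "t = pi / 2 - arctan p" by (auto simp: g_def)
    then show "t \<in> {0<..<pi}" using arctan_bounded[of p] by auto
  qed
  have key: "\<bar>- 1 / (1 + p\<^sup>2)\<bar> * f (g p) = h p 1" for p
  proof -
    let ?s = "1 / sqrt (1 + p\<^sup>2)"
    have s: "0 < 1 + p\<^sup>2" by (simp add: add_pos_nonneg)
    have "f (g p) = h (sin (arctan p)) (cos (arctan p))"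
      by (simp add: f_def g_def cos_diff sin_diff)
    also have "\<dots> = h (?s * p) (?s * 1)" by (simp add: sin_arctan cos_arctan)
    also have "\<dots> = h p 1 / ?s\<^sup>2" using s by (intro hom) auto
    also have "\<dots> = (1 + p\<^sup>2) * h p 1" using s by (simp add: power_divide)
    finally have "f (g p) = (1 + p\<^sup>2) * h p 1" .
    moreover have "\<bar>- 1 / (1 + p\<^sup>2)\<bar> * (1 + p\<^sup>2) = 1" using s by (simp add: abs_divide)
    ultimately show ?thesis by (metis mult.assoc mult_1)
  qed
  have cv: "(\<lambda>p. \<bar>- 1 / (1 + p\<^sup>2)\<bar> * f (g p)) absolutely_integrable_on UNIV \<and>
      integral UNIV (\<lambda>p. \<bar>- 1 / (1 + p\<^sup>2)\<bar> * f (g p)) = b \<longleftrightarrow>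
      f absolutely_integrable_on g ` UNIV \<and> integral (g ` UNIV) f = b" for b
  proof (rule has_absolute_integral_change_of_variables_1')
    show "(g has_field_derivative - 1 / (1 + p\<^sup>2)) (at p within UNIV)" for p
    proof -
      have "((\<lambda>p. pi / 2 - arctan p) has_field_derivative 0 - inverse (1 + p\<^sup>2)) (at p within UNIV)"
        by (rule DERIV_diff[OF DERIV_const DERIV_arctan])
      then show ?thesis by (simp add: g_def[abs_def] inverse_eq_divide)
    qed
    show "inj_on g UNIV" by (auto simp: inj_on_def g_def) (metis tan_arctan)
  qed simp
  then have cv': "(\<lambda>p. h p 1) absolutely_integrable_on UNIV \<and> integral UNIV (\<lambda>p. h p 1) = b \<longleftrightarrow>
      f absolutely_integrable_on {0<..<pi} \<and> integral {0<..<pi} f = b" for b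
    unfolding key img .
  have abs1: "(\<lambda>p. h p 1) absolutely_integrable_on UNIV \<longleftrightarrow> integrable lborel (\<lambda>p. h p 1)"
    by (simp add: set_integrable_def integrable_completion)
  have abs2: "f absolutely_integrable_on {0<..<pi} \<longleftrightarrow> set_integrable lborel {0<..<pi} f"
    by (simp add: set_integrable_def integrable_completion)
  have "(LINT t:{0..pi}|lborel. f t) = (LINT t:{0<..<pi}|lborel. f t)"
    unfolding set_lebesgue_integral_def
    by (rule integral_discrete_difference[of "{0, pi}"]) (auto simp: indicator_def)
  also have "\<dots> = (\<integral>p. h p 1 \<partial>lborel)"
  proof (cases "integrable lborel (\<lambda>p. h p 1)")
    case True
    then have 2: "set_integrable lborel {0<..<pi} f" "integral {0<..<pi} f = integral UNIV (\<lambda>p. h p 1)"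
      using cv'[of "integral UNIV (\<lambda>p. h p 1)"] abs1 abs2 by auto
    have "set_integrable lborel UNIV (\<lambda>p. h p 1)" using True by (simp add: set_integrable_def)
    then have "(LINT p:UNIV|lborel. h p 1) = integral UNIV (\<lambda>p. h p 1)"
      by (rule set_borel_integral_eq_integral)
    moreover have "(LINT t:{0<..<pi}|lborel. f t) = integral {0<..<pi} f"
      using 2(1) by (rule set_borel_integral_eq_integral)
    ultimately show ?thesis using 2(2) by (simp add: set_lebesgue_integral_def)
  next
    case False
    then have "\<not> set_integrable lborel {0<..<pi} f"
      using cv'[of "integral {0<..<pi} f"] abs1 abs2 by auto
    then show ?thesis using False
      by (simp add: set_lebesgue_integral_def set_integrable_def not_integrable_integral_eq)
  qed
  finally show ?thesis by (simp add: f_def)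
qed

text \<open>
  How the integral over a great semicircle changes when the orthonormal basis \<open>x, v\<close> of its plane is
  replaced by a basis \<open>r x, \<alpha> x + \<beta> v\<close>. Along the affine line of the previous lemma the change of
  basis is an affine substitution, whose determinant produces the factor \<open>1 / (r * \<beta>)\<close>.
\<close>

lemma integral_half_circle_plane:
  fixes F :: "'a::euclidean_space \<Rightarrow> real"
  assumes [measurable]: "F \<in> borel_measurable borel"
    and hom: "\<And>c y. c \<noteq> 0 \<Longrightarrow> F (c *\<^sub>R y) = F y"
    and o: "norm x = 1" "norm v = 1" "x \<bullet> v = 0"
    and r: "0 < r" and \<beta>: "0 < \<beta>"
  shows "(LINT t:{0..pi}|lborel. F (great_circle (r *\<^sub>R x) (\<alpha> *\<^sub>R x + \<beta> *\<^sub>R v) t)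
            / (norm (great_circle (r *\<^sub>R x) (\<alpha> *\<^sub>R x + \<beta> *\<^sub>R v) t))\<^sup>2)
       = (LINT t:{0..pi}|lborel. F (great_circle x v t)) / (r * \<beta>)"
proof -
  let ?w = "\<alpha> *\<^sub>R x + \<beta> *\<^sub>R v"
  have hom2: "F (p *\<^sub>R (c *\<^sub>R y)) = F (p *\<^sub>R y)" if "c \<noteq> 0" for p c y
    using hom[OF that, of "p *\<^sub>R y"] by (simp add: mult.commute)
  have P: "(LINT t:{0..pi}|lborel. F (great_circle y z t) / (norm (great_circle y z t))\<^sup>2)
      = (\<integral>p. F (p *\<^sub>R y + z) / (norm (p *\<^sub>R y + z))\<^sup>2 \<partial>lborel)" for y z :: 'a
  proof -
    define h where "h p q = F (p *\<^sub>R y + q *\<^sub>R z) / (norm (p *\<^sub>R y + q *\<^sub>R z))\<^sup>2" for p q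
    have "(LINT t:{0..pi}|lborel. h (cos t) (sin t)) = (\<integral>p. h p 1 \<partial>lborel)"
    proof (rule integral_half_circle_projective)
      show "case_prod h \<in> borel_measurable borel"
        unfolding h_def borel_prod[symmetric] by measurable
      fix c p q :: real assume c: "c \<noteq> 0"
      have "(c * p) *\<^sub>R y + (c * q) *\<^sub>R z = c *\<^sub>R (p *\<^sub>R y + q *\<^sub>R z)"
        by (simp add: scaleR_add_right)
      then show "h (c * p) (c * q) = h p q / c\<^sup>2"
        using hom[OF c, of "p *\<^sub>R y + q *\<^sub>R z"] by (simp add: h_def power_mult_distrib)
    qed
    then show ?thesis by (simp add: h_def great_circle_def)
  qed
  have xv: "x \<bullet> x = 1" "v \<bullet> v = 1" "v \<bullet> x = 0" using o by (auto simp: dot_square_norm inner_commute)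
  have n1: "norm (great_circle x v t) = 1" for t
  proof -
    have "great_circle x v t \<bullet> great_circle x v t = 1"
      using xv o by (simp add: great_circle_def inner_add_left inner_add_right power2_eq_square[symmetric])
    then show ?thesis by (simp add: norm_eq_sqrt_inner)
  qed
  define k where "k q = F (q *\<^sub>R x + v) / (norm (q *\<^sub>R x + v))\<^sup>2" for q
  have "(LINT t:{0..pi}|lborel. F (great_circle (r *\<^sub>R x) ?w t) / (norm (great_circle (r *\<^sub>R x) ?w t))\<^sup>2)
      = (\<integral>p. F (p *\<^sub>R r *\<^sub>R x + ?w) / (norm (p *\<^sub>R r *\<^sub>R x + ?w))\<^sup>2 \<partial>lborel)"
    by (rule P)
  also have "\<dots> = (\<integral>p. k (\<alpha> / \<beta> + (r / \<beta>) * p) / \<beta>\<^sup>2 \<partial>lborel)"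
  proof (rule Bochner_Integration.integral_cong[OF refl])
    fix p
    have "p *\<^sub>R r *\<^sub>R x + ?w = \<beta> *\<^sub>R ((\<alpha> / \<beta> + (r / \<beta>) * p) *\<^sub>R x + v)"
      using \<beta> by (simp add: scaleR_add_right algebra_simps)
    then show "F (p *\<^sub>R r *\<^sub>R x + ?w) / (norm (p *\<^sub>R r *\<^sub>R x + ?w))\<^sup>2 = k (\<alpha> / \<beta> + (r / \<beta>) * p) / \<beta>\<^sup>2"
      using \<beta> by (simp add: hom k_def power_mult_distrib)
  qed
  also have "\<dots> = (\<integral>p. k (\<alpha> / \<beta> + (r / \<beta>) * p) \<partial>lborel) / \<beta>\<^sup>2" by simp
  also have "(\<integral>p. k (\<alpha> / \<beta> + (r / \<beta>) * p) \<partial>lborel) = \<beta> / r * (\<integral>q. k q \<partial>lborel)"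
    using lborel_integral_real_affine[of "r / \<beta>" k "\<alpha> / \<beta>"] r \<beta> by (simp add: field_simps)
  also have "(\<integral>q. k q \<partial>lborel) = (LINT t:{0..pi}|lborel. F (great_circle x v t))"
    using P[of x v] n1 by (simp add: k_def)
  finally show ?thesis using r \<beta> by (simp add: field_simps power2_eq_square)
qed

section \<open>Weights on pairs of vectors\<close>

text \<open>
  The square of the area of the parallelogram spanned by \<open>u\<close> and \<open>w\<close>.
\<close>

definition gram :: "'a::real_inner \<Rightarrow> 'a \<Rightarrow> real"
  where "gram u w = (norm u)\<^sup>2 * (norm w)\<^sup>2 - (u \<bullet> w)\<^sup>2"

text \<open>
  The contraction of the bivector \<open>u \<and> w\<close> with \<open>\<omega>\<close>. Its squared norm is the squared area times the
  squared norm of the orthogonal projection of \<open>\<omega>\<close> to the plane of \<open>u\<close> and \<open>w\<close>.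
\<close>

definition contraction :: "'a::real_inner \<Rightarrow> 'a \<Rightarrow> 'a \<Rightarrow> 'a"
  where "contraction \<omega> u w = (u \<bullet> \<omega>) *\<^sub>R w - (w \<bullet> \<omega>) *\<^sub>R u"

text \<open>
  The test functions on pairs of vectors: the \<open>2 k\<close>-th power of the length of the projection of \<open>\<omega>\<close>
  to the plane of \<open>u\<close> and \<open>w\<close>, times the squared area, cut off to a ball of pairs. Each of the three
  factors is invariant under rotations of the pair in its plane. The squared area compensates the
  singularity of \<open>1 / (norm u)\<^sup>2\<close> in the integrals below.
\<close>

definition plane_weight :: "nat \<Rightarrow> 'a::euclidean_space \<Rightarrow> 'a \<Rightarrow> 'a \<Rightarrow> real"
  where "plane_weight k \<omega> u w =
    (if (norm u)\<^sup>2 + (norm w)\<^sup>2 < 1 then ((norm (contraction \<omega> u w))\<^sup>2 / gram u w) ^ k * gram u w else 0)"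

definition rejection :: "'a::real_inner \<Rightarrow> 'a \<Rightarrow> 'a"
  where "rejection x w = w - (w \<bullet> x) *\<^sub>R x"

lemma rejection_facts:
  assumes "norm x = 1"
  shows "rejection x w \<bullet> x = 0" "x \<bullet> rejection x w = 0"
    "(norm (rejection x w))\<^sup>2 = (norm w)\<^sup>2 - (w \<bullet> x)\<^sup>2"
    "w = (w \<bullet> x) *\<^sub>R x + rejection x w"
proof -
  have xx: "x \<bullet> x = 1" using assms by (simp add: dot_square_norm)
  show "rejection x w \<bullet> x = 0" "x \<bullet> rejection x w = 0"
    by (simp_all add: rejection_def inner_diff_left inner_diff_right xx inner_commute)
  show "(norm (rejection x w))\<^sup>2 = (norm w)\<^sup>2 - (w \<bullet> x)\<^sup>2"
    unfolding rejection_def power2_norm_eq_inner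
    by (simp add: inner_diff_left inner_diff_right xx inner_commute power2_eq_square)
  show "w = (w \<bullet> x) *\<^sub>R x + rejection x w" by (simp add: rejection_def)
qed

lemma gram_scaled:
  assumes "norm x = 1"
  shows "gram (r *\<^sub>R x) w = r\<^sup>2 * (norm (rejection x w))\<^sup>2"
  using assms by (simp add: gram_def rejection_facts power_mult_distrib inner_commute algebra_simps)

lemma norm_contraction_scaled:
  assumes x: "norm x = 1"
  shows "(norm (contraction \<omega> (r *\<^sub>R x) w))\<^sup>2
    = r\<^sup>2 * ((x \<bullet> \<omega>)\<^sup>2 * (norm (rejection x w))\<^sup>2 + (rejection x w \<bullet> \<omega>)\<^sup>2)"
proof -
  define p where "p = rejection x w"
  have p: "p \<bullet> x = 0" "x \<bullet> p = 0" "w = (w \<bullet> x) *\<^sub>R x + p" "x \<bullet> x = 1"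
    using rejection_facts[OF x, of w] x by (auto simp: p_def dot_square_norm)
  have "contraction \<omega> (r *\<^sub>R x) w = r *\<^sub>R ((x \<bullet> \<omega>) *\<^sub>R p - (p \<bullet> \<omega>) *\<^sub>R x)"
    unfolding contraction_def
    by (subst (1 2) p(3)) (simp add: inner_add_left algebra_simps)
  then have "(norm (contraction \<omega> (r *\<^sub>R x) w))\<^sup>2 = r\<^sup>2 * (norm ((x \<bullet> \<omega>) *\<^sub>R p - (p \<bullet> \<omega>) *\<^sub>R x))\<^sup>2"
    by (simp add: power_mult_distrib)
  also have "(norm ((x \<bullet> \<omega>) *\<^sub>R p - (p \<bullet> \<omega>) *\<^sub>R x))\<^sup>2 = (x \<bullet> \<omega>)\<^sup>2 * (norm p)\<^sup>2 + (p \<bullet> \<omega>)\<^sup>2"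
    unfolding power2_norm_eq_inner
    by (simp add: inner_diff_left inner_diff_right p power2_eq_square)
  finally show ?thesis by (simp add: p_def)
qed

lemma plane_weight_scaled:
  assumes x: "norm x = 1" and r: "0 < r"
  shows "plane_weight k \<omega> (r *\<^sub>R x) w = (if (norm w)\<^sup>2 < 1 - r\<^sup>2
    then r\<^sup>2 * ((norm (rejection x w))\<^sup>2 * ((x \<bullet> \<omega>)\<^sup>2 + (rejection x w \<bullet> \<omega>)\<^sup>2 / (norm (rejection x w))\<^sup>2) ^ k)
    else 0)"
proof (cases "rejection x w = 0")
  case False
  have "(norm (contraction \<omega> (r *\<^sub>R x) w))\<^sup>2 / gram (r *\<^sub>R x) w
      = (x \<bullet> \<omega>)\<^sup>2 + (rejection x w \<bullet> \<omega>)\<^sup>2 / (norm (rejection x w))\<^sup>2"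
    using False r by (simp add: norm_contraction_scaled[OF x] gram_scaled[OF x] add_divide_distrib)
  then show ?thesis using x r by (auto simp: plane_weight_def gram_scaled)
next
  case True
  then have "gram (r *\<^sub>R x) w = 0" using x by (simp add: gram_scaled)
  then show ?thesis using True by (simp add: plane_weight_def)
qed

lemma plane_weight_bounds:
  "0 \<le> plane_weight k \<omega> u w"
  "plane_weight k \<omega> u w \<le> (if u \<in> ball 0 1 \<and> w \<in> ball 0 1 then (2 * (norm \<omega>)\<^sup>2) ^ k * (norm u)\<^sup>2 else 0)"
proof -
  have "0 \<le> plane_weight k \<omega> u w \<and>
    plane_weight k \<omega> u w \<le> (if u \<in> ball 0 1 \<and> w \<in> ball 0 1 then (2 * (norm \<omega>)\<^sup>2) ^ k * (norm u)\<^sup>2 else 0)"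
  proof (cases "u = 0")
    case True
    then have "gram u w = 0" by (simp add: gram_def)
    then show ?thesis using True by (simp add: plane_weight_def)
  next
    case False
    define x r p where "x = sgn u" and "r = norm u" and "p = rejection x w"
    have x: "norm x = 1" and r: "0 < r" and u: "u = r *\<^sub>R x"
      using False by (auto simp: x_def r_def norm_sgn sgn_div_norm)
    define q where "q = (x \<bullet> \<omega>)\<^sup>2 + (p \<bullet> \<omega>)\<^sup>2 / (norm p)\<^sup>2"
    have cs: "(y \<bullet> \<omega>)\<^sup>2 \<le> (norm y)\<^sup>2 * (norm \<omega>)\<^sup>2" for y
      using Cauchy_Schwarz_ineq[of y \<omega>] by (simp add: power2_norm_eq_inner)
    have q: "0 \<le> q" "q \<le> 2 * (norm \<omega>)\<^sup>2"
    proof -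
      have "(p \<bullet> \<omega>)\<^sup>2 / (norm p)\<^sup>2 \<le> (norm \<omega>)\<^sup>2"
        using cs[of p] by (cases "p = 0") (auto simp: field_simps)
      then show "q \<le> 2 * (norm \<omega>)\<^sup>2" using cs[of x] x by (simp add: q_def)
    qed (simp add: q_def)
    have W: "plane_weight k \<omega> u w = (if (norm w)\<^sup>2 < 1 - r\<^sup>2 then r\<^sup>2 * ((norm p)\<^sup>2 * q ^ k) else 0)"
      unfolding u plane_weight_scaled[OF x r] p_def q_def by simp
    show ?thesis
    proof (cases "(norm w)\<^sup>2 < 1 - r\<^sup>2")
      case True
      have sq: "0 \<le> r\<^sup>2" "0 \<le> (norm w)\<^sup>2" "0 \<le> (w \<bullet> x)\<^sup>2" by simp_all
      then have "(norm w)\<^sup>2 < 1" "r\<^sup>2 < 1" using True by linarith+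
      then have ball: "u \<in> ball 0 1" "w \<in> ball 0 1"
        by (simp_all add: r_def abs_square_less_1 power_less_one_iff)
      have "(norm p)\<^sup>2 \<le> 1"
        unfolding p_def using rejection_facts(3)[OF x, of w] sq \<open>(norm w)\<^sup>2 < 1\<close> by linarith
      then have "(norm p)\<^sup>2 * q ^ k \<le> 1 * (2 * (norm \<omega>)\<^sup>2) ^ k"
        using q by (intro mult_mono power_mono) auto
      then have "r\<^sup>2 * ((norm p)\<^sup>2 * q ^ k) \<le> r\<^sup>2 * (2 * (norm \<omega>)\<^sup>2) ^ k"
        by (intro mult_left_mono) auto
      then show ?thesis using True ball q by (simp add: W r_def mult.commute)
    qed (use q in \<open>simp add: W\<close>)
  qed
  then show "0 \<le> plane_weight k \<omega> u w"
    "plane_weight k \<omega> u w \<le> (if u \<in> ball 0 1 \<and> w \<in> ball 0 1 then (2 * (norm \<omega>)\<^sup>2) ^ k * (norm u)\<^sup>2 else 0)"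
    by auto
qed

definition plane_rotation :: "real \<Rightarrow> 'a::real_vector \<times> 'a \<Rightarrow> 'a \<times> 'a"
  where "plane_rotation \<theta> z = (great_circle (fst z) (snd z) \<theta>, great_circle (snd z) (- fst z) \<theta>)"

lemma orthogonal_transformation_plane_rotation:
  "orthogonal_transformation (plane_rotation \<theta> :: 'a::real_inner \<times> 'a \<Rightarrow> _)"
  unfolding orthogonal_transformation_def
proof (intro conjI allI)
  show "linear (plane_rotation \<theta> :: 'a \<times> 'a \<Rightarrow> _)"
    by (rule linearI) (auto simp: plane_rotation_def great_circle_def algebra_simps)
  fix y z :: "'a \<times> 'a"
  have "plane_rotation \<theta> y \<bullet> plane_rotation \<theta> z
      = ((cos \<theta>)\<^sup>2 + (sin \<theta>)\<^sup>2) * (fst y \<bullet> fst z) + ((cos \<theta>)\<^sup>2 + (sin \<theta>)\<^sup>2) * (snd y \<bullet> snd z)"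
    by (simp add: plane_rotation_def great_circle_def inner_prod_def inner_add_left inner_add_right
        inner_diff_left inner_diff_right power2_eq_square algebra_simps del: sin_cos_squared_add sin_cos_squared_add2 sin_cos_squared_add3)
  then show "plane_rotation \<theta> y \<bullet> plane_rotation \<theta> z = y \<bullet> z" by (simp add: inner_prod_def)
qed

lemma plane_weight_rotation:
  "plane_weight k \<omega> (great_circle u w \<theta>) (great_circle w (- u) \<theta>) = plane_weight k \<omega> u w"
proof -
  let ?c = "cos \<theta>" and ?s = "sin \<theta>"
  let ?u = "great_circle u w \<theta>" and ?w = "great_circle w (- u) \<theta>"
  have cs: "?c\<^sup>2 + ?s\<^sup>2 = 1" by simp
  have uw: "?u \<bullet> ?u = ?c\<^sup>2 * (u \<bullet> u) + 2 * ?c * ?s * (u \<bullet> w) + ?s\<^sup>2 * (w \<bullet> w)"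
    "?w \<bullet> ?w = ?c\<^sup>2 * (w \<bullet> w) - 2 * ?c * ?s * (u \<bullet> w) + ?s\<^sup>2 * (u \<bullet> u)"
    "?u \<bullet> ?w = ?c * ?s * (w \<bullet> w) - ?c * ?s * (u \<bullet> u) + (?c\<^sup>2 - ?s\<^sup>2) * (u \<bullet> w)"
    by (simp_all add: great_circle_def inner_add_left inner_add_right inner_diff_left inner_diff_right
        inner_commute power2_eq_square algebra_simps)
  have "gram ?u ?w = (?c\<^sup>2 + ?s\<^sup>2)\<^sup>2 * gram u w"
    unfolding gram_def power2_norm_eq_inner uw by algebra
  then have g: "gram ?u ?w = gram u w" by simp
  have "contraction \<omega> ?u ?w = (?c\<^sup>2 + ?s\<^sup>2) *\<^sub>R contraction \<omega> u w"
    by (simp add: contraction_def great_circle_def inner_add_left inner_diff_left power2_eq_square algebra_simps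
        del: sin_cos_squared_add sin_cos_squared_add2 sin_cos_squared_add3)
  then have c: "contraction \<omega> ?u ?w = contraction \<omega> u w" by simp
  have "(norm ?u)\<^sup>2 + (norm ?w)\<^sup>2 = (?c\<^sup>2 + ?s\<^sup>2) * ((norm u)\<^sup>2 + (norm w)\<^sup>2)"
    unfolding power2_norm_eq_inner uw by algebra
  then have n: "(norm ?u)\<^sup>2 + (norm ?w)\<^sup>2 = (norm u)\<^sup>2 + (norm w)\<^sup>2" by simp
  show ?thesis by (simp add: plane_weight_def g c n)
qed

lemma plane_weight_measurable [measurable]:
  "(\<lambda>z. plane_weight k \<omega> (fst z) (snd z)) \<in> borel_measurable (borel \<Otimes>\<^sub>M (borel :: 'a::euclidean_space measure))"
  unfolding plane_weight_def gram_def contraction_def by measurable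

section \<open>Weighted averages of circle integrals\<close>

text \<open>
  Functions on the space of lines through the origin; on the sphere these are the even functions.
\<close>

definition projective :: "('a::real_vector \<Rightarrow> 'b) \<Rightarrow> bool"
  where "projective F \<longleftrightarrow> (\<forall>c y. c \<noteq> 0 \<longrightarrow> F (c *\<^sub>R y) = F y)"

lemma projectiveD: "projective F \<Longrightarrow> c \<noteq> 0 \<Longrightarrow> F (c *\<^sub>R y) = F y"
  by (simp add: projective_def)

lemma projective_sgn: "projective F \<Longrightarrow> F (sgn u) = F u" for F :: "'a::real_normed_vector \<Rightarrow> 'b"
  using projectiveD[of F "inverse (norm u)" u] by (cases "u = 0") (auto simp: sgn_div_norm)

text \<open>
  The integral over half of the great circle in the plane of \<open>u\<close> and \<open>w\<close>. An orthonormal basis of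
  the plane is obtained from the pair by the Gram-Schmidt process.
\<close>

definition circle_integral :: "('a::euclidean_space \<Rightarrow> real) \<Rightarrow> 'a \<Rightarrow> 'a \<Rightarrow> real"
  where "circle_integral F u w =
    (LINT t:{0..pi}|lborel. F (great_circle (sgn u) (sgn (rejection (sgn u) w)) t))"

definition weighted_integral :: "nat \<Rightarrow> 'a::euclidean_space \<Rightarrow> ('a \<Rightarrow> real) \<Rightarrow> real"
  where "weighted_integral k \<omega> F =
    (\<integral>z. F (fst z) / (norm (fst z))\<^sup>2 * plane_weight k \<omega> (fst z) (snd z) \<partial>lborel)"

lemma weighted_integrand_integrable:
  fixes F :: "'a::euclidean_space \<Rightarrow> real"
  assumes F[measurable]: "F \<in> borel_measurable borel" and int: "set_integrable lborel (ball 0 1) F"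
  shows "integrable lborel (\<lambda>z. F (fst z) / (norm (fst z))\<^sup>2 * plane_weight k \<omega> (fst z) (snd z))"
    (is "integrable _ ?g")
proof (rule Bochner_Integration.integrable_bound)
  let ?C = "(2 * (norm \<omega>)\<^sup>2) ^ k"
  let ?h = "\<lambda>z :: 'a \<times> 'a. indicator (ball 0 1) (fst z) * F (fst z) * indicator (ball 0 1) (snd z) :: real"
  have [measurable]: "ball (0::'a) 1 \<in> sets borel" by simp
  have "integrable (lborel \<Otimes>\<^sub>M lborel) (\<lambda>(u, w :: 'a). (indicat_real (ball 0 1) u * F u) * indicat_real (ball 0 1) w)"
  proof (rule lborel_pair.Fubini_integrable)
    show "(\<lambda>(u, w :: 'a). (indicat_real (ball 0 1) u * F u) * indicat_real (ball 0 1) w)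
        \<in> borel_measurable (lborel \<Otimes>\<^sub>M lborel)"
      by measurable
    have "integrable lborel (\<lambda>u. \<bar>indicat_real (ball 0 1) u * F u\<bar> * measure lborel (ball (0::'a) 1))"
      using int by (intro integrable_mult_left integrable_abs) (simp add: set_integrable_def)
    then show "integrable lborel (\<lambda>u. \<integral>w. norm (case (u, w :: 'a) of (u, w) \<Rightarrow>
        (indicat_real (ball 0 1) u * F u) * indicat_real (ball 0 1) w) \<partial>lborel)"
      by (simp add: abs_mult)
    show "AE u in lborel. integrable lborel (\<lambda>w. case (u, w :: 'a) of (u, w) \<Rightarrow>
        (indicat_real (ball 0 1) u * F u) * indicat_real (ball 0 1) w)"
      using emeasure_lborel_ball_finite[of "0::'a" 1] by (intro AE_I2) simp
  qed
  then show "integrable lborel (\<lambda>z. ?C * ?h z)"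
    by (simp add: lborel_prod case_prod_unfold)
  show "?g \<in> borel_measurable lborel"
  proof -
    have "?g \<in> borel_measurable (borel \<Otimes>\<^sub>M borel)" by measurable
    then show ?thesis by (simp add: borel_prod)
  qed
  show "AE z in lborel. norm (?g z) \<le> norm (?C * ?h z)"
  proof (rule AE_I2)
    fix z :: "'a \<times> 'a"
    obtain u w where z: "z = (u, w)" by (cases z)
    note W = plane_weight_bounds[of k \<omega> u w]
    show "norm (?g z) \<le> norm (?C * ?h z)"
    proof (cases "u \<in> ball 0 1 \<and> w \<in> ball 0 1 \<and> u \<noteq> 0")
      case True
      then have "\<bar>F u\<bar> / (norm u)\<^sup>2 * plane_weight k \<omega> u w \<le> \<bar>F u\<bar> / (norm u)\<^sup>2 * (?C * (norm u)\<^sup>2)"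
        using W(2) by (intro mult_left_mono) auto
      then show ?thesis using True W(1) by (simp add: z abs_mult mult.commute)
    next
      case False
      then have "plane_weight k \<omega> u w = 0"
        using W by (cases "u = 0") (auto split: if_splits)
      then show ?thesis by (simp add: z)
    qed
  qed
qed

text \<open>
  The heart of the inversion. Lebesgue measure on pairs and \<open>plane_weight\<close> are invariant under
  \<open>plane_rotation \<theta>\<close>, so the weighted integral may be averaged over \<open>\<theta>\<close>. By Fubini the average over
  \<open>\<theta>\<close> becomes the inner integral, which runs over half of the great circle in the plane of the pair.
\<close>

lemma weighted_integral_rotate:
  fixes F :: "'a::euclidean_space \<Rightarrow> real"
  assumes F[measurable]: "F \<in> borel_measurable borel" and int: "set_integrable lborel (ball 0 1) F"
  shows "pi * weighted_integral k \<omega> F = (\<integral>z. plane_weight k \<omega> (fst z) (snd z) *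
      (LINT t:{0..pi}|lborel. F (great_circle (fst z) (snd z) t) / (norm (great_circle (fst z) (snd z) t))\<^sup>2) \<partial>lborel)"
proof -
  define g where "g z = F (fst z) / (norm (fst z))\<^sup>2 * plane_weight k \<omega> (fst z) (snd z)" for z
  have g_meas[measurable]: "g \<in> borel_measurable borel"
    unfolding g_def borel_prod[symmetric] by measurable
  have g_int: "integrable lborel g"
    unfolding g_def by (rule weighted_integrand_integrable[OF F int])
  have rot: "g (plane_rotation \<theta> z) = F (great_circle (fst z) (snd z) \<theta>)
      / (norm (great_circle (fst z) (snd z) \<theta>))\<^sup>2 * plane_weight k \<omega> (fst z) (snd z)" for \<theta> z
    by (simp add: g_def plane_rotation_def plane_weight_rotation)
  define f where "f \<theta> z = indicat_real {0..pi} \<theta> * g (plane_rotation \<theta> z)" for \<theta> z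
  have "(\<lambda>y. plane_rotation (fst y) (snd y) :: 'a \<times> 'a) \<in> borel_measurable (lborel \<Otimes>\<^sub>M lborel)"
    unfolding lborel_prod plane_rotation_def great_circle_def
    by (simp, intro borel_measurable_continuous_onI continuous_intros)
  then have rot_meas[measurable]: "(\<lambda>y. g (plane_rotation (fst y) (snd y))) \<in> borel_measurable (lborel \<Otimes>\<^sub>M lborel)"
    by (rule measurable_compose[OF _ g_meas])
  have f_meas: "(\<lambda>(\<theta>, z). f \<theta> z) \<in> borel_measurable (lborel \<Otimes>\<^sub>M lborel)"
    unfolding f_def case_prod_unfold by measurable
  have inner: "(\<integral>z. G (plane_rotation \<theta> z) \<partial>lborel) = (\<integral>z. G z \<partial>lborel)"
    if "G \<in> borel_measurable borel" for \<theta> and G :: "'a \<times> 'a \<Rightarrow> real"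
    by (rule integral_lborel_orthogonal[OF orthogonal_transformation_plane_rotation that])
  have int_rot: "integrable lborel (\<lambda>z. g (plane_rotation \<theta> z))" for \<theta>
    by (rule integrable_lborel_orthogonal[OF orthogonal_transformation_plane_rotation g_int])
  have f_int: "integrable (lborel \<Otimes>\<^sub>M lborel) (\<lambda>(\<theta>, z). f \<theta> z)"
  proof (rule lborel_pair.Fubini_integrable[OF f_meas])
    have "(\<integral>z. norm (case (\<theta>, z) of (\<theta>, z) \<Rightarrow> f \<theta> z) \<partial>lborel) = indicat_real {0..pi} \<theta> * (\<integral>z. \<bar>g z\<bar> \<partial>lborel)" for \<theta>
      using inner[of "\<lambda>z. \<bar>g z\<bar>" \<theta>] by (simp add: f_def abs_mult)
    moreover have "integrable lborel (\<lambda>\<theta>. indicat_real {0..pi} \<theta> * (\<integral>z. \<bar>g z\<bar> \<partial>lborel))"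
      by (intro integrable_mult_left) simp
    ultimately show "integrable lborel (\<lambda>\<theta>. \<integral>z. norm (case (\<theta>, z) of (\<theta>, z) \<Rightarrow> f \<theta> z) \<partial>lborel)" by simp
    show "AE \<theta> in lborel. integrable lborel (\<lambda>z. case (\<theta>, z) of (\<theta>, z) \<Rightarrow> f \<theta> z)"
      using int_rot by (intro AE_I2) (simp add: f_def)
  qed
  have "pi * weighted_integral k \<omega> F = (\<integral>\<theta>. indicat_real {0..pi} \<theta> * (\<integral>z. g z \<partial>lborel) \<partial>lborel)"
    by (simp add: weighted_integral_def g_def)
  also have "\<dots> = (\<integral>\<theta>. \<integral>z. f \<theta> z \<partial>lborel \<partial>lborel)"
    using inner[OF g_meas] by (simp add: f_def)
  also have "\<dots> = (\<integral>z. \<integral>\<theta>. f \<theta> z \<partial>lborel \<partial>lborel)"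
    by (rule lborel_pair.Fubini_integral[OF f_int, symmetric])
  also have "\<dots> = (\<integral>z. plane_weight k \<omega> (fst z) (snd z) *
      (LINT t:{0..pi}|lborel. F (great_circle (fst z) (snd z) t) / (norm (great_circle (fst z) (snd z) t))\<^sup>2) \<partial>lborel)"
  proof (rule Bochner_Integration.integral_cong[OF refl])
    fix z :: "'a \<times> 'a"
    have "(\<integral>\<theta>. f \<theta> z \<partial>lborel) = (\<integral>\<theta>. plane_weight k \<omega> (fst z) (snd z) * (indicat_real {0..pi} \<theta> *\<^sub>R
        (F (great_circle (fst z) (snd z) \<theta>) / (norm (great_circle (fst z) (snd z) \<theta>))\<^sup>2)) \<partial>lborel)"
      by (intro Bochner_Integration.integral_cong[OF refl]) (simp add: f_def rot mult_ac)
    then show "(\<integral>\<theta>. f \<theta> z \<partial>lborel) = plane_weight k \<omega> (fst z) (snd z) *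
      (LINT t:{0..pi}|lborel. F (great_circle (fst z) (snd z) t) / (norm (great_circle (fst z) (snd z) t))\<^sup>2)"
      by (simp only: set_lebesgue_integral_def integral_mult_right_zero)
  qed
  finally show ?thesis .
qed

lemma plane_integral_eq_circle_integral:
  fixes F :: "'a::euclidean_space \<Rightarrow> real"
  assumes F: "F \<in> borel_measurable borel" "projective F"
    and u: "u \<noteq> 0" and w: "rejection (sgn u) w \<noteq> 0"
  shows "(LINT t:{0..pi}|lborel. F (great_circle u w t) / (norm (great_circle u w t))\<^sup>2)
    = circle_integral F u w / (norm u * norm (rejection (sgn u) w))"
proof -
  define x p where "x = sgn u" and "p = rejection x w"
  have x: "norm x = 1" using u by (simp add: x_def norm_sgn)
  have eq: "u = norm u *\<^sub>R x" "w = (w \<bullet> x) *\<^sub>R x + norm p *\<^sub>R sgn p"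
    using u w rejection_facts(4)[OF x, of w] by (auto simp: x_def p_def sgn_div_norm)
  have "x \<bullet> p = 0" using rejection_facts[OF x] by (simp add: p_def)
  then have "norm (sgn p) = 1" "x \<bullet> sgn p = 0" using w by (auto simp: p_def x_def norm_sgn sgn_div_norm)
  then have "(LINT t:{0..pi}|lborel. F (great_circle (norm u *\<^sub>R x) ((w \<bullet> x) *\<^sub>R x + norm p *\<^sub>R sgn p) t)
            / (norm (great_circle (norm u *\<^sub>R x) ((w \<bullet> x) *\<^sub>R x + norm p *\<^sub>R sgn p) t))\<^sup>2)
       = (LINT t:{0..pi}|lborel. F (great_circle x (sgn p) t)) / (norm u * norm p)"
    using x u w by (intro integral_half_circle_plane F(1) projectiveD[OF F(2)]) (auto simp: p_def x_def)
  then show ?thesis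
    unfolding eq(1)[symmetric] eq(2)[symmetric] by (simp add: circle_integral_def x_def p_def)
qed

lemma weighted_integral_determined:
  fixes F G :: "'a::euclidean_space \<Rightarrow> real"
  assumes F: "F \<in> borel_measurable borel" "projective F" "set_integrable lborel (ball 0 1) F"
    and G: "G \<in> borel_measurable borel" "projective G" "set_integrable lborel (ball 0 1) G"
    and eq: "AE z in lborel. fst z \<in> ball 0 1 \<and> snd z \<in> ball 0 1 \<longrightarrow>
      circle_integral F (fst z) (snd z) = circle_integral G (fst z) (snd z)"
  shows "weighted_integral k \<omega> F = weighted_integral k \<omega> G"
proof -
  let ?I = "\<lambda>F z. plane_weight k \<omega> (fst z) (snd z) * (LINT t:{0..pi}|lborel.
      F (great_circle (fst z) (snd z) t) / (norm (great_circle (fst z) (snd z) t))\<^sup>2)"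
  have meas: "?I H \<in> borel_measurable lborel" if H[measurable]: "H \<in> borel_measurable borel" for H :: "'a \<Rightarrow> real"
  proof -
    have "(\<lambda>y. great_circle (fst (fst y)) (snd (fst y)) (snd y) :: 'a) \<in> borel_measurable (lborel \<Otimes>\<^sub>M lborel)"
      unfolding lborel_prod great_circle_def
      by (simp, intro borel_measurable_continuous_onI continuous_intros)
    note gc[measurable] = this
    have "(\<lambda>y. indicat_real {0..pi} (snd y) *\<^sub>R (H (great_circle (fst (fst y)) (snd (fst y)) (snd y))
        / (norm (great_circle (fst (fst y)) (snd (fst y)) (snd y)))\<^sup>2)) \<in> borel_measurable (lborel \<Otimes>\<^sub>M lborel)"
      by measurable
    then have "(\<lambda>z. LINT t:{0..pi}|lborel.
      H (great_circle (fst z) (snd z) t) / (norm (great_circle (fst z) (snd z) t))\<^sup>2) \<in> borel_measurable lborel"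
      unfolding set_lebesgue_integral_def
      by (intro lborel.borel_measurable_lebesgue_integral) (simp add: case_prod_unfold)
    then show ?thesis using plane_weight_measurable[of k \<omega>] by (intro borel_measurable_times) (auto simp: borel_prod)
  qed
  have "(\<integral>z. ?I F z \<partial>lborel) = (\<integral>z. ?I G z \<partial>lborel)"
  proof (rule integral_cong_AE)
    show "AE z in lborel. ?I F z = ?I G z"
      using eq
    proof eventually_elim
      fix z :: "'a \<times> 'a"
      assume *: "fst z \<in> ball 0 1 \<and> snd z \<in> ball 0 1 \<longrightarrow>
        circle_integral F (fst z) (snd z) = circle_integral G (fst z) (snd z)"
      obtain u w where z: "z = (u, w)" by (cases z)
      show "?I F z = ?I G z"
      proof (cases "plane_weight k \<omega> u w = 0")
        case False
        then have "u \<in> ball 0 1" "w \<in> ball 0 1"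
          using plane_weight_bounds[of k \<omega> u w] by (auto split: if_splits)
        moreover have u: "u \<noteq> 0" using False by (auto simp: plane_weight_def gram_def split: if_splits)
        \<comment> \<open>The squared area vanishes on parallel pairs, for which there is no great circle.\<close>
        moreover have "rejection (sgn u) w \<noteq> 0"
        proof
          assume "rejection (sgn u) w = 0"
          then have "gram (norm u *\<^sub>R sgn u) w = 0" using u by (subst gram_scaled) (auto simp: norm_sgn)
          then have "gram u w = 0" using u by (simp add: sgn_div_norm)
          then show False using False by (simp add: plane_weight_def split: if_splits)
        qed
        ultimately show ?thesis
          using * F G by (simp add: z plane_integral_eq_circle_integral)
      qed (simp add: z)
    qed
  qed (use meas F G in auto)
  then have "pi * weighted_integral k \<omega> F = pi * weighted_integral k \<omega> G"
    using F G by (simp add: weighted_integral_rotate)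
  then show ?thesis by simp
qed

section \<open>Expansion of the averages in moments\<close>

text \<open>
  With \<open>n\<close> the squared distance of \<open>w\<close> from the line of \<open>x\<close> and \<open>z / n\<close> the squared cosine of the
  angle between \<open>e\<close> and the component of \<open>w\<close> orthogonal to \<open>x\<close>.
\<close>

definition angular_density :: "nat \<Rightarrow> nat \<Rightarrow> 'a::euclidean_space \<Rightarrow> 'a \<Rightarrow> 'a \<Rightarrow> real"
  where "angular_density j l x e w = indicator (ball 0 1) w *
    (let n = (norm w)\<^sup>2 - (w \<bullet> x)\<^sup>2; z = (w \<bullet> e)\<^sup>2 in n * (1 - z / n) ^ j * (z / n) ^ l)"

lemma angular_density_measurable [measurable]:
  "angular_density j l x e \<in> borel_measurable borel"
proof -
  have [measurable]: "ball (0::'a) 1 \<in> sets borel" by simp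
  show ?thesis unfolding angular_density_def Let_def by measurable
qed

lemma bessel_orthonormal_pair:
  assumes "orthonormal_pair x e"
  shows "(w \<bullet> e)\<^sup>2 \<le> (norm w)\<^sup>2 - (w \<bullet> x)\<^sup>2"
proof -
  have x: "norm x = 1" and e: "norm e = 1" "x \<bullet> e = 0" using assms by (auto simp: orthonormal_pair_def)
  have "rejection x w \<bullet> e = w \<bullet> e" using e by (simp add: rejection_def inner_diff_left)
  moreover have "(rejection x w \<bullet> e)\<^sup>2 \<le> (norm (rejection x w))\<^sup>2 * (norm e)\<^sup>2"
    using Cauchy_Schwarz_ineq[of "rejection x w" e] by (simp add: power2_norm_eq_inner)
  ultimately show ?thesis using e rejection_facts(3)[OF x, of w] by simp
qed

lemma angular_density_bounds:
  assumes "orthonormal_pair x e"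
  shows "0 \<le> angular_density j l x e w" "angular_density j l x e w \<le> indicator (ball 0 1) w"
proof -
  define n z where "n = (norm w)\<^sup>2 - (w \<bullet> x)\<^sup>2" and "z = (w \<bullet> e)\<^sup>2"
  have z: "0 \<le> z" "z \<le> n" using bessel_orthonormal_pair[OF assms, of w] by (auto simp: n_def z_def)
  then have q: "0 \<le> z / n" "z / n \<le> 1" by (auto simp: divide_le_eq_1)
  have "0 \<le> n * (1 - z / n) ^ j * (z / n) ^ l" using z q by (intro mult_nonneg_nonneg) auto
  then show "0 \<le> angular_density j l x e w"
    by (simp add: angular_density_def Let_def n_def[symmetric] z_def[symmetric])
  show "angular_density j l x e w \<le> indicator (ball 0 1) w"
  proof (cases "w \<in> ball 0 1")
    case True
    then have "(norm w)\<^sup>2 \<le> 1" by (simp add: power_le_one)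
    moreover have "0 \<le> (w \<bullet> x)\<^sup>2" by simp
    ultimately have n: "n \<le> 1" unfolding n_def by linarith
    have "n * (1 - z / n) ^ j * (z / n) ^ l \<le> 1 * 1 * 1"
      using z q n by (intro mult_mono mult_nonneg_nonneg power_le_one) auto
    then show ?thesis using True
      by (simp add: angular_density_def Let_def n_def[symmetric] z_def[symmetric])
  qed (simp add: angular_density_def)
qed

lemma angular_density_integrable:
  fixes x e :: "'a::euclidean_space"
  assumes "orthonormal_pair x e"
  shows "integrable lborel (angular_density j l x e)"
proof (rule Bochner_Integration.integrable_bound)
  show "integrable lborel (indicat_real (ball (0::'a) 1))"
    using emeasure_lborel_ball_finite[of "0::'a" 1] by simp
  show "AE w in lborel. norm (angular_density j l x e w) \<le> norm (indicat_real (ball 0 1) w)"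
    using angular_density_bounds[OF assms] by (intro AE_I2) simp
qed measurable

lemma angular_density_integral_invariant:
  fixes x e x' e' :: "'a::euclidean_space"
  assumes "orthonormal_pair x e" "orthonormal_pair x' e'"
  shows "integral\<^sup>L lborel (angular_density j l x e) = integral\<^sup>L lborel (angular_density j l x' e')"
proof -
  obtain T :: "'a \<Rightarrow> 'a" where T: "orthogonal_transformation T" "T x = x'" "T e = e'"
    using orthogonal_transformation_orthonormal_pair[OF assms] by blast
  have inner: "T w \<bullet> x' = w \<bullet> x" "T w \<bullet> e' = w \<bullet> e" for w
    using T by (auto simp: orthogonal_transformation_def)
  have "angular_density j l x' e' (T w) = angular_density j l x e w" for w
    using T(1) by (simp add: angular_density_def Let_def inner orthogonal_transformation_norm indicator_def)
  then show ?thesis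
    using integral_lborel_orthogonal[OF T(1), of "angular_density j l x' e'"] by simp
qed

lemma orthonormal_decomposition:
  fixes x \<omega> :: "'a::euclidean_space"
  assumes dim: "2 \<le> DIM('a)" and x: "norm x = 1" and \<omega>: "norm \<omega> = 1"
  obtains e s where "orthonormal_pair x e" "\<omega> = (\<omega> \<bullet> x) *\<^sub>R x + s *\<^sub>R e" "s\<^sup>2 = 1 - (x \<bullet> \<omega>)\<^sup>2"
proof (cases "rejection x \<omega> = 0")
  case False
  have "orthonormal_pair x (sgn (rejection x \<omega>))"
    using False x rejection_facts[OF x] by (simp add: orthonormal_pair_def norm_sgn sgn_div_norm)
  moreover have "\<omega> = (\<omega> \<bullet> x) *\<^sub>R x + norm (rejection x \<omega>) *\<^sub>R sgn (rejection x \<omega>)"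
    using False rejection_facts(4)[OF x, of \<omega>] by (simp add: sgn_div_norm)
  moreover have "(norm (rejection x \<omega>))\<^sup>2 = 1 - (x \<bullet> \<omega>)\<^sup>2"
    using rejection_facts(3)[OF x, of \<omega>] \<omega> by (simp add: inner_commute)
  ultimately show ?thesis by (rule that)
next
  case True
  obtain y where y: "y \<noteq> 0" "orthogonal x y" using orthogonal_to_vector_exists[OF dim] by blast
  then have "orthonormal_pair x (sgn y)"
    using x by (simp add: orthonormal_pair_def norm_sgn sgn_div_norm orthogonal_def)
  moreover have "\<omega> = (\<omega> \<bullet> x) *\<^sub>R x + 0 *\<^sub>R sgn y" using True rejection_facts(4)[OF x, of \<omega>] by simp
  moreover have "0\<^sup>2 = 1 - (x \<bullet> \<omega>)\<^sup>2"
    using True rejection_facts(3)[OF x, of \<omega>] \<omega> by (simp add: inner_commute)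
  ultimately show ?thesis by (rule that)
qed

text \<open>
  The common value of the integrals of \<open>angular_density\<close> over all orthonormal pairs.
\<close>

definition angular_moment :: "nat \<Rightarrow> nat \<Rightarrow> 'a::euclidean_space itself \<Rightarrow> real"
  where "angular_moment j l _ =
    (SOME a. \<forall>x e :: 'a. orthonormal_pair x e \<longrightarrow> a = integral\<^sup>L lborel (angular_density j l x e))"

lemma angular_moment_eq:
  fixes x e :: "'a::euclidean_space"
  assumes "orthonormal_pair x e"
  shows "integral\<^sup>L lborel (angular_density j l x e) = angular_moment j l TYPE('a)"
proof -
  have "\<exists>a. \<forall>x e :: 'a. orthonormal_pair x e \<longrightarrow> a = integral\<^sup>L lborel (angular_density j l x e)"
    using angular_density_integral_invariant[OF assms] by blast
  from someI_ex[OF this] show ?thesis using assms by (simp add: angular_moment_def)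
qed

text \<open>
  What remains of the cut-off \<open>(norm u)\<^sup>2 + (norm w)\<^sup>2 < 1\<close> after integration over \<open>w\<close>: with
  \<open>R = sqrt (1 - (norm u)\<^sup>2)\<close>, substituting \<open>R w\<close> for \<open>w\<close> gives \<open>R ^ DIM('a)\<close> from the volume and
  \<open>R\<^sup>2\<close> from the squared area.
\<close>

definition radial_weight :: "'a::euclidean_space \<Rightarrow> real"
  where "radial_weight u = indicator (ball 0 1) u * sqrt (1 - (norm u)\<^sup>2) ^ (DIM('a) + 2)"

text \<open>
  Write \<open>x = sgn u\<close>, \<open>c = \<omega> \<bullet> x\<close>, and \<open>q\<close> for the squared cosine of the angle between the components
  of \<open>\<omega>\<close> and \<open>w\<close> orthogonal to \<open>x\<close>. The squared length of the projection of \<open>\<omega>\<close> to the plane of \<open>u\<close>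
  and \<open>w\<close> is \<open>c\<^sup>2 + (1 - c\<^sup>2) q = c\<^sup>2 (1 - q) + q\<close>, and the binomial theorem turns its \<open>k\<close>-th power
  into a polynomial of degree \<open>k\<close> in \<open>c\<^sup>2\<close>. Its coefficients, integrated over \<open>w\<close>, depend on \<open>u\<close>
  only through \<open>radial_weight u\<close>, and that factor is the same for all \<open>j\<close> and \<open>k\<close>.
\<close>

lemma integral_plane_weight:
  fixes u \<omega> :: "'a::euclidean_space"
  assumes dim: "2 \<le> DIM('a)" and u: "u \<noteq> 0" and \<omega>: "norm \<omega> = 1"
  shows "(\<integral>w. plane_weight k \<omega> u w \<partial>lborel) = (norm u)\<^sup>2 * radial_weight u *
    (\<Sum>j\<le>k. real (k choose j) * angular_moment j (k - j) TYPE('a) * (\<omega> \<bullet> sgn u) ^ (2 * j))"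
proof -
  define x r where "x = sgn u" and "r = norm u"
  have x: "norm x = 1" and r: "0 < r" and u: "u = r *\<^sub>R x"
    using u by (auto simp: x_def r_def norm_sgn sgn_div_norm)
  obtain e s where e: "orthonormal_pair x e" "\<omega> = (\<omega> \<bullet> x) *\<^sub>R x + s *\<^sub>R e" "s\<^sup>2 = 1 - (x \<bullet> \<omega>)\<^sup>2"
    using orthonormal_decomposition[OF dim x \<omega>] by blast
  define c where "c = \<omega> \<bullet> x"
  define H where "H w = (if (norm w)\<^sup>2 < 1 - r\<^sup>2 then (norm (rejection x w))\<^sup>2 *
      ((x \<bullet> \<omega>)\<^sup>2 + (rejection x w \<bullet> \<omega>)\<^sup>2 / (norm (rejection x w))\<^sup>2) ^ k else 0)" for w
  have W: "plane_weight k \<omega> u w = r\<^sup>2 * H w" for w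
    unfolding u plane_weight_scaled[OF x r] H_def by simp
  show ?thesis
  proof (cases "r < 1")
    case False
    then have "1 \<le> r\<^sup>2" by (simp add: one_le_power)
    moreover have "0 \<le> (norm w)\<^sup>2" for w :: 'a by simp
    ultimately have "\<not> (norm w)\<^sup>2 < 1 - r\<^sup>2" for w :: 'a by (smt (verit))
    then have "H w = 0" for w by (simp add: H_def)
    moreover have "radial_weight u = 0" using False by (simp add: radial_weight_def r_def)
    ultimately show ?thesis by (simp add: W)
  next
    case True
    define R where "R = sqrt (1 - r\<^sup>2)"
    have r1: "r\<^sup>2 < 1" using True r by (simp add: power_less_one_iff)
    have R: "0 < R" "R\<^sup>2 = 1 - r\<^sup>2" using r1 by (auto simp: R_def)
    have [measurable]: "H \<in> borel_measurable borel" unfolding H_def rejection_def by measurable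
    have HR: "H (R *\<^sub>R w) = R\<^sup>2 * (\<Sum>j\<le>k. real (k choose j) * c ^ (2 * j) * angular_density j (k - j) x e w)" for w
    proof (cases "w \<in> ball 0 1")
      case True
      define n z where "n = (norm w)\<^sup>2 - (w \<bullet> x)\<^sup>2" and "z = (w \<bullet> e)\<^sup>2"
      have rej: "rejection x (R *\<^sub>R w) = R *\<^sub>R rejection x w" by (simp add: rejection_def algebra_simps)
      have n: "(norm (rejection x (R *\<^sub>R w)))\<^sup>2 = R\<^sup>2 * n"
        unfolding rej by (simp add: power_mult_distrib rejection_facts(3)[OF x] n_def)
      have "rejection x w \<bullet> \<omega> = s * (rejection x w \<bullet> e)"
        by (subst e(2)) (simp add: inner_add_right rejection_facts[OF x])
      also have "rejection x w \<bullet> e = w \<bullet> e"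
        using e(1) by (simp add: rejection_def inner_diff_left orthonormal_pair_def)
      finally have z: "(rejection x (R *\<^sub>R w) \<bullet> \<omega>)\<^sup>2 = R\<^sup>2 * (s\<^sup>2 * z)"
        unfolding rej by (simp add: power_mult_distrib z_def)
      have "(norm (R *\<^sub>R w))\<^sup>2 < 1 - r\<^sup>2"
      proof -
        have "(norm w)\<^sup>2 < 1" using True by (simp add: power_less_one_iff)
        then have "R\<^sup>2 * (norm w)\<^sup>2 < R\<^sup>2 * 1" using R(1) by (intro mult_strict_left_mono) auto
        then show ?thesis using R r1 by (simp add: power_mult_distrib)
      qed
      then have "H (R *\<^sub>R w) = R\<^sup>2 * n * ((x \<bullet> \<omega>)\<^sup>2 + R\<^sup>2 * (s\<^sup>2 * z) / (R\<^sup>2 * n)) ^ k"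
        unfolding H_def n z by simp
      also have "(x \<bullet> \<omega>)\<^sup>2 + R\<^sup>2 * (s\<^sup>2 * z) / (R\<^sup>2 * n) = c\<^sup>2 * (1 - z / n) + z / n"
      proof -
        have "R\<^sup>2 * (s\<^sup>2 * z) / (R\<^sup>2 * n) = s\<^sup>2 * (z / n)" using R(1) by simp
        then show ?thesis unfolding e(3) by (simp add: c_def inner_commute algebra_simps)
      qed
      also have "(c\<^sup>2 * (1 - z / n) + z / n) ^ k
          = (\<Sum>j\<le>k. real (k choose j) * (c\<^sup>2 * (1 - z / n)) ^ j * (z / n) ^ (k - j))"
        by (rule binomial_ring)
      finally have H_sum: "H (R *\<^sub>R w) = R\<^sup>2 *
          (\<Sum>j\<le>k. n * (real (k choose j) * (c\<^sup>2 * (1 - z / n)) ^ j * (z / n) ^ (k - j)))"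
        by (simp add: sum_distrib_left mult.assoc)
      have "n * (real (k choose j) * (c\<^sup>2 * (1 - z / n)) ^ j * (z / n) ^ (k - j))
          = real (k choose j) * c ^ (2 * j) * angular_density j (k - j) x e w" for j
        unfolding power_mult[of c 2 j] using True
        by (simp add: angular_density_def Let_def n_def[symmetric] z_def[symmetric]
            power_mult_distrib mult_ac)
      then show ?thesis unfolding H_sum by (simp only:)
    next
      case False
      then have "1 \<le> (norm w)\<^sup>2" by (simp add: one_le_power)
      then have "R\<^sup>2 * 1 \<le> R\<^sup>2 * (norm w)\<^sup>2" using R(1) by (intro mult_left_mono) auto
      then have "H (R *\<^sub>R w) = 0" using R by (simp add: H_def power_mult_distrib)
      then show ?thesis using False by (simp add: angular_density_def)
    qed
    have "(\<integral>w. H w \<partial>lborel) = R ^ DIM('a) * (\<integral>w. H (R *\<^sub>R w) \<partial>lborel)"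
      by (rule integral_lborel_scaleR) (use R in auto)
    also have "(\<integral>w. H (R *\<^sub>R w) \<partial>lborel)
        = R\<^sup>2 * (\<Sum>j\<le>k. real (k choose j) * c ^ (2 * j) * angular_moment j (k - j) TYPE('a))"
      unfolding HR using angular_density_integrable[OF e(1)]
      by (simp add: Bochner_Integration.integral_sum angular_moment_eq[OF e(1)])
    finally have "(\<integral>w. H w \<partial>lborel) = R ^ (DIM('a) + 2) *
        (\<Sum>j\<le>k. real (k choose j) * c ^ (2 * j) * angular_moment j (k - j) TYPE('a))"
      by (simp add: power_add power2_eq_square mult_ac)
    moreover have "radial_weight u = R ^ (DIM('a) + 2)"
      using True by (simp add: radial_weight_def R_def r_def)
    ultimately show ?thesis
      unfolding W by (simp add: c_def x_def[symmetric] r_def[symmetric] mult_ac)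
  qed
qed

text \<open>
  In dimension at least 3 there is a unit vector \<open>f\<close> orthogonal to \<open>x\<close> and \<open>e\<close>. Where \<open>w \<bullet> f \<noteq> 0\<close>,
  the component of \<open>w\<close> orthogonal to \<open>x\<close> is not parallel to \<open>e\<close>, so the density is positive almost
  everywhere on the ball. In dimension 2 it would vanish for \<open>0 < k\<close>, in accordance with the fact
  that the circle contains only one great circle.
\<close>

lemma angular_moment_pos:
  assumes dim: "3 \<le> DIM('a::euclidean_space)"
  shows "0 < angular_moment k 0 TYPE('a)"
proof -
  obtain S where S: "S \<subseteq> (Basis :: 'a set)" "card S = 3"
    using obtain_subset_with_card_n[OF dim] by metis
  then obtain x e f where xef: "S = {x, e, f}" "x \<noteq> e" "e \<noteq> f" "x \<noteq> f"
    using card_3_iff by metis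
  have o: "orthonormal_pair x e"
    using S xef by (auto simp: orthonormal_pair_def inner_not_same_Basis)
  let ?D = "angular_density k 0 x e"
  have "integral\<^sup>L lborel ?D \<noteq> 0"
  proof
    assume "integral\<^sup>L lborel ?D = 0"
    then have "AE w in lborel. ?D w = 0"
      using angular_density_integrable[OF o] angular_density_bounds[OF o]
      by (subst (asm) integral_nonneg_eq_0_iff_AE) auto
    moreover have "AE w in lborel. w \<bullet> f \<noteq> 0" using S xef by (intro AE_lborel_inner_neq) auto
    ultimately have "AE w in lborel. w \<notin> ball (0::'a) 1"
    proof eventually_elim
      fix w assume D: "?D w = 0" and wf: "w \<bullet> f \<noteq> 0"
      define n z where "n = (norm w)\<^sup>2 - (w \<bullet> x)\<^sup>2" and "z = (w \<bullet> e)\<^sup>2"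
      have "(\<Sum>b\<in>{x, e, f}. (w \<bullet> b)\<^sup>2) \<le> (\<Sum>b\<in>Basis. (w \<bullet> b)\<^sup>2)"
        using S xef by (intro sum_mono2) auto
      also have "\<dots> = (norm w)\<^sup>2"
        unfolding power2_norm_eq_inner by (subst euclidean_inner) (simp add: power2_eq_square)
      finally have "z + (w \<bullet> f)\<^sup>2 \<le> n" using xef by (simp add: n_def z_def)
      moreover have "0 < (w \<bullet> f)\<^sup>2" "0 \<le> z" using wf by (auto simp: z_def)
      ultimately have "0 < n" "z < n" by linarith+
      then have "0 < n * (1 - z / n) ^ k" by (intro mult_pos_pos zero_less_power) auto
      then show "w \<notin> ball 0 1"
        using D by (auto simp: angular_density_def Let_def n_def[symmetric] z_def[symmetric] zero_power)
    qed
    then have "emeasure lborel (ball (0::'a) 1) = 0"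
      by (subst (asm) AE_iff_measurable[of "ball 0 1"]) auto
    then show False by (simp add: emeasure_ball unit_ball_vol_pos less_imp_neq[symmetric])
  qed
  moreover have "0 \<le> integral\<^sup>L lborel ?D" using angular_density_bounds[OF o] by (intro integral_nonneg_AE) auto
  ultimately show ?thesis using angular_moment_eq[OF o] by simp
qed

section \<open>Injectivity of the great circle transform\<close>

text \<open>
  Since \<open>F\<close> is homogeneous of degree 0, this is a positive multiple, common to all \<open>F\<close>, \<open>\<omega>\<close> and \<open>m\<close>,
  of the integral of \<open>F x * (\<omega> \<bullet> x) ^ m\<close> over the unit sphere.
\<close>

definition sphere_moment :: "('a::euclidean_space \<Rightarrow> real) \<Rightarrow> 'a \<Rightarrow> nat \<Rightarrow> real"
  where "sphere_moment F \<omega> m = (\<integral>u. F u * radial_weight u * (\<omega> \<bullet> sgn u) ^ m \<partial>lborel)"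

lemma radial_weight_measurable [measurable]: "radial_weight \<in> borel_measurable borel"
proof -
  have [measurable]: "ball (0::'a) 1 \<in> sets borel" by simp
  show ?thesis unfolding radial_weight_def by measurable
qed

lemma radial_weight_bounds:
  fixes u :: "'a::euclidean_space"
  shows "0 \<le> radial_weight u" "radial_weight u \<le> indicator (ball 0 1) u"
proof -
  have "0 \<le> sqrt (1 - (norm u)\<^sup>2) ^ (DIM('a) + 2) \<and> sqrt (1 - (norm u)\<^sup>2) ^ (DIM('a) + 2) \<le> 1"
    if "norm u < 1"
  proof -
    have "(norm u)\<^sup>2 \<le> 1" using that by (simp add: power_le_one)
    then show ?thesis by (intro conjI zero_le_power power_le_one) auto
  qed
  then show "0 \<le> radial_weight u" "radial_weight u \<le> indicator (ball 0 1) u"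
    by (auto simp: radial_weight_def indicator_def simp del: power_Suc)
qed

lemma sgn_measurable [measurable]: "(sgn :: 'a::euclidean_space \<Rightarrow> 'a) \<in> borel_measurable borel"
  unfolding sgn_div_norm by measurable

lemma sphere_moment_integrable:
  fixes F :: "'a::euclidean_space \<Rightarrow> real"
  assumes F[measurable]: "F \<in> borel_measurable borel" and int: "set_integrable lborel (ball 0 1) F"
  shows "integrable lborel (\<lambda>u. F u * radial_weight u * (\<omega> \<bullet> sgn u) ^ m)"
proof (rule Bochner_Integration.integrable_bound)
  show "integrable lborel (\<lambda>u. norm \<omega> ^ m * (indicator (ball 0 1) u *\<^sub>R F u))"
    using int by (simp add: set_integrable_def)
  show "AE u in lborel. norm (F u * radial_weight u * (\<omega> \<bullet> sgn u) ^ m)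
      \<le> norm (norm \<omega> ^ m * (indicator (ball 0 1) u *\<^sub>R F u))"
  proof (rule AE_I2)
    fix u :: 'a
    have "\<bar>\<omega> \<bullet> sgn u\<bar> \<le> norm \<omega> * norm (sgn u)" by (rule Cauchy_Schwarz_ineq2)
    also have "\<dots> \<le> norm \<omega> * 1" by (intro mult_left_mono) (auto simp: norm_sgn)
    finally have "\<bar>\<omega> \<bullet> sgn u\<bar> ^ m \<le> norm \<omega> ^ m" by (intro power_mono) auto
    then have "radial_weight u * \<bar>\<omega> \<bullet> sgn u\<bar> ^ m * \<bar>F u\<bar> \<le> indicator (ball 0 1) u * norm \<omega> ^ m * \<bar>F u\<bar>"
      using radial_weight_bounds[of u] by (intro mult_right_mono mult_mono) auto
    then show "norm (F u * radial_weight u * (\<omega> \<bullet> sgn u) ^ m)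
      \<le> norm (norm \<omega> ^ m * (indicator (ball 0 1) u *\<^sub>R F u))"
      using radial_weight_bounds(1)[of u] by (simp add: abs_mult power_abs mult_ac)
  qed
qed measurable

lemma weighted_integral_expansion:
  fixes F :: "'a::euclidean_space \<Rightarrow> real"
  assumes F[measurable]: "F \<in> borel_measurable borel" and int: "set_integrable lborel (ball 0 1) F"
    and dim: "2 \<le> DIM('a)" and \<omega>: "norm \<omega> = 1"
  shows "weighted_integral k \<omega> F =
    (\<Sum>j\<le>k. real (k choose j) * angular_moment j (k - j) TYPE('a) * sphere_moment F \<omega> (2 * j))"
proof -
  let ?g = "\<lambda>z. F (fst z) / (norm (fst z))\<^sup>2 * plane_weight k \<omega> (fst z) (snd z)"
  let ?a = "\<lambda>j. real (k choose j) * angular_moment j (k - j) TYPE('a)"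
  have g: "integrable (lborel \<Otimes>\<^sub>M lborel) ?g"
    using weighted_integrand_integrable[OF F int] by (simp add: lborel_prod)
  have [measurable]: "?g \<in> borel_measurable (lborel \<Otimes>\<^sub>M lborel)" by measurable
  have "weighted_integral k \<omega> F = (\<integral>u. \<integral>w. ?g (u, w) \<partial>lborel \<partial>lborel)"
    unfolding weighted_integral_def using lborel_pair.integral_fst'[OF g] by (simp add: lborel_prod)
  also have "\<dots> = (\<integral>u. (\<Sum>j\<le>k. ?a j * (F u * radial_weight u * (\<omega> \<bullet> sgn u) ^ (2 * j))) \<partial>lborel)"
  proof (rule integral_cong_AE)
    show "(\<lambda>u. \<integral>w. ?g (u, w) \<partial>lborel) \<in> borel_measurable lborel"
      by (rule lborel.borel_measurable_lebesgue_integral) (simp add: case_prod_unfold)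
    show "AE u in lborel. (\<integral>w. ?g (u, w) \<partial>lborel)
        = (\<Sum>j\<le>k. ?a j * (F u * radial_weight u * (\<omega> \<bullet> sgn u) ^ (2 * j)))"
      using AE_lborel_singleton[of "0::'a"]
    proof eventually_elim
      fix u :: 'a assume u: "u \<noteq> 0"
      have "(\<integral>w. ?g (u, w) \<partial>lborel) = F u / (norm u)\<^sup>2 * (\<integral>w. plane_weight k \<omega> u w \<partial>lborel)" by simp
      also have "\<dots> = F u * radial_weight u * (\<Sum>j\<le>k. ?a j * (\<omega> \<bullet> sgn u) ^ (2 * j))"
        using u by (simp add: integral_plane_weight[OF dim u \<omega>])
      finally show "(\<integral>w. ?g (u, w) \<partial>lborel)
        = (\<Sum>j\<le>k. ?a j * (F u * radial_weight u * (\<omega> \<bullet> sgn u) ^ (2 * j)))"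
        by (simp add: sum_distrib_left mult_ac)
    qed
  qed measurable
  also have "\<dots> = (\<Sum>j\<le>k. ?a j * sphere_moment F \<omega> (2 * j))"
    unfolding sphere_moment_def
    using sphere_moment_integrable[OF F int] by (subst Bochner_Integration.integral_sum) auto
  finally show ?thesis .
qed

text \<open>
  The weighted integrals are a triangular system for the even moments, with the positive diagonal
  entries \<open>angular_moment k 0\<close>.
\<close>

lemma even_moments_determined:
  fixes F G :: "'a::euclidean_space \<Rightarrow> real"
  assumes F: "F \<in> borel_measurable borel" "set_integrable lborel (ball 0 1) F"
    and G: "G \<in> borel_measurable borel" "set_integrable lborel (ball 0 1) G"
    and dim: "3 \<le> DIM('a)" and \<omega>: "norm \<omega> = 1"
    and eq: "\<And>k. weighted_integral k \<omega> F = weighted_integral k \<omega> G"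
  shows "sphere_moment F \<omega> (2 * k) = sphere_moment G \<omega> (2 * k)"
proof (induction k rule: less_induct)
  case (less k)
  let ?a = "\<lambda>j. real (k choose j) * angular_moment j (k - j) TYPE('a)"
  have dim2: "2 \<le> DIM('a)" using dim by simp
  have split: "(\<Sum>j\<le>k. f j) = (\<Sum>j<k. f j) + f k" for f :: "nat \<Rightarrow> real"
    by (simp add: lessThan_Suc_atMost[symmetric])
  have "(\<Sum>j\<le>k. ?a j * sphere_moment F \<omega> (2 * j)) = (\<Sum>j\<le>k. ?a j * sphere_moment G \<omega> (2 * j))"
    using eq[of k] weighted_integral_expansion[OF F dim2 \<omega>] weighted_integral_expansion[OF G dim2 \<omega>] by simp
  moreover have "(\<Sum>j<k. ?a j * sphere_moment F \<omega> (2 * j)) = (\<Sum>j<k. ?a j * sphere_moment G \<omega> (2 * j))"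
    using less by (intro sum.cong) auto
  ultimately have "?a k * sphere_moment F \<omega> (2 * k) = ?a k * sphere_moment G \<omega> (2 * k)"
    unfolding split by linarith
  then show ?case using angular_moment_pos[OF dim, of k] by simp
qed

lemma odd_moment_zero:
  fixes F :: "'a::euclidean_space \<Rightarrow> real"
  assumes [measurable]: "F \<in> borel_measurable borel" and "projective F" and "odd m"
  shows "sphere_moment F \<omega> m = 0"
proof -
  let ?G = "\<lambda>u. F u * radial_weight u * (\<omega> \<bullet> sgn u) ^ m"
  have "orthogonal_transformation (uminus :: 'a \<Rightarrow> 'a)"
    by (simp add: orthogonal_transformation_def linear_uminus)
  then have "(\<integral>u. ?G (- u) \<partial>lborel) = (\<integral>u. ?G u \<partial>lborel)"
    by (rule integral_lborel_orthogonal) measurable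
  moreover have "?G (- u) = - ?G u" for u
    using projectiveD[OF assms(2), of "- 1" u] \<open>odd m\<close>
    by (simp add: radial_weight_def indicator_def sgn_minus power_minus_odd)
  ultimately show ?thesis by (simp add: sphere_moment_def)
qed

lemma sphere_moment_scale:
  assumes "\<omega> = c *\<^sub>R \<eta>"
  shows "sphere_moment F \<omega> m = c ^ m * sphere_moment F \<eta> m"
proof -
  have "sphere_moment F \<omega> m = (\<integral>u. c ^ m * (F u * radial_weight u * (\<eta> \<bullet> sgn u) ^ m) \<partial>lborel)"
    unfolding sphere_moment_def assms
    by (intro Bochner_Integration.integral_cong[OF refl]) (simp add: power_mult_distrib mult_ac)
  then show ?thesis by (simp add: sphere_moment_def)
qed

text \<open>
  Injectivity of the great circle transform on even functions (for the two-sphere the theorem of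
  Funk), for integrable functions and almost all great circles. The even moments of \<open>F - G\<close> vanish
  by \<open>even_moments_determined\<close>, the odd ones by symmetry. To conclude with
  \<open>AE_zero_if_moments_zero\<close>, the measure with density \<open>radial_weight\<close> is projected to the sphere.
\<close>

theorem circle_integrals_determine:
  fixes F G :: "'a::euclidean_space \<Rightarrow> real"
  assumes dim: "3 \<le> DIM('a)"
    and F: "F \<in> borel_measurable borel" "projective F" "set_integrable lborel (ball 0 1) F"
    and G: "G \<in> borel_measurable borel" "projective G" "set_integrable lborel (ball 0 1) G"
    and eq: "AE z in lborel. fst z \<in> ball 0 1 \<and> snd z \<in> ball 0 1 \<longrightarrow>
      circle_integral F (fst z) (snd z) = circle_integral G (fst z) (snd z)"
  shows "AE u in lborel. u \<in> ball 0 1 \<longrightarrow> F u = G u"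
proof -
  note [measurable] = F(1) G(1)
  define H where "H u = F u - G u" for u
  have H: "projective H" using F(2) G(2) by (simp add: H_def projective_def)
  have H_meas[measurable]: "H \<in> borel_measurable borel" unfolding H_def by measurable
  have moments: "sphere_moment F \<omega> m = sphere_moment G \<omega> m" if \<omega>: "norm \<omega> = 1" for \<omega> m
  proof (cases "even m")
    case True
    then obtain k where "m = 2 * k" by (auto elim: evenE)
    then show ?thesis
      using even_moments_determined[OF F(1,3) G(1,3) dim \<omega> weighted_integral_determined[OF F G eq]] by simp
  next
    case False
    then show ?thesis using odd_moment_zero[OF F(1,2)] odd_moment_zero[OF G(1,2)] by simp
  qed
  \<comment> \<open>By homogeneity in \<open>\<omega>\<close> the restriction to unit vectors is harmless.\<close>
  have H_moment: "sphere_moment H \<omega> m = 0" for \<omega> m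
  proof -
    have 1: "sphere_moment H \<eta> m = 0" if "norm \<eta> = 1" for \<eta>
    proof -
      have "sphere_moment H \<eta> m = sphere_moment F \<eta> m - sphere_moment G \<eta> m"
        unfolding sphere_moment_def H_def
        using sphere_moment_integrable[OF F(1,3), of \<eta> m] sphere_moment_integrable[OF G(1,3), of \<eta> m]
        by (simp add: left_diff_distrib)
      then show ?thesis using moments[OF that] by simp
    qed
    obtain b :: 'a where b: "b \<in> Basis" using nonempty_Basis by blast
    show ?thesis
    proof (cases "\<omega> = 0")
      case True
      then show ?thesis using sphere_moment_scale[of \<omega> 0 b H m] 1[of b] b by simp
    next
      case False
      then have "\<omega> = norm \<omega> *\<^sub>R sgn \<omega>" by (simp add: sgn_div_norm)
      then show ?thesis using sphere_moment_scale[of \<omega> "norm \<omega>" "sgn \<omega>" H m] 1[of "sgn \<omega>"] False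
        by (simp add: norm_sgn)
    qed
  qed
  \<comment> \<open>The moments of \<open>H\<close> are moments with respect to a finite measure on the unit sphere.\<close>
  define D where "D = density lborel (\<lambda>u::'a. ennreal (radial_weight u))"
  define \<mu> where "\<mu> = distr D borel sgn"
  have sgn_D[measurable]: "sgn \<in> D \<rightarrow>\<^sub>M borel" unfolding D_def by simp
  have "emeasure D (space D) = (\<integral>\<^sup>+u. ennreal (radial_weight (u :: 'a)) \<partial>lborel)"
    by (simp add: D_def emeasure_density)
  also have "\<dots> \<le> (\<integral>\<^sup>+u. indicator (ball (0::'a) 1) u \<partial>lborel)"
    by (intro nn_integral_mono)
      (simp add: ennreal_indicator[symmetric] ennreal_leI radial_weight_bounds(2) del: ennreal_indicator)
  also have "\<dots> < \<infinity>" using emeasure_lborel_ball_finite[of "0::'a" 1] by simp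
  finally have "finite_measure D" by (intro finite_measureI) auto
  then have fin: "finite_measure \<mu>"
    unfolding \<mu>_def by (rule finite_measure.finite_measure_distr) simp
  have int_\<mu>: "(\<integral>x. f x \<partial>\<mu>) = (\<integral>u. radial_weight u * f (sgn u) \<partial>lborel)"
    "integrable \<mu> f \<longleftrightarrow> integrable lborel (\<lambda>u. radial_weight u * f (sgn u))"
    if [measurable]: "f \<in> borel_measurable borel" for f :: "'a \<Rightarrow> real"
  proof -
    have [measurable]: "(\<lambda>u. f (sgn u)) \<in> borel_measurable borel" by measurable
    show "(\<integral>x. f x \<partial>\<mu>) = (\<integral>u. radial_weight u * f (sgn u) \<partial>lborel)"
      unfolding \<mu>_def by (subst integral_distr) (auto simp: D_def integral_density radial_weight_bounds)
    show "integrable \<mu> f \<longleftrightarrow> integrable lborel (\<lambda>u. radial_weight u * f (sgn u))"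
      unfolding \<mu>_def by (subst integrable_distr_eq) (auto simp: D_def integrable_density radial_weight_bounds)
  qed
  have "AE x in \<mu>. H x = 0"
  proof (rule AE_zero_if_moments_zero[OF fin _ compact_cball])
    show "sets \<mu> = sets borel" by (simp add: \<mu>_def)
    show "AE x in \<mu>. x \<in> cball 0 1"
      unfolding \<mu>_def by (subst AE_distr_iff) (auto simp: norm_sgn)
    have "integrable lborel (\<lambda>u. F u * radial_weight u)" "integrable lborel (\<lambda>u. G u * radial_weight u)"
      using sphere_moment_integrable[OF F(1,3), of 0 0] sphere_moment_integrable[OF G(1,3), of 0 0] by simp_all
    then have "integrable lborel (\<lambda>u. F u * radial_weight u - G u * radial_weight u)"
      by (intro Bochner_Integration.integrable_diff) simp_all
    then show "integrable \<mu> H"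
      by (subst int_\<mu>(2)) (auto simp: projective_sgn[OF F(2)] projective_sgn[OF G(2)] H_def right_diff_distrib mult.commute)
    show "(\<integral>x. H x * (\<omega> \<bullet> x) ^ m \<partial>\<mu>) = 0" for \<omega> m
      using H_moment[of \<omega> m]
      by (subst int_\<mu>(1)) (auto simp: projective_sgn[OF H] sphere_moment_def mult_ac)
  qed
  then have "AE u in D. H (sgn u) = 0" unfolding \<mu>_def by (rule AE_distrD[OF sgn_D])
  then have "AE u in lborel. 0 < ennreal (radial_weight u) \<longrightarrow> H (sgn u) = 0"
    unfolding D_def by (subst (asm) AE_density) auto
  then show ?thesis
  proof eventually_elim
    fix u :: 'a assume "0 < ennreal (radial_weight u) \<longrightarrow> H (sgn u) = 0"
    moreover have "0 < radial_weight u" if "u \<in> ball 0 1"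
      using that by (simp add: radial_weight_def power_less_one_iff)
    ultimately show "u \<in> ball 0 1 \<longrightarrow> F u = G u"
      using projective_sgn[OF F(2), of u] projective_sgn[OF G(2), of u] by (auto simp: H_def)
  qed
qed

section \<open>Folding the sphere\<close>

definition wall_reflection :: "'n \<Rightarrow> real ^ 'n::finite \<Rightarrow> real ^ 'n"
  where "wall_reflection b y = y - (2 * y $ b) *\<^sub>R axis b 1"

definition fold_wall :: "'n \<Rightarrow> real ^ 'n::finite \<Rightarrow> real ^ 'n"
  where "fold_wall b y = (if 0 \<le> y $ b then y else wall_reflection b y)"

text \<open>
  Antipodes are identified first, which maps the sphere to the half sphere \<open>{y. 0 \<le> y $ a}\<close>; the
  half sphere is then folded along the reflecting wall \<open>{y. y $ b = 0}\<close>.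
\<close>

definition fold_sphere :: "'n \<Rightarrow> 'n \<Rightarrow> real ^ 'n::finite \<Rightarrow> real ^ 'n"
  where "fold_sphere a b y = fold_wall b (if 0 \<le> y $ a then y else - y)"

lemma wall_reflection_nth [simp]:
  "wall_reflection b y $ i = (if i = b then - (y $ b) else y $ i)"
  by (simp add: wall_reflection_def axis_def)

lemma wall_reflection_involution [simp]: "wall_reflection b (wall_reflection b y) = y"
  by (simp add: vec_eq_iff)

lemma inner_wall_reflection: "wall_reflection b x \<bullet> wall_reflection b y = x \<bullet> y"
  by (auto simp: inner_vec_def intro!: sum.cong)

lemma norm_wall_reflection [simp]: "norm (wall_reflection b y) = norm y"
  by (simp add: norm_eq_sqrt_inner inner_wall_reflection)

lemma linear_wall_reflection: "linear (wall_reflection b)"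
  by (rule linearI) (auto simp: vec_eq_iff)

lemma orthogonal_transformation_wall_reflection: "orthogonal_transformation (wall_reflection b)"
  by (simp add: orthogonal_transformation_def linear_wall_reflection inner_wall_reflection)

lemma reflect_velocity_axis: "reflect_velocity (axis b 1) v = wall_reflection b v"
  by (simp add: reflect_velocity_def wall_reflection_def inner_axis)

lemma norm_fold_wall [simp]: "norm (fold_wall b y) = norm y"
  by (simp add: fold_wall_def)

lemma fold_wall_nth: "fold_wall b y $ i = (if i = b then \<bar>y $ b\<bar> else y $ i)"
  by (simp add: fold_wall_def)

lemma fold_sphere_in_quadrant:
  assumes "norm y = 1" "y $ a \<noteq> 0"
  shows "fold_sphere a b y \<in> quadrant a b"
  using assms by (auto simp: fold_sphere_def quadrant_def fold_wall_nth)

lemma fold_sphere_quadrant: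
  assumes "y \<in> quadrant a b"
  shows "fold_sphere a b y = y"
  using assms by (auto simp: fold_sphere_def quadrant_def fold_wall_def)

lemma fold_sphere_uminus: "y $ a \<noteq> 0 \<Longrightarrow> fold_sphere a b (- y) = fold_sphere a b y"
  by (auto simp: fold_sphere_def)

lemma hemisphere_eq_quadrant: "hemisphere = quadrant 2 2"
  by (auto simp: hemisphere_def quadrant_def)

section \<open>Great circles as broken rays\<close>

lemma great_circle_nth: "great_circle x v t $ i = cos t * x $ i + sin t * v $ i"
  by (simp add: great_circle_def)

lemma great_circle_add:
  "great_circle x v (s + t) = great_circle (great_circle x v s) (great_circle v (- x) s) t"
  by (simp add: great_circle_def cos_add sin_add algebra_simps)

lemma orthonormal_pair_great_circle:
  assumes "orthonormal_pair x v"
  shows "orthonormal_pair (great_circle x v s) (great_circle v (- x) s)"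
proof -
  have "x \<bullet> x = 1" "v \<bullet> v = 1" "x \<bullet> v = 0" "v \<bullet> x = 0"
    using assms by (auto simp: orthonormal_pair_def inner_commute dot_square_norm)
  moreover have "orthonormal_pair v (- x)" using assms
    by (auto simp: orthonormal_pair_def inner_commute)
  ultimately show ?thesis
    using assms norm_great_circle[of x v s] norm_great_circle[of v "- x" s]
    by (simp add: orthonormal_pair_def great_circle_def inner_add_left inner_add_right inner_diff_right)
qed

lemma great_circle_has_vector_derivative:
  "(great_circle x v has_vector_derivative great_circle v (- x) t) (at t within I)"
  unfolding great_circle_def
  by (auto intro!: derivative_eq_intros)

lemma unit_speed_geodesic_great_circle:
  assumes "orthonormal_pair x v"
  shows "unit_speed_geodesic_on I (great_circle x v)"
  unfolding unit_speed_geodesic_on_def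
proof (intro exI ballI conjI)
  fix t
  have "orthonormal_pair v (- x)" using assms
    by (auto simp: orthonormal_pair_def inner_commute)
  then show "norm (great_circle v (- x) t) = 1" by (rule norm_great_circle)
  show "great_circle x v t \<in> sphere 0 1" using norm_great_circle[OF assms] by simp
  show "(great_circle x v has_vector_derivative great_circle v (- x) t) (at t within I)"
    "(great_circle v (- x) has_vector_derivative great_circle (- x) (- v) t) (at t within I)"
    by (rule great_circle_has_vector_derivative)+
  have "great_circle (- x) (- v) t = - great_circle x v t" by (simp add: great_circle_def)
  moreover have "great_circle x v t \<bullet> great_circle x v t = 1"
    using norm_great_circle[OF assms, of t] by (simp add: dot_square_norm)
  ultimately show "great_circle (- x) (- v) t
      - (great_circle (- x) (- v) t \<bullet> great_circle x v t) *\<^sub>R great_circle x v t = 0"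
    by simp
qed

lemma unit_speed_geodesic_on_cong:
  assumes "unit_speed_geodesic_on I c" "\<And>t. t \<in> I \<Longrightarrow> c' t = c t"
  shows "unit_speed_geodesic_on I c'"
proof -
  obtain v a where va: "\<forall>t\<in>I. c t \<in> sphere 0 1 \<and>
       (c has_vector_derivative v t) (at t within I) \<and>
       (v has_vector_derivative a t) (at t within I) \<and>
       norm (v t) = 1 \<and> a t - (a t \<bullet> c t) *\<^sub>R c t = 0"
    using assms(1) unfolding unit_speed_geodesic_on_def by blast
  have "(c' has_vector_derivative v t) (at t within I)" if "t \<in> I" for t
  proof (rule has_vector_derivative_transform[OF that])
    show "(c has_vector_derivative v t) (at t within I)" using va that by blast
  qed (use assms(2) in auto)
  then show ?thesis unfolding unit_speed_geodesic_on_def using va assms(2) by metis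
qed

lemma orthonormal_pair_wall_reflection:
  "orthonormal_pair x v \<Longrightarrow> orthonormal_pair (wall_reflection b x) (wall_reflection b v)"
  by (simp add: orthonormal_pair_def inner_wall_reflection)

lemma great_circle_wall_reflection:
  "great_circle (wall_reflection b x) (wall_reflection b v) t = wall_reflection b (great_circle x v t)"
  by (simp add: great_circle_def linear_add[OF linear_wall_reflection] linear_scale[OF linear_wall_reflection])

lemma openin_sphere_pos: 
  "openin (top_of_set (sphere 0 1)) {y::real ^ 'n::finite. y \<in> sphere 0 1 \<and> 0 < y $ a \<and> 0 < y $ b}"
proof -
  have "open {y::real^'n. 0 < y $ a \<and> 0 < y $ b}"
    by (intro open_Collect_conj open_Collect_less continuous_intros)
  then have "openin (top_of_set (sphere 0 1)) (sphere 0 1 \<inter> {y::real^'n. 0 < y $ a \<and> 0 < y $ b})"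
    by (rule openin_open_Int)
  then show ?thesis by (simp add: Int_def)
qed

lemma pos_in_interior:
  assumes "norm y = 1" "0 < y $ a" "0 < y $ b"
  shows "y \<in> mfd_interior (quadrant a b)"
  unfolding mfd_interior_def interior_of_def
  using assms openin_sphere_pos[of a b]
  by (auto simp: quadrant_def intro!: exI[of _ "{y. y \<in> sphere 0 1 \<and> 0 < y $ a \<and> 0 < y $ b}"])

text \<open>
  The geodesic that leaves \<open>y\<close> against the inner normal of the wall leaves the quadrant at once.
\<close>

lemma wall_in_boundary:
  assumes y: "y \<in> quadrant a b" and c: "c = a \<or> c = b" "y $ c = 0"
  shows "y \<in> mfd_boundary (quadrant a b)"
proof -
  have ny: "norm y = 1" using y by (simp add: quadrant_def)
  have "y \<in> (top_of_set (sphere 0 1)) closure_of (quadrant a b)"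
  proof -
    have "quadrant a b \<subseteq> topspace (top_of_set (sphere 0 1))" by (auto simp: quadrant_def)
    then show ?thesis using y closure_of_subset by blast
  qed
  moreover have "y \<notin> (top_of_set (sphere 0 1)) interior_of (quadrant a b)"
  proof
    assume "y \<in> (top_of_set (sphere 0 1)) interior_of (quadrant a b)"
    then obtain U where U: "open U" "y \<in> U" "sphere 0 1 \<inter> U \<subseteq> quadrant a b"
      by (auto simp: interior_of_def openin_open)
    define g where "g t = great_circle y (axis c 1) (- t)" for t
    have "orthonormal_pair y (axis c 1)"
      using ny c by (simp add: orthonormal_pair_def inner_axis)
    then have sph: "g t \<in> sphere 0 1" for t by (simp add: g_def norm_great_circle)
    have "(g \<longlongrightarrow> g 0) (at_right 0)"
      unfolding g_def great_circle_def by (intro tendsto_intros)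
    moreover have "g 0 = y" by (simp add: g_def great_circle_def)
    ultimately have "eventually (\<lambda>t. g t \<in> U) (at_right 0)"
      using U by (metis topological_tendstoD)
    moreover have "eventually (\<lambda>t. 0 < t \<and> t < pi) (at_right 0)"
      using eventually_at_right_real[of 0 pi] by simp
    ultimately have "eventually (\<lambda>t. g t \<in> U \<and> 0 < t \<and> t < pi) (at_right 0)"
      by (rule eventually_conj)
    then obtain t where t: "g t \<in> U" "0 < t" "t < pi"
      using eventually_happens[of _ "at_right (0::real)"] by (auto simp: trivial_limit_at_right_real)
    have "g t $ c = - sin t" using c by (simp add: g_def great_circle_nth)
    moreover have "0 < sin t" using t sin_gt_zero by blast
    moreover have "g t \<in> quadrant a b" using U(3) sph t by blast
    ultimately show False using c by (auto simp: quadrant_def)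
  qed
  ultimately show ?thesis by (simp add: mfd_boundary_def frontier_of_def)
qed

lemma wall_in_reflecting_part:
  assumes y: "y \<in> quadrant a b" "y $ b = 0" "0 < y $ a"
  shows "y \<in> reflecting_part (quadrant a b) (quadrant_tomography a b)"
proof -
  let ?B = "mfd_boundary (quadrant a b)"
  have "openin (top_of_set ?B) (?B \<inter> {z. 0 < z $ a})"
    by (intro openin_open_Int open_Collect_less continuous_intros)
  moreover have "y \<in> ?B \<inter> {z. 0 < z $ a}" using y wall_in_boundary[of y a b b] by simp
  moreover have "?B \<inter> {z. 0 < z $ a} \<subseteq> ?B - quadrant_tomography a b"
    by (auto simp: quadrant_tomography_def)
  ultimately show ?thesis unfolding reflecting_part_def interior_of_def by blast
qed

lemma inward_unit_normal_wall:
  fixes y :: "real ^ 'n::finite"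
  assumes y: "y \<in> quadrant a b" "y $ b = 0" "0 < y $ a"
  shows "inward_unit_normal (quadrant a b) y (axis b 1)"
  unfolding inward_unit_normal_def
proof (intro conjI exI)
  show "open {z::real^'n. 0 < z $ a}" by (intro open_Collect_less continuous_intros)
  show "y \<in> {z. 0 < z $ a}" using y by simp
  show "quadrant a b \<inter> {z. 0 < z $ a} = {z \<in> sphere 0 1 \<inter> {z. 0 < z $ a}. 0 \<le> axis b 1 \<bullet> z}"
    by (auto simp: quadrant_def inner_axis')
qed (use y in \<open>auto simp: inner_axis'\<close>)

text \<open>
  A coordinate of a great circle is a sinusoid; its phase locates the zeros, i.e. the times at which
  the circle crosses the wall.
\<close>

lemma sine_form:
  fixes p q :: real
  assumes "0 < p"
  obtains r \<alpha> where "0 < r" "0 < \<alpha>" "\<alpha> < pi" "p = r * sin \<alpha>" "q = r * cos \<alpha>"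
proof -
  define r where "r = sqrt (p\<^sup>2 + q\<^sup>2)"
  have r: "0 < r" "r\<^sup>2 = p\<^sup>2 + q\<^sup>2" using assms by (auto simp: r_def add_pos_nonneg)
  have "(q / r)\<^sup>2 + (p / r)\<^sup>2 = 1" using r assms by (simp add: power_divide add.commute add_divide_distrib[symmetric])
  moreover have "0 \<le> p / r" using assms r by simp
  ultimately obtain \<alpha> where \<alpha>: "0 \<le> \<alpha>" "\<alpha> \<le> pi" "q / r = cos \<alpha>" "p / r = sin \<alpha>"
    using sincos_total_pi by blast
  have "sin \<alpha> \<noteq> 0" using \<alpha>(4) assms r by auto
  then have "\<alpha> \<noteq> 0" "\<alpha> \<noteq> pi" by auto
  then show ?thesis using that[of r \<alpha>] \<alpha> r by (auto simp: field_simps)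
qed

lemma great_circle_nth_sine:
  assumes "x $ i = r * sin \<alpha>" "v $ i = r * cos \<alpha>"
  shows "great_circle x v t $ i = r * sin (t + \<alpha>)"
  using assms by (simp add: great_circle_nth sin_add algebra_simps)

text \<open>
  A great semicircle that starts and ends in \<open>{x. x $ a = 0}\<close> and crosses \<open>{x. x $ b = 0}\<close> once, at
  time \<open>\<tau>\<close>, becomes a broken ray when the part beyond the wall is mirrored: mirroring one of the two
  arcs is exactly the reflection law at \<open>\<tau>\<close>. The maps \<open>g1\<close> and \<open>g2\<close> say which arc is mirrored.
\<close>

lemma broken_ray_bent:
  fixes x v :: "real ^ 'n::finite"
  assumes ab: "a \<noteq> b" and o: "orthonormal_pair x v" and \<tau>: "0 < \<tau>" "\<tau> < pi"
    and x: "x $ a = 0" and v: "0 < v $ a"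
    and g: "(g1 = id \<and> g2 = wall_reflection b) \<or> (g1 = wall_reflection b \<and> g2 = id)"
    and pos1: "\<And>t. 0 \<le> t \<Longrightarrow> t < \<tau> \<Longrightarrow> 0 < g1 (great_circle x v t) $ b"
    and pos2: "\<And>t. \<tau> < t \<Longrightarrow> t \<le> pi \<Longrightarrow> 0 < g2 (great_circle x v t) $ b"
    and zero: "great_circle x v \<tau> $ b = 0"
  shows "broken_ray (quadrant a b) (quadrant_tomography a b) pi (\<lambda>t. fold_wall b (great_circle x v t))"
    (is "broken_ray ?M ?E pi ?\<gamma>")
proof -
  have sph: "norm (great_circle x v t) = 1" for t by (rule norm_great_circle[OF o])
  have ga: "great_circle x v t $ a = sin t * v $ a" for t by (simp add: great_circle_nth x)
  have ga0: "0 \<le> great_circle x v t $ a" if "0 \<le> t" "t \<le> pi" for t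
    using that v by (simp add: ga sin_ge_zero)
  have gapos: "0 < great_circle x v t $ a" if "0 < t" "t < pi" for t
    using that v by (simp add: ga sin_gt_zero)
  have nth_a: "?\<gamma> t $ a = great_circle x v t $ a" for t using ab by (simp add: fold_wall_nth)
  have \<gamma>1: "?\<gamma> t = g1 (great_circle x v t)" if "0 \<le> t" "t \<le> \<tau>" for t
    using g pos1[of t] that zero by (cases "t = \<tau>") (auto simp: fold_wall_def vec_eq_iff)
  have \<gamma>2: "?\<gamma> t = g2 (great_circle x v t)" if "\<tau> \<le> t" "t \<le> pi" for t
    using g pos2[of t] that zero by (cases "t = \<tau>") (auto simp: fold_wall_def vec_eq_iff)
  have gg: "orthonormal_pair (h x) (h v) \<and> h (great_circle x v t) = great_circle (h x) (h v) t
      \<and> h (great_circle v (- x) t) = great_circle (h v) (- h x) t"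
    if "h = id \<or> h = wall_reflection b" for h t
    using that o orthonormal_pair_wall_reflection[of x v b] great_circle_wall_reflection[of b x v t]
      great_circle_wall_reflection[of b v "- x" t] linear_neg[OF linear_wall_reflection[of b], of x]
    by auto
  have g1: "g1 = id \<or> g1 = wall_reflection b" and g2: "g2 = id \<or> g2 = wall_reflection b"
    using g by auto
  have inM: "?\<gamma> t \<in> ?M" if "0 \<le> t" "t \<le> pi" for t
    using sph[of t] ga0[OF that] nth_a[of t] by (simp add: quadrant_def fold_wall_nth)
  have bpos: "0 < ?\<gamma> t $ b" if "0 \<le> t" "t \<le> pi" "t \<noteq> \<tau>" for t
    using pos1[of t] pos2[of t] \<gamma>1[of t] \<gamma>2[of t] that by (cases "t < \<tau>") auto
  have E: "?\<gamma> t \<in> closure ?E" if "t = 0 \<or> t = pi" for t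
  proof -
    have "?\<gamma> t \<in> ?E"
      using inM[of t] bpos[of t] that \<tau> nth_a[of t] ga[of t] by (auto simp: quadrant_tomography_def)
    then show ?thesis using closure_subset by blast
  qed
  have int: "?\<gamma> t \<in> mfd_interior ?M" if "0 < t" "t < pi" "t \<noteq> \<tau>" for t
    using that gapos[of t] bpos[of t] nth_a[of t] sph[of t] by (intro pos_in_interior) auto
  define ts where "ts i = (if i = 0 then 0 else if i = 1 then \<tau> else pi)" for i :: nat
  have geo1: "unit_speed_geodesic_on {0..\<tau>} ?\<gamma>"
  proof (rule unit_speed_geodesic_on_cong)
    show "unit_speed_geodesic_on {0..\<tau>} (great_circle (g1 x) (g1 v))"
      using gg[OF g1] by (intro unit_speed_geodesic_great_circle) auto
    show "?\<gamma> t = great_circle (g1 x) (g1 v) t" if "t \<in> {0..\<tau>}" for t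
      using \<gamma>1[of t] gg[OF g1, of t] that by simp
  qed
  have geo2: "unit_speed_geodesic_on {\<tau>..pi} ?\<gamma>"
  proof (rule unit_speed_geodesic_on_cong)
    show "unit_speed_geodesic_on {\<tau>..pi} (great_circle (g2 x) (g2 v))"
      using gg[OF g2] by (intro unit_speed_geodesic_great_circle) auto
    show "?\<gamma> t = great_circle (g2 x) (g2 v) t" if "t \<in> {\<tau>..pi}" for t
      using \<gamma>2[of t] gg[OF g2, of t] that by simp
  qed
  have left: "vector_derivative ?\<gamma> (at_left \<tau>) = g1 (great_circle v (- x) \<tau>)"
  proof (rule vector_derivative_within)
    have "(?\<gamma> has_vector_derivative great_circle (g1 v) (- g1 x) \<tau>) (at \<tau> within {0..\<tau>})"
    proof (rule has_vector_derivative_transform)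
      show "(great_circle (g1 x) (g1 v) has_vector_derivative great_circle (g1 v) (- g1 x) \<tau>) (at \<tau> within {0..\<tau>})"
        by (rule great_circle_has_vector_derivative)
      show "?\<gamma> t = great_circle (g1 x) (g1 v) t" if "t \<in> {0..\<tau>}" for t
        using \<gamma>1[of t] gg[OF g1, of t] that by simp
    qed (use \<tau> in auto)
    then have "(?\<gamma> has_vector_derivative great_circle (g1 v) (- g1 x) \<tau>) (at \<tau> within {0<..<\<tau>})"
      by (rule has_vector_derivative_within_subset) auto
    moreover have "at \<tau> within {0<..<\<tau>} = at_left \<tau>"
      using \<tau> by (intro at_within_nhd[of _ "{0<..}"]) auto
    ultimately show "(?\<gamma> has_vector_derivative g1 (great_circle v (- x) \<tau>)) (at_left \<tau>)"
      using gg[OF g1, of \<tau>] by simp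
  qed (simp add: trivial_limit_at_left_real)
  have right: "vector_derivative ?\<gamma> (at_right \<tau>) = g2 (great_circle v (- x) \<tau>)"
  proof (rule vector_derivative_within)
    have "(?\<gamma> has_vector_derivative great_circle (g2 v) (- g2 x) \<tau>) (at \<tau> within {\<tau>..pi})"
    proof (rule has_vector_derivative_transform)
      show "(great_circle (g2 x) (g2 v) has_vector_derivative great_circle (g2 v) (- g2 x) \<tau>) (at \<tau> within {\<tau>..pi})"
        by (rule great_circle_has_vector_derivative)
      show "?\<gamma> t = great_circle (g2 x) (g2 v) t" if "t \<in> {\<tau>..pi}" for t
        using \<gamma>2[of t] gg[OF g2, of t] that by simp
    qed (use \<tau> in auto)
    then have "(?\<gamma> has_vector_derivative great_circle (g2 v) (- g2 x) \<tau>) (at \<tau> within {\<tau><..<pi})"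
      by (rule has_vector_derivative_within_subset) auto
    moreover have "at \<tau> within {\<tau><..<pi} = at_right \<tau>"
      using \<tau> by (intro at_within_nhd[of _ "{..<pi}"]) auto
    ultimately show "(?\<gamma> has_vector_derivative g2 (great_circle v (- x) \<tau>)) (at_right \<tau>)"
      using gg[OF g2, of \<tau>] by simp
  qed (simp add: trivial_limit_at_right_real)
  have \<tau>b: "?\<gamma> \<tau> $ b = 0" using zero by (simp add: fold_wall_nth)
  have \<tau>a: "0 < ?\<gamma> \<tau> $ a" using gapos[of \<tau>] \<tau> nth_a by simp
  have \<tau>M: "?\<gamma> \<tau> \<in> ?M" using inM[of \<tau>] \<tau> by simp
  have law: "vector_derivative ?\<gamma> (at_right \<tau>)
      = reflect_velocity (axis b 1) (vector_derivative ?\<gamma> (at_left \<tau>))"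
    unfolding left right reflect_velocity_axis using g by auto
  show ?thesis unfolding broken_ray_def
  proof (intro conjI)
    show "?\<gamma> ` {0..pi} \<subseteq> ?M" using inM by auto
    show "?\<gamma> 0 \<in> closure ?E" "?\<gamma> pi \<in> closure ?E" using E by blast+
    show "\<exists>k \<tau>. 0 < k \<and> \<tau> 0 = 0 \<and> \<tau> k = pi \<and>
      (\<forall>i<k. \<tau> i < \<tau> (Suc i) \<and> unit_speed_geodesic_on {\<tau> i..\<tau> (Suc i)} ?\<gamma> \<and>
         ?\<gamma> ` {\<tau> i<..<\<tau> (Suc i)} \<subseteq> mfd_interior ?M) \<and>
      (\<forall>i. 0 < i \<and> i < k \<longrightarrow> ?\<gamma> (\<tau> i) \<in> reflecting_part ?M ?E \<and>
         (\<exists>\<nu>. inward_unit_normal ?M (?\<gamma> (\<tau> i)) \<nu> \<and>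
            vector_derivative ?\<gamma> (at_right (\<tau> i)) =
            reflect_velocity \<nu> (vector_derivative ?\<gamma> (at_left (\<tau> i)))))"
    proof (intro exI[of _ "2::nat"] exI[of _ ts] conjI allI impI)
      fix i :: nat assume "i < 2"
      then have i: "i = 0 \<or> i = 1" by auto
      show "ts i < ts (Suc i)" using i \<tau> by (auto simp: ts_def)
      show "unit_speed_geodesic_on {ts i..ts (Suc i)} ?\<gamma>" using i geo1 geo2 by (auto simp: ts_def)
      show "?\<gamma> ` {ts i<..<ts (Suc i)} \<subseteq> mfd_interior ?M" using i int \<tau> by (auto simp: ts_def)
    next
      fix i :: nat assume "0 < i \<and> i < 2"
      then have i: "ts i = \<tau>" by (auto simp: ts_def)
      show "?\<gamma> (ts i) \<in> reflecting_part ?M ?E"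
        unfolding i by (rule wall_in_reflecting_part[OF \<tau>M \<tau>b \<tau>a])
      show "\<exists>\<nu>. inward_unit_normal ?M (?\<gamma> (ts i)) \<nu> \<and>
            vector_derivative ?\<gamma> (at_right (ts i)) =
            reflect_velocity \<nu> (vector_derivative ?\<gamma> (at_left (ts i)))"
        unfolding i using inward_unit_normal_wall[OF \<tau>M \<tau>b \<tau>a] law by blast
    qed (auto simp: ts_def)
  qed simp
qed

text \<open>
  The great circle through \<open>x\<close> with velocity \<open>v\<close>, reflected into the quadrant, is a broken ray of
  length \<open>\<pi>\<close>. The time \<open>s\<close> at which the ray reaches \<open>x\<close> enters because a ray starts at the wall
  \<open>{x. x $ a = 0}\<close> and not at \<open>x\<close>. For \<open>a = b\<close> the quadrant is a half sphere.
\<close>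

definition folded_circle_through ::
  "'n \<Rightarrow> 'n \<Rightarrow> (real ^ 'n::finite) set \<Rightarrow> real ^ 'n \<Rightarrow> real ^ 'n \<Rightarrow> bool"
  where "folded_circle_through a b E x v \<longleftrightarrow>
    (\<exists>\<gamma> s. broken_ray (quadrant a b) E pi \<gamma> \<and> 0 < s \<and> s < pi \<and> \<gamma> s = x \<and>
       (\<gamma> has_vector_derivative v) (at s) \<and>
       (\<forall>t\<in>{0<..<pi}. great_circle x v (t - s) $ a \<noteq> 0 \<and>
          \<gamma> t = fold_sphere a b (great_circle x v (t - s))))"

lemma folded_circle_throughI:
  fixes x v :: "real ^ 'n::finite"
  assumes o: "orthonormal_pair x v" and xb: "0 < x $ b"
    and r: "0 < r" and \<alpha>: "0 < \<alpha>" "\<alpha> < pi" and xa: "x $ a = r * sin \<alpha>" "v $ a = r * cos \<alpha>"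
    and ray: "broken_ray (quadrant a b) E pi (\<lambda>t. fold_wall b (great_circle x v (t - \<alpha>)))"
  shows "folded_circle_through a b E x v"
  unfolding folded_circle_through_def
proof (intro exI conjI ballI)
  let ?\<gamma> = "\<lambda>t. fold_wall b (great_circle x v (t - \<alpha>))"
  show "broken_ray (quadrant a b) E pi ?\<gamma>" "0 < \<alpha>" "\<alpha> < pi" by fact+
  show "?\<gamma> \<alpha> = x" using xb by (simp add: great_circle_def fold_wall_def)
  have d: "((\<lambda>t. great_circle x v (t - \<alpha>)) has_vector_derivative v) (at \<alpha>)"
    unfolding great_circle_def by (auto intro!: derivative_eq_intros)
  have "((\<lambda>t. great_circle x v (t - \<alpha>) $ b) \<longlongrightarrow> great_circle x v (\<alpha> - \<alpha>) $ b) (at \<alpha>)"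
    unfolding great_circle_nth by (intro tendsto_intros)
  then have "eventually (\<lambda>t. 0 < great_circle x v (t - \<alpha>) $ b) (at \<alpha>)"
    using xb by (intro order_tendstoD(1)[of _ "x $ b"]) (auto simp: great_circle_def)
  then have "eventually (\<lambda>t. ?\<gamma> t = great_circle x v (t - \<alpha>)) (at \<alpha>)"
    by eventually_elim (simp add: fold_wall_def)
  then obtain e where e: "0 < e" "\<And>t. t \<noteq> \<alpha> \<Longrightarrow> dist t \<alpha> < e \<Longrightarrow> ?\<gamma> t = great_circle x v (t - \<alpha>)"
    unfolding eventually_at by auto
  have "?\<gamma> t = great_circle x v (t - \<alpha>)" if "dist t \<alpha> < e" for t
    using e(2)[OF _ that] xb by (cases "t = \<alpha>") (auto simp: great_circle_def fold_wall_def)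
  then show "(?\<gamma> has_vector_derivative v) (at \<alpha>)"
    using e(1) by (intro has_vector_derivative_transform_within[OF d, of e]) auto
  fix t assume t: "t \<in> {0<..<pi}"
  have "great_circle x v (t - \<alpha>) $ a = r * sin t"
    by (subst great_circle_nth_sine[OF xa]) simp
  moreover have "0 < sin t" using t by (simp add: sin_gt_zero)
  ultimately have "0 < great_circle x v (t - \<alpha>) $ a" using r by simp
  then show "great_circle x v (t - \<alpha>) $ a \<noteq> 0"
    "?\<gamma> t = fold_sphere a b (great_circle x v (t - \<alpha>))"
    by (auto simp: fold_sphere_def)
qed

text \<open>
  The \<open>a\<close>-coordinate of the circle has phase \<open>\<alpha>\<close> and its \<open>b\<close>-coordinate phase \<open>\<beta>\<close>. The generic
  position of \<open>(x, v)\<close> means \<open>\<alpha> \<noteq> \<beta>\<close>, so that the wall is crossed in the interior of the semicircle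
  and not at its end points, which would then be corners of the quadrant.
\<close>

lemma quadrant_ray_through:
  fixes x v :: "real ^ 'n::finite"
  assumes ab: "a \<noteq> b" and o: "orthonormal_pair x v" and xa: "0 < x $ a" and xb: "0 < x $ b"
    and generic: "x $ a * v $ b \<noteq> x $ b * v $ a"
  shows "folded_circle_through a b (quadrant_tomography a b) x v"
proof -
  obtain r \<alpha> where r: "0 < r" and \<alpha>: "0 < \<alpha>" "\<alpha> < pi" and a: "x $ a = r * sin \<alpha>" "v $ a = r * cos \<alpha>"
    using sine_form[OF xa] by metis
  obtain q \<beta> where q: "0 < q" and \<beta>: "0 < \<beta>" "\<beta> < pi" and b: "x $ b = q * sin \<beta>" "v $ b = q * cos \<beta>"
    using sine_form[OF xb] by metis
  \<comment> \<open>Start at time \<open>- \<alpha>\<close>, when the circle enters the half sphere \<open>{x. 0 \<le> x $ a}\<close>.\<close>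
  define y w where "y = great_circle x v (- \<alpha>)" and "w = great_circle v (- x) (- \<alpha>)"
  have oyw: "orthonormal_pair y w" unfolding y_def w_def by (rule orthonormal_pair_great_circle[OF o])
  have gc: "great_circle x v (t - \<alpha>) = great_circle y w t" for t
    using great_circle_add[of x v "- \<alpha>" t] by (simp add: y_def w_def)
  have ya: "y $ a = 0" unfolding y_def by (subst great_circle_nth_sine[OF a]) simp
  have "w $ a = cos \<alpha> * (r * cos \<alpha>) + sin \<alpha> * (r * sin \<alpha>)"
    by (simp add: w_def great_circle_nth a)
  also have "\<dots> = r * ((cos \<alpha>)\<^sup>2 + (sin \<alpha>)\<^sup>2)" by algebra
  finally have "w $ a = r * ((cos \<alpha>)\<^sup>2 + (sin \<alpha>)\<^sup>2)" .
  then have wa: "0 < w $ a" using r by simp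
  have gb: "great_circle y w t $ b = q * sin (t - \<alpha> + \<beta>)" for t
    unfolding gc[symmetric] by (rule great_circle_nth_sine[OF b])
  have "\<alpha> \<noteq> \<beta>" using generic a b by auto
  then have "broken_ray (quadrant a b) (quadrant_tomography a b) pi (\<lambda>t. fold_wall b (great_circle y w t))"
  proof (cases rule: linorder_cases[of \<alpha> \<beta>])
    case less
    show ?thesis
    proof (rule broken_ray_bent[OF ab oyw _ _ ya wa, of "pi + \<alpha> - \<beta>" id "wall_reflection b"])
      show "0 < id (great_circle y w t) $ b" if "0 \<le> t" "t < pi + \<alpha> - \<beta>" for t
        using that less q \<alpha> \<beta> by (simp add: gb sin_gt_zero)
      show "0 < wall_reflection b (great_circle y w t) $ b" if "pi + \<alpha> - \<beta> < t" "t \<le> pi" for t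
      proof -
        have "sin (t - \<alpha> + \<beta>) = - sin (t - \<alpha> + \<beta> - pi)" by (simp add: sin_diff)
        moreover have "0 < sin (t - \<alpha> + \<beta> - pi)"
          using that less \<alpha> \<beta> by (intro sin_gt_zero) auto
        ultimately show ?thesis using q by (simp add: gb mult_pos_neg)
      qed
    qed (use less \<alpha> \<beta> in \<open>auto simp: gb\<close>)
  next
    case greater
    show ?thesis
    proof (rule broken_ray_bent[OF ab oyw _ _ ya wa, of "\<alpha> - \<beta>" "wall_reflection b" id])
      show "0 < id (great_circle y w t) $ b" if "\<alpha> - \<beta> < t" "t \<le> pi" for t
        using that greater q \<alpha> \<beta> by (simp add: gb sin_gt_zero)
      show "0 < wall_reflection b (great_circle y w t) $ b" if "0 \<le> t" "t < \<alpha> - \<beta>" for t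
      proof -
        have "sin (t - \<alpha> + \<beta>) = - sin (\<alpha> - \<beta> - t)" by (metis sin_minus minus_diff_eq add_uminus_conv_diff diff_diff_eq2 diff_add_eq diff_diff_eq)
        moreover have "0 < sin (\<alpha> - \<beta> - t)"
          using that greater \<alpha> \<beta> by (intro sin_gt_zero) auto
        ultimately show ?thesis using q by (simp add: gb mult_pos_neg)
      qed
    qed (use greater \<alpha> \<beta> in \<open>auto simp: gb\<close>)
  qed simp
  then show ?thesis
    using folded_circle_throughI[OF o xb r \<alpha> a] by (simp add: gc)
qed

text \<open>
  For \<open>1 < \<epsilon>\<close> the set of tomography is the whole boundary circle, and every great semicircle is a
  ray without reflections.
\<close>

lemma hemisphere_ray_through:
  fixes x v :: "real ^ 3"
  assumes o: "orthonormal_pair x v" and x2: "0 < x $ 2" and \<epsilon>: "1 < \<epsilon>"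
  shows "folded_circle_through 2 2 (hemisphere_tomography \<epsilon>) x v"
proof -
  obtain r \<alpha> where r: "0 < r" and \<alpha>: "0 < \<alpha>" "\<alpha> < pi" and a: "x $ 2 = r * sin \<alpha>" "v $ 2 = r * cos \<alpha>"
    using sine_form[OF x2] by metis
  let ?c = "\<lambda>t. great_circle x v (t - \<alpha>)"
  let ?M = "quadrant (2::3) 2"
  define y w where "y = great_circle x v (- \<alpha>)" and "w = great_circle v (- x) (- \<alpha>)"
  have oyw: "orthonormal_pair y w" unfolding y_def w_def by (rule orthonormal_pair_great_circle[OF o])
  have gc: "?c t = great_circle y w t" for t
    using great_circle_add[of x v "- \<alpha>" t] by (simp add: y_def w_def)
  have c2: "?c t $ 2 = r * sin t" for t by (subst great_circle_nth_sine[OF a]) simp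
  have sph: "norm (?c t) = 1" for t by (rule norm_great_circle[OF o])
  let ?\<gamma> = "\<lambda>t. fold_wall 2 (?c t)"
  have \<gamma>: "?\<gamma> t = great_circle y w t" if "0 \<le> t" "t \<le> pi" for t
    using r that by (simp add: fold_wall_def c2 sin_ge_zero gc[symmetric])
  have inM: "?\<gamma> t \<in> ?M" for t using sph[of t] by (simp add: quadrant_def fold_wall_nth)
  have E: "?\<gamma> t \<in> closure (hemisphere_tomography \<epsilon>)" if "t = 0 \<or> t = pi" for t
  proof -
    have "?\<gamma> t \<in> mfd_boundary ?M"
      using that inM[of t] c2[of t] by (intro wall_in_boundary[of _ 2 2 2]) (auto simp: fold_wall_nth)
    moreover have "?\<gamma> t $ 1 < \<epsilon>"
      using component_le_norm_cart[of "?\<gamma> t" 1] sph[of t] \<epsilon> by (simp del: component_le_norm_cart)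
    ultimately have "?\<gamma> t \<in> hemisphere_tomography \<epsilon>"
      by (simp add: hemisphere_tomography_def hemisphere_eq_quadrant)
    then show ?thesis using closure_subset by blast
  qed
  have int: "?\<gamma> t \<in> mfd_interior ?M" if "0 < t" "t < pi" for t
    using that r sph[of t] sin_gt_zero[of t] by (intro pos_in_interior) (auto simp: fold_wall_nth c2)
  have "broken_ray ?M (hemisphere_tomography \<epsilon>) pi ?\<gamma>"
    unfolding broken_ray_def
  proof (intro conjI exI[of _ "1::nat"] exI[of _ "\<lambda>i. real i * pi"] allI impI)
    show "?\<gamma> ` {0..pi} \<subseteq> ?M" using inM by auto
    show "?\<gamma> 0 \<in> closure (hemisphere_tomography \<epsilon>)" "?\<gamma> pi \<in> closure (hemisphere_tomography \<epsilon>)"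
      using E by blast+
    fix i :: nat assume "i < 1"
    then have i: "i = 0" by simp
    show "unit_speed_geodesic_on {real i * pi..real (Suc i) * pi} ?\<gamma>"
      by (rule unit_speed_geodesic_on_cong[OF unit_speed_geodesic_great_circle[OF oyw]])
        (use \<gamma> i in auto)
    show "?\<gamma> ` {real i * pi<..<real (Suc i) * pi} \<subseteq> mfd_interior ?M"
      using int i by auto
  qed auto
  then show ?thesis
    using folded_circle_throughI[OF o x2 r \<alpha> a] by simp
qed

section \<open>Surface measure and almost every broken ray\<close>

lemma vec_nth_measurable [measurable]: "(\<lambda>y. y $ i) \<in> borel_measurable (borel :: (real ^ 'n::finite) measure)"
  by (intro borel_measurable_continuous_onI continuous_intros)

lemma closed_quadrant: "closed (quadrant a b)"
proof -
  have "quadrant a b = sphere 0 1 \<inter> ({y. 0 \<le> y $ a} \<inter> {y. 0 \<le> y $ b})"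
    by (auto simp: quadrant_def)
  then show ?thesis
    by (simp only:) (intro closed_Int closed_sphere closed_Collect_le continuous_intros)
qed

lemma quadrant_sets [measurable]: "quadrant a b \<in> sets borel"
  by (rule borel_closed[OF closed_quadrant])

lemma fold_sphere_measurable [measurable]:
  "fold_sphere a b \<in> borel_measurable (borel :: (real ^ 'n::finite) measure)"
proof -
  have [measurable]: "fold_wall b \<in> borel_measurable (borel :: (real ^ 'n::finite) measure)"
    unfolding fold_wall_def wall_reflection_def by measurable
  show ?thesis unfolding fold_sphere_def by measurable
qed

lemma sets_sphere_measure [simp, measurable_cong]: "sets sphere_measure = sets borel"
  by (simp add: sphere_measure_def)

lemma space_sphere_measure [simp]: "space sphere_measure = UNIV"
  by (simp add: sphere_measure_def space_scale_measure)

lemma nn_integral_sphere_measure: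
  fixes g :: "'a::euclidean_space \<Rightarrow> ennreal"
  assumes [measurable]: "g \<in> borel_measurable borel"
  shows "(\<integral>\<^sup>+x. g x \<partial>sphere_measure)
    = ennreal (real DIM('a)) * (\<integral>\<^sup>+u. g (sgn u) * indicator (ball 0 1) u \<partial>lborel)"
proof -
  have [measurable]: "sgn \<in> restrict_space lborel (ball (0::'a) 1) \<rightarrow>\<^sub>M borel"
    by (rule measurable_restrict_space1) simp
  show ?thesis
    unfolding sphere_measure_def
    by (simp add: nn_integral_scale_measure nn_integral_distr nn_integral_restrict_space)
qed

lemma finite_measure_sphere_measure: "finite_measure (sphere_measure :: 'a::euclidean_space measure)"
proof (rule finite_measureI)
  have "emeasure (sphere_measure :: 'a measure) UNIV = (\<integral>\<^sup>+x. 1 \<partial>(sphere_measure :: 'a measure))"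
    by simp
  also have "\<dots> = ennreal (real DIM('a)) * emeasure lborel (ball (0::'a) 1)"
    by (subst nn_integral_sphere_measure) simp_all
  also have "\<dots> < \<infinity>"
    using emeasure_lborel_ball_finite[of "0::'a" 1] by (simp add: ennreal_mult_less_top)
  finally show "emeasure (sphere_measure :: 'a measure) (space sphere_measure) \<noteq> \<infinity>" by simp
qed

lemma finite_measure_surface_measure:
  "M \<in> sets borel \<Longrightarrow> finite_measure (surface_measure M)"
  unfolding surface_measure_def
  by (rule finite_measure_restrict_space[OF finite_measure_sphere_measure]) simp

text \<open>
  Stated for arbitrary \<open>P\<close>, because it is applied to statements that are quantified over all rays
  through a point, whose measurability is not evident.
\<close>

lemma AE_sphere_measureD:
  fixes P :: "'a::euclidean_space \<Rightarrow> bool"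
  assumes "AE x in sphere_measure. P x"
  shows "AE u in lborel. u \<in> ball 0 1 \<longrightarrow> P (sgn u)"
proof -
  let ?D = "distr (restrict_space lborel (ball (0::'a) 1)) borel sgn"
  have m: "sgn \<in> restrict_space lborel (ball (0::'a) 1) \<rightarrow>\<^sub>M borel"
    by (rule measurable_restrict_space1) simp
  have "ae_filter (sphere_measure :: 'a measure) = ae_filter ?D"
    by (simp add: sphere_measure_def ae_filter_def null_sets_def space_scale_measure)
  then have "AE x in ?D. P x" using assms by (simp only:)
  then have "AE u in restrict_space lborel (ball 0 1). P (sgn u)" by (rule AE_distrD[OF m])
  then show ?thesis by (subst (asm) AE_restrict_space_iff) auto
qed

lemma AE_sphere_measureI:
  fixes P :: "'a::euclidean_space \<Rightarrow> bool"
  assumes P[measurable]: "Measurable.pred borel P"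
    and ae: "AE u in lborel. u \<in> ball 0 1 \<longrightarrow> P (sgn u)"
  shows "AE x in sphere_measure. P x"
proof -
  let ?D = "distr (restrict_space lborel (ball (0::'a) 1)) borel sgn"
  have m: "sgn \<in> restrict_space lborel (ball (0::'a) 1) \<rightarrow>\<^sub>M borel"
    by (rule measurable_restrict_space1) simp
  have "AE u in restrict_space lborel (ball 0 1). P (sgn u)"
    using ae by (subst AE_restrict_space_iff) auto
  then have "AE x in ?D. P x" using m by (subst AE_distr_iff) auto
  moreover have "ae_filter (sphere_measure :: 'a measure) = ae_filter ?D"
    by (simp add: sphere_measure_def ae_filter_def null_sets_def space_scale_measure)
  ultimately show ?thesis by (simp only:)
qed

lemma AE_surface_measure_iff:
  "(AE x in surface_measure (quadrant a b). P x) \<longleftrightarrow> (AE x in sphere_measure. x \<in> quadrant a b \<longrightarrow> P x)"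
  unfolding surface_measure_def by (rule AE_restrict_space_iff) simp

lemma rejection_sgn: "sgn (rejection x (sgn w)) = sgn (rejection x w)"
proof (cases "w = 0")
  case False
  have "rejection x (sgn w) = inverse (norm w) *\<^sub>R rejection x w"
    by (simp add: rejection_def sgn_div_norm algebra_simps)
  then show ?thesis using False by (simp add: sgn_scaleR)
qed (simp add: rejection_def)

text \<open>
  The Liouville measure is the image of a product of two surface measures, and the surface measure
  is the image of Lebesgue measure on the ball. A property of almost every broken ray therefore
  holds for the rays along almost every pair \<open>(u, w)\<close> of vectors. The two quantifiers stay separate,
  since the property is not known to be measurable jointly in the pair.
\<close>

lemma AE_broken_rayD:
  fixes E :: "(real ^ 'n::finite) set"
  assumes "AE_broken_ray (quadrant a b) E P"
  shows "AE u in lborel. u \<in> ball 0 1 \<and> sgn u \<in> quadrant a b \<longrightarrow>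
    (AE w in lborel. w \<in> ball 0 1 \<longrightarrow>
      (\<forall>L \<gamma>. broken_ray (quadrant a b) E L \<gamma> \<and> (\<exists>t\<in>{0<..<L}. \<gamma> t = sgn u \<and>
        (\<gamma> has_vector_derivative sgn (rejection (sgn u) w)) (at t)) \<longrightarrow> P L \<gamma>))"
proof -
  let ?M = "quadrant a b"
  define Q where "Q x v \<longleftrightarrow> (\<forall>L \<gamma>. broken_ray ?M E L \<gamma> \<and> (\<exists>t\<in>{0<..<L}. \<gamma> t = x \<and>
        (\<gamma> has_vector_derivative v) (at t)) \<longrightarrow> P L \<gamma>)" for x v
  interpret S: finite_measure "sphere_measure :: (real ^ 'n) measure" by (rule finite_measure_sphere_measure)
  interpret F: finite_measure "surface_measure ?M"
    unfolding surface_measure_def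
    by (rule finite_measure_restrict_space[OF finite_measure_sphere_measure]) simp
  interpret pair_sigma_finite "surface_measure ?M" "sphere_measure :: (real ^ 'n) measure" ..
  have fst: "fst \<in> surface_measure ?M \<Otimes>\<^sub>M sphere_measure \<rightarrow>\<^sub>M borel"
    unfolding surface_measure_def
    by (rule measurable_compose[OF measurable_fst]) (rule measurable_restrict_space1, simp)
  note [measurable] = fst
  have "(\<lambda>z. (fst z, sgn (snd z - (snd z \<bullet> fst z) *\<^sub>R fst z)))
      \<in> surface_measure ?M \<Otimes>\<^sub>M sphere_measure \<rightarrow>\<^sub>M borel \<Otimes>\<^sub>M borel"
    by measurable
  then have m: "(\<lambda>(x, w). (x, sgn (w - (w \<bullet> x) *\<^sub>R x)))
      \<in> surface_measure ?M \<Otimes>\<^sub>M sphere_measure \<rightarrow>\<^sub>M borel"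
    by (simp add: case_prod_unfold borel_prod)
  have "AE z in liouville_measure ?M. Q (fst z) (snd z)"
    using assms unfolding AE_broken_ray_def Q_def by (simp add: case_prod_unfold)
  then have "AE z in surface_measure ?M \<Otimes>\<^sub>M sphere_measure. Q (fst z) (sgn (rejection (fst z) (snd z)))"
    unfolding liouville_measure_def rejection_def
    using AE_distrD[OF m, of "\<lambda>z. Q (fst z) (snd z)"] by (simp add: case_prod_unfold)
  then have "AE x in surface_measure ?M. AE w in sphere_measure. Q x (sgn (rejection x w))"
    using AE_pair[of "\<lambda>z. Q (fst z) (sgn (rejection (fst z) (snd z)))"] by simp
  then have "AE x in sphere_measure. x \<in> ?M \<longrightarrow> (AE w in sphere_measure. Q x (sgn (rejection x w)))"
    by (simp add: AE_surface_measure_iff)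
  then have "AE u in lborel. u \<in> ball 0 1 \<longrightarrow> sgn u \<in> ?M \<longrightarrow>
      (AE w in sphere_measure. Q (sgn u) (sgn (rejection (sgn u) w)))"
    by (rule AE_sphere_measureD)
  then show ?thesis
    unfolding Q_def[symmetric]
  proof eventually_elim
    fix u :: "real ^ 'n"
    assume *: "u \<in> ball 0 1 \<longrightarrow> sgn u \<in> ?M \<longrightarrow>
      (AE w in sphere_measure. Q (sgn u) (sgn (rejection (sgn u) w)))"
    show "u \<in> ball 0 1 \<and> sgn u \<in> ?M \<longrightarrow>
      (AE w in lborel. w \<in> ball 0 1 \<longrightarrow> Q (sgn u) (sgn (rejection (sgn u) w)))"
    proof
      assume "u \<in> ball 0 1 \<and> sgn u \<in> ?M"
      then have "AE w in sphere_measure. Q (sgn u) (sgn (rejection (sgn u) w))" using * by blast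
      from AE_sphere_measureD[OF this]
      show "AE w in lborel. w \<in> ball 0 1 \<longrightarrow> Q (sgn u) (sgn (rejection (sgn u) w))"
        by (simp add: rejection_sgn)
    qed
  qed
qed

section \<open>Unfolding functions on a quadrant\<close>

text \<open>
  The function obtained by unfolding the quadrant, extended to be homogeneous of degree 0. The value
  0 on the null set \<open>{u. u $ a = 0}\<close> makes it even without exceptions; there \<open>fold_sphere\<close> need not
  take equal values at antipodes.
\<close>

definition even_extension :: "'n \<Rightarrow> 'n \<Rightarrow> (real ^ 'n::finite \<Rightarrow> real) \<Rightarrow> real ^ 'n \<Rightarrow> real"
  where "even_extension a b f u = (if u $ a = 0 then 0
    else indicator (quadrant a b) (fold_sphere a b (sgn u)) * f (fold_sphere a b (sgn u)))"

lemma sgn_nth: "sgn u $ a = u $ a / norm u" for u :: "real ^ 'n::finite"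
  by (simp add: sgn_div_norm divide_inverse)

lemma sgn_nth_eq_0: "sgn u $ a = 0 \<longleftrightarrow> u $ a = 0" for u :: "real ^ 'n::finite"
  by (cases "u = 0") (auto simp: sgn_nth)

lemma projective_even_extension: "projective (even_extension a b f)" for a b :: "'n::finite"
  unfolding projective_def
proof (intro allI impI)
  fix c :: real and y :: "real ^ 'n" assume c: "c \<noteq> 0"
  show "even_extension a b f (c *\<^sub>R y) = even_extension a b f y"
  proof (cases "y $ a = 0")
    case False
    then have "fold_sphere a b (sgn (c *\<^sub>R y)) = fold_sphere a b (sgn y)"
      using c fold_sphere_uminus[of "sgn y" a b]
      by (cases "0 < c") (auto simp: sgn_scaleR sgn_nth_eq_0)
    then show ?thesis using c by (simp add: even_extension_def)
  qed (simp add: even_extension_def)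
qed

lemma even_extension_measurable:
  assumes "f \<in> borel_measurable (surface_measure (quadrant a b))"
  shows "even_extension a b f \<in> borel_measurable borel"
proof -
  have "(\<lambda>x. indicator (quadrant a b) x *\<^sub>R f x) \<in> borel_measurable sphere_measure"
    using assms unfolding surface_measure_def by (subst (asm) borel_measurable_restrict_space_iff) auto
  then have [measurable]: "(\<lambda>x. indicator (quadrant a b) x * f x) \<in> borel_measurable borel" by simp
  show ?thesis
    unfolding even_extension_def[abs_def]
    by (rule measurable_If) measurable
qed

lemma even_extension_eq:
  assumes "x \<in> quadrant a b" "x $ a \<noteq> 0"
  shows "even_extension a b f x = f x"
  using assms by (simp add: even_extension_def fold_sphere_quadrant quadrant_def) 
    (simp add: fold_sphere_quadrant quadrant_def sgn_div_norm)

lemma sgn_wall_reflection: "sgn (wall_reflection b u) = wall_reflection b (sgn u)"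
  by (simp add: sgn_div_norm linear_scale[OF linear_wall_reflection])

lemma even_extension_wall_reflection:
  fixes a b :: "'n::finite"
  assumes "a \<noteq> b"
  shows "even_extension a b f (wall_reflection b u) = even_extension a b f u"
proof -
  have "fold_wall b (wall_reflection b y) = fold_wall b y" for y :: "real ^ 'n"
    by (auto simp: fold_wall_def vec_eq_iff)
  moreover have "- wall_reflection b y = wall_reflection b (- y)" for y :: "real ^ 'n"
    by (simp add: linear_neg[OF linear_wall_reflection])
  ultimately have "fold_sphere a b (wall_reflection b y) = fold_sphere a b y" for y :: "real ^ 'n"
    using assms by (simp add: fold_sphere_def)
  then show ?thesis using assms by (simp add: even_extension_def sgn_wall_reflection)
qed

text \<open>
  The extension is dominated by the sum of the four images of \<open>\<bar>f\<bar>\<close> under the group generated by the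
  antipodal map and the wall reflection.
\<close>

lemma integrable_even_extension:
  fixes f :: "real ^ 'n::finite \<Rightarrow> real"
  assumes f: "integrable (surface_measure (quadrant a b)) f"
  shows "set_integrable lborel (ball 0 1) (even_extension a b f)"
proof -
  define f0 where "f0 x = indicator (quadrant a b) x *\<^sub>R f x" for x
  have f0: "integrable sphere_measure f0"
    using f unfolding surface_measure_def f0_def by (subst (asm) integrable_restrict_space) auto
  then have [measurable]: "f0 \<in> borel_measurable borel" by (auto dest: borel_measurable_integrable)
  have [measurable]: "ball (0 :: real ^ 'n) 1 \<in> sets borel" by simp
  define k where "k u = indicator (ball 0 1) u * \<bar>f0 (sgn u)\<bar>" for u
  have k: "integrable lborel k"
    unfolding integrable_iff_bounded
  proof
    show "k \<in> borel_measurable lborel" unfolding k_def by measurable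
    have "(\<integral>\<^sup>+x. ennreal (norm (f0 x)) \<partial>sphere_measure) < \<infinity>"
      using f0 by (simp add: integrable_iff_bounded)
    then have "(\<integral>\<^sup>+u. ennreal (norm (f0 (sgn u))) * indicator (ball 0 1) u \<partial>lborel) < \<infinity>"
      by (subst (asm) nn_integral_sphere_measure) (auto simp: ennreal_mult_less_top)
    then show "(\<integral>\<^sup>+u. ennreal (norm (k u)) \<partial>lborel) < \<infinity>"
      by (simp add: k_def abs_mult ennreal_mult ennreal_indicator mult.commute)
  qed
  let ?R = "wall_reflection b"
  have neg: "orthogonal_transformation (uminus :: real ^ 'n \<Rightarrow> real ^ 'n)"
    by (simp add: orthogonal_transformation_def linear_uminus)
  note R = orthogonal_transformation_wall_reflection[of b]
  have k2: "integrable lborel (\<lambda>u. k (?R u))" by (rule integrable_lborel_orthogonal[OF R k])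
  have "integrable lborel (\<lambda>u. k u + k (- u) + k (?R u) + k (?R (- u)))"
    using k k2 integrable_lborel_orthogonal[OF neg k] integrable_lborel_orthogonal[OF neg k2]
    by (intro Bochner_Integration.integrable_add)
  then have "integrable lborel (\<lambda>u. indicator (ball 0 1) u *\<^sub>R even_extension a b f u)"
  proof (rule Bochner_Integration.integrable_bound)
    have "even_extension a b f \<in> borel_measurable borel"
      using f by (intro even_extension_measurable borel_measurable_integrable)
    then show "(\<lambda>u. indicator (ball 0 1) u *\<^sub>R even_extension a b f u) \<in> borel_measurable lborel" by simp
    show "AE u in lborel. norm (indicator (ball 0 1) u *\<^sub>R even_extension a b f u)
        \<le> norm (k u + k (- u) + k (?R u) + k (?R (- u)))"
    proof (rule AE_I2)
      fix u :: "real ^ 'n"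
      have k0: "0 \<le> k v" for v by (simp add: k_def)
      have ext: "\<bar>even_extension a b f u\<bar> \<le> \<bar>f0 (fold_sphere a b (sgn u))\<bar>"
        by (simp add: even_extension_def f0_def)
      have "fold_sphere a b (sgn u) \<in> {sgn u, - sgn u, ?R (sgn u), ?R (- sgn u)}"
        by (simp add: fold_sphere_def fold_wall_def)
      then have "\<exists>v\<in>{u, - u, ?R u, ?R (- u)}. fold_sphere a b (sgn u) = sgn v"
        by (simp add: sgn_minus sgn_wall_reflection)
      then obtain v where v: "v \<in> {u, - u, ?R u, ?R (- u)}" "fold_sphere a b (sgn u) = sgn v" by blast
      have "norm v = norm u" using v(1) by auto
      then have "indicator (ball 0 1) u * \<bar>even_extension a b f u\<bar> \<le> k v"
        using ext v(2) by (simp add: k_def indicator_def)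
      also have "k v \<le> k u + k (- u) + k (?R u) + k (?R (- u))"
        using v(1) k0[of u] k0[of "- u"] k0[of "?R u"] k0[of "?R (- u)"] by auto
      finally show "norm (indicator (ball 0 1) u *\<^sub>R even_extension a b f u)
        \<le> norm (k u + k (- u) + k (?R u) + k (?R (- u)))" by (simp add: abs_mult)
    qed
  qed
  then show ?thesis by (simp add: set_integrable_def)
qed

lemma square_integrable_imp_integrable:
  assumes M: "M \<in> sets borel" and f: "f \<in> square_integrable M"
  shows "integrable (surface_measure M) f"
proof (rule Bochner_Integration.integrable_bound)
  interpret finite_measure "surface_measure M" by (rule finite_measure_surface_measure[OF M])
  show "integrable (surface_measure M) (\<lambda>x. 1 + (f x)\<^sup>2)"
    using f by (simp add: square_integrable_def)
  show "f \<in> borel_measurable (surface_measure M)" using f by (simp add: square_integrable_def)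
  show "AE x in surface_measure M. norm (f x) \<le> norm (1 + (f x)\<^sup>2)"
  proof (rule AE_I2)
    fix x
    have "0 \<le> (\<bar>f x\<bar> - 1)\<^sup>2" "0 \<le> (f x)\<^sup>2" by simp_all
    then show "norm (f x) \<le> norm (1 + (f x)\<^sup>2)" by (simp add: power2_diff)
  qed
qed

lemma circle_integral_measurable:
  fixes F :: "'a::euclidean_space \<Rightarrow> real"
  assumes F[measurable]: "F \<in> borel_measurable borel"
  shows "(\<lambda>z. circle_integral F (fst z) (snd z)) \<in> borel_measurable (lborel \<Otimes>\<^sub>M lborel)"
proof -
  have "(\<lambda>y. indicat_real {0..pi} (snd y) *\<^sub>R F (great_circle (sgn (fst (fst y)))
      (sgn (rejection (sgn (fst (fst y))) (snd (fst y)))) (snd y)))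
      \<in> borel_measurable ((lborel \<Otimes>\<^sub>M lborel) \<Otimes>\<^sub>M lborel)"
    unfolding great_circle_def rejection_def by measurable
  then show ?thesis
    unfolding circle_integral_def set_lebesgue_integral_def
    by (intro lborel.borel_measurable_lebesgue_integral) (simp add: case_prod_unfold)
qed

lemma circle_integral_orthogonal:
  fixes F :: "'a::euclidean_space \<Rightarrow> real"
  assumes T: "orthogonal_transformation T" and F: "\<And>y. F (T y) = F y"
  shows "circle_integral F (T u) (T w) = circle_integral F u w"
proof -
  have lin: "linear T" using T by (rule orthogonal_transformation_linear)
  have sgn: "sgn (T y) = T (sgn y)" for y
    using T by (simp add: sgn_div_norm linear_scale[OF lin] orthogonal_transformation_norm)
  have rej: "rejection (T x) (T y) = T (rejection x y)" for x y
    using T by (simp add: rejection_def linear_diff[OF lin] linear_scale[OF lin] orthogonal_transformation_def)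
  have "great_circle (T x) (T y) t = T (great_circle x y t)" for x y t
    by (simp add: great_circle_def linear_add[OF lin] linear_scale[OF lin])
  then show ?thesis by (simp add: circle_integral_def sgn rej F)
qed

text \<open>
  Unfolding straightens the broken ray to a great semicircle. It begins at the wall and not at \<open>x\<close>,
  which is immaterial because an even function has period \<open>\<pi>\<close> along a great circle.
\<close>

lemma broken_ray_transform_folded_circle:
  fixes x v :: "real ^ 'n::finite"
  assumes o: "orthonormal_pair x v" and through: "folded_circle_through a b E x v"
  obtains \<gamma> where "broken_ray (quadrant a b) E pi \<gamma>"
    "\<exists>t\<in>{0<..<pi}. \<gamma> t = x \<and> (\<gamma> has_vector_derivative v) (at t)"
    "\<And>f. f \<in> borel_measurable (surface_measure (quadrant a b)) \<Longrightarrow> broken_ray_transform f pi \<gamma>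
      = (LINT t:{0..pi}|lborel. even_extension a b f (great_circle x v t))"
proof -
  obtain \<gamma> s where ray: "broken_ray (quadrant a b) E pi \<gamma>" and s: "0 < s" "s < pi"
    and at_s: "\<gamma> s = x" "(\<gamma> has_vector_derivative v) (at s)"
    and fold: "\<And>t. t \<in> {0<..<pi} \<Longrightarrow> great_circle x v (t - s) $ a \<noteq> 0"
      "\<And>t. t \<in> {0<..<pi} \<Longrightarrow> \<gamma> t = fold_sphere a b (great_circle x v (t - s))"
    using through unfolding folded_circle_through_def by blast
  have "broken_ray_transform f pi \<gamma> = (LINT t:{0..pi}|lborel. even_extension a b f (great_circle x v t))"
    if f: "f \<in> borel_measurable (surface_measure (quadrant a b))" for f
  proof -
    let ?F = "even_extension a b f"
    note [measurable] = even_extension_measurable[OF f]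
    define \<phi> where "\<phi> t = ?F (great_circle x v t)" for t
    have [measurable]: "\<phi> \<in> borel_measurable borel"
      unfolding \<phi>_def great_circle_def by measurable
    have per: "\<phi> (t + pi) = \<phi> t" for t
      using projectiveD[OF projective_even_extension, of "- 1" a b f "great_circle x v t"]
      by (simp add: \<phi>_def great_circle_def)
    have \<gamma>: "f (\<gamma> t) = \<phi> (t + (pi - s))" if t: "t \<in> {0<..<pi}" for t
    proof -
      let ?y = "great_circle x v (t - s)"
      have y: "norm ?y = 1" "sgn ?y = ?y" using norm_great_circle[OF o] by (auto simp: sgn_div_norm)
      have "\<phi> (t + (pi - s)) = \<phi> (t - s)" using per[of "t - s"] by (simp add: algebra_simps)
      also have "\<dots> = f (\<gamma> t)"
        using fold[OF t] fold_sphere_in_quadrant[OF y(1), of a b] by (simp add: \<phi>_def even_extension_def y(2))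
      finally show ?thesis by simp
    qed
    have "broken_ray_transform f pi \<gamma> = (LINT t:{0..<pi}|lborel. \<phi> (t + (pi - s)))"
      unfolding broken_ray_transform_def set_lebesgue_integral_def
      by (rule integral_discrete_difference[of "{0, pi}"]) (auto simp: indicator_def \<gamma>)
    also have "\<dots> = (LINT t:{0..<pi}|lborel. \<phi> t)"
      using s by (intro integral_periodic_shift per) auto
    also have "\<dots> = (LINT t:{0..pi}|lborel. \<phi> t)" by (rule LINT_Icc_eq_Ico[symmetric])
    finally show ?thesis by (simp add: \<phi>_def)
  qed
  moreover have "\<exists>t\<in>{0<..<pi}. \<gamma> t = x \<and> (\<gamma> has_vector_derivative v) (at t)"
    using s at_s by (intro bexI[of _ s]) auto
  ultimately show ?thesis using ray by (intro that[of \<gamma>])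
qed

text \<open>
  The exceptional directions lie in the hyperplane orthogonal to
  \<open>u $ a *\<^sub>R axis c 1 - u $ c *\<^sub>R axis a 1\<close>.
\<close>

lemma AE_generic_direction:
  fixes u :: "real ^ 'n::finite"
  assumes "a \<noteq> c" "u $ a \<noteq> 0"
  shows "AE w in lborel. u $ a * w $ c \<noteq> u $ c * w $ a"
proof -
  let ?d = "u $ a *\<^sub>R axis c 1 - u $ c *\<^sub>R axis a 1 :: real ^ 'n"
  have inner: "?d \<bullet> w = u $ a * w $ c - u $ c * w $ a" for w
    by (simp add: inner_diff_left inner_axis')
  have "?d $ c \<noteq> 0" using assms by (simp add: axis_def)
  then have "?d \<noteq> 0" by (metis zero_index)
  then have "negligible {w. ?d \<bullet> w = 0}" by (intro negligible_hyperplane) simp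
  then have "AE w in lebesgue. w \<notin> {w. ?d \<bullet> w = 0}"
    by (intro AE_not_in) (simp add: negligible_iff_null_sets)
  then have "AE w in lborel. w \<notin> {w. ?d \<bullet> w = 0}" by (simp add: AE_completion_iff)
  then show ?thesis by eventually_elim (simp add: inner)
qed

text \<open>
  Broken rays are available for points \<open>u\<close> in the open quadrant only. The circle integrals of the
  unfolded functions are invariant under the antipodal map and, for \<open>a \<noteq> b\<close>, under the wall
  reflection; the images of the quadrant under these maps cover almost all of the space. Once the statement speaks of circle integrals, it is
  measurable in the pair \<open>(u, w)\<close>, and the two almost everywhere quantifiers can be merged.
\<close>

lemma circle_integrals_agree:
  fixes a b c :: "'n::finite"
  assumes ac: "a \<noteq> c"
    and rays: "\<And>x v. orthonormal_pair x v \<Longrightarrow> 0 < x $ a \<Longrightarrow> 0 < x $ b \<Longrightarrow>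
      x $ a * v $ c \<noteq> x $ c * v $ a \<Longrightarrow> folded_circle_through a b E x v"
    and f: "f \<in> borel_measurable (surface_measure (quadrant a b))"
    and g: "g \<in> borel_measurable (surface_measure (quadrant a b))"
    and ae: "AE_broken_ray (quadrant a b) E
      (\<lambda>L \<gamma>. broken_ray_transform f L \<gamma> = broken_ray_transform g L \<gamma>)"
  shows "AE z in lborel. fst z \<in> ball 0 1 \<and> snd z \<in> ball 0 1 \<longrightarrow>
    circle_integral (even_extension a b f) (fst z) (snd z) = circle_integral (even_extension a b g) (fst z) (snd z)"
proof -
  let ?I = "\<lambda>f u w. circle_integral (even_extension a b f) u w"
  define Q where "Q z \<longleftrightarrow> (fst z \<in> ball 0 1 \<and> snd z \<in> ball 0 1 \<longrightarrow> ?I f (fst z) (snd z) = ?I g (fst z) (snd z))"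
    for z :: "(real ^ 'n) \<times> (real ^ 'n)"
  define S where "S x v \<longleftrightarrow> (\<forall>L \<gamma>. broken_ray (quadrant a b) E L \<gamma> \<and> (\<exists>t\<in>{0<..<L}. \<gamma> t = x \<and>
    (\<gamma> has_vector_derivative v) (at t)) \<longrightarrow> broken_ray_transform f L \<gamma> = broken_ray_transform g L \<gamma>)"
    for x v
  have [measurable]: "ball (0 :: real ^ 'n) 1 \<in> sets borel" by simp
  note [measurable] = circle_integral_measurable[OF even_extension_measurable[OF f]]
    circle_integral_measurable[OF even_extension_measurable[OF g]]
  have "AE z in lborel \<Otimes>\<^sub>M lborel. 0 < fst z $ a \<and> 0 < fst z $ b \<longrightarrow> Q z"
  proof (rule lborel_pair.AE_pair_measure)
    show "{z \<in> space (lborel \<Otimes>\<^sub>M lborel). 0 < fst z $ a \<and> 0 < fst z $ b \<longrightarrow> Q z} \<in> sets (lborel \<Otimes>\<^sub>M lborel)"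
      unfolding Q_def by measurable
    show "AE u in lborel. AE w in lborel. 0 < fst (u, w) $ a \<and> 0 < fst (u, w) $ b \<longrightarrow> Q (u, w)"
      using AE_broken_rayD[OF ae, folded S_def]
    proof eventually_elim
      fix u :: "real ^ 'n"
      assume *: "u \<in> ball 0 1 \<and> sgn u \<in> quadrant a b \<longrightarrow> (AE w in lborel. w \<in> ball 0 1 \<longrightarrow>
        S (sgn u) (sgn (rejection (sgn u) w)))"
      show "AE w in lborel. 0 < fst (u, w) $ a \<and> 0 < fst (u, w) $ b \<longrightarrow> Q (u, w)"
      proof (cases "u \<in> ball 0 1 \<and> 0 < u $ a \<and> 0 < u $ b")
        case True
        define x where "x = sgn u"
        have u0: "u \<noteq> 0" using True by auto
        have nx: "norm x = 1" using u0 by (simp add: x_def norm_sgn)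
        have xab: "0 < x $ a" "0 < x $ b" using True u0 by (auto simp: x_def sgn_nth)
        then have "sgn u \<in> quadrant a b" using nx by (simp add: quadrant_def x_def)
        then have ray_eq: "AE w in lborel. w \<in> ball 0 1 \<longrightarrow> S x (sgn (rejection x w))"
          using * True by (simp add: x_def)
        have "AE w in lborel. u $ a * w $ c \<noteq> u $ c * w $ a"
          using AE_generic_direction[OF ac] True by simp
        with ray_eq show ?thesis
        proof eventually_elim
          fix w :: "real ^ 'n"
          assume eq: "w \<in> ball 0 1 \<longrightarrow> S x (sgn (rejection x w))"
            and gen: "u $ a * w $ c \<noteq> u $ c * w $ a"
          define p where "p = rejection x w"
          have u: "u = norm u *\<^sub>R x" using u0 by (simp add: x_def sgn_div_norm)
          have "u $ a * w $ c - u $ c * w $ a = norm u * (x $ a * p $ c - x $ c * p $ a)"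
            by (subst (1 2) u) (simp add: p_def rejection_def algebra_simps)
          then have genp: "x $ a * p $ c \<noteq> x $ c * p $ a" using gen by auto
          then have p0: "p \<noteq> 0" by auto
          define v where "v = sgn p"
          have o: "orthonormal_pair x v"
            using nx p0 rejection_facts(2)[OF nx, of w]
            by (simp add: orthonormal_pair_def v_def norm_sgn sgn_div_norm p_def)
          have "x $ a * v $ c - x $ c * v $ a = (x $ a * p $ c - x $ c * p $ a) / norm p"
            by (simp add: v_def sgn_nth diff_divide_distrib)
          then have "x $ a * v $ c \<noteq> x $ c * v $ a" using genp p0 by auto
          then have "folded_circle_through a b E x v" by (rule rays[OF o xab])
          then obtain \<gamma> where \<gamma>: "broken_ray (quadrant a b) E pi \<gamma>"
            "\<exists>t\<in>{0<..<pi}. \<gamma> t = x \<and> (\<gamma> has_vector_derivative v) (at t)"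
            "\<And>f. f \<in> borel_measurable (surface_measure (quadrant a b)) \<Longrightarrow> broken_ray_transform f pi \<gamma>
              = (LINT t:{0..pi}|lborel. even_extension a b f (great_circle x v t))"
            using broken_ray_transform_folded_circle[OF o] by metis
          have I: "?I h u w = broken_ray_transform h pi \<gamma>"
            if "h \<in> borel_measurable (surface_measure (quadrant a b))" for h
            using \<gamma>(3)[OF that] by (simp add: circle_integral_def v_def p_def x_def)
          have "w \<in> ball 0 1 \<longrightarrow> broken_ray_transform f pi \<gamma> = broken_ray_transform g pi \<gamma>"
            using eq \<gamma>(1,2) unfolding S_def v_def p_def by blast
          then show "0 < fst (u, w) $ a \<and> 0 < fst (u, w) $ b \<longrightarrow> Q (u, w)"
            by (simp add: Q_def I f g)
        qed
      qed (auto simp: Q_def)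
    qed
  qed
  then have pos: "AE z in lborel. 0 < fst z $ a \<and> 0 < fst z $ b \<longrightarrow> Q z" by (simp only: lborel_prod)
  have Q_sym: "Q (map_prod T T z) \<longleftrightarrow> Q z"
    if T: "orthogonal_transformation T" and inv: "\<And>f y. even_extension a b f (T y) = even_extension a b f y" for T z
    using circle_integral_orthogonal[of T "even_extension a b f", OF T inv]
      circle_integral_orthogonal[of T "even_extension a b g", OF T inv] T
    by (simp add: Q_def orthogonal_transformation_norm)
  have prod_orth: "orthogonal_transformation (map_prod T T)"
    if "orthogonal_transformation T" for T :: "real ^ 'n \<Rightarrow> real ^ 'n"
  proof -
    have lin: "linear T" using that by (rule orthogonal_transformation_linear)
    have "linear (map_prod T T)"
      by (rule linearI) (auto simp: linear_add[OF lin] linear_scale[OF lin])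
    then show ?thesis using that by (auto simp: orthogonal_transformation_def inner_prod_def)
  qed
  have neg: "orthogonal_transformation (uminus :: real ^ 'n \<Rightarrow> real ^ 'n)"
    by (simp add: orthogonal_transformation_def linear_uminus)
  have neg_inv: "even_extension a b f (- y) = even_extension a b f y" for f y
    using projectiveD[OF projective_even_extension, of "- 1" a b f y] by simp
  have "AE z in lborel. fst z $ a < 0 \<and> fst z $ b < 0 \<longrightarrow> Q z"
    using AE_lborel_orthogonal[OF prod_orth[OF neg] pos]
    by eventually_elim (auto simp: Q_sym[OF neg neg_inv])
  with pos have same_sign: "AE z in lborel. 0 < fst z $ a * fst z $ b \<longrightarrow> Q z"
    by eventually_elim (auto simp: zero_less_mult_iff)
  have all: "AE z in lborel. fst z $ a \<noteq> 0 \<and> fst z $ b \<noteq> 0 \<longrightarrow> Q z"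
  proof (cases "a = b")
    case True
    show ?thesis using same_sign by eventually_elim (auto simp: True zero_less_mult_iff linorder_neq_iff)
  next
    case False
    note R = orthogonal_transformation_wall_reflection[of b]
    have "AE z in lborel. fst z $ a * fst z $ b < 0 \<longrightarrow> Q z"
      using AE_lborel_orthogonal[OF prod_orth[OF R] same_sign]
      by eventually_elim (use False in \<open>auto simp: Q_sym[OF R even_extension_wall_reflection[OF False]]\<close>)
    with same_sign show ?thesis
      by eventually_elim (auto simp: zero_less_mult_iff mult_less_0_iff linorder_neq_iff)
  qed
  have nz: "AE z in lborel. fst (z :: (real ^ 'n) \<times> (real ^ 'n)) $ i \<noteq> 0" for i
  proof -
    have "(axis i 1, 0) \<in> (Basis :: ((real ^ 'n) \<times> (real ^ 'n)) set)" by (simp add: Basis_prod_def axis_in_Basis_iff)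
    from AE_lborel_inner_neq[OF this, of 0] show ?thesis
      by eventually_elim (simp add: inner_prod_def inner_axis)
  qed
  show ?thesis using all nz[of a] nz[of b] by eventually_elim (simp add: Q_def)
qed

text \<open>
  The set of tomography enters through \<open>rays\<close>: almost every great circle, folded into the quadrant,
  is a broken ray. The coordinate \<open>c\<close> serves to state the genericity of a direction; for the
  quadrant it is \<open>b\<close>, for the half sphere any coordinate other than \<open>a\<close>.
\<close>

lemma extensions_agree:
  fixes a b c :: "'n::finite"
  assumes dim: "3 \<le> CARD('n)" and ac: "a \<noteq> c"
    and rays: "\<And>x v. orthonormal_pair x v \<Longrightarrow> 0 < x $ a \<Longrightarrow> 0 < x $ b \<Longrightarrow>
      x $ a * v $ c \<noteq> x $ c * v $ a \<Longrightarrow> folded_circle_through a b E x v"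
    and f: "f \<in> square_integrable (quadrant a b)" and g: "g \<in> square_integrable (quadrant a b)"
    and ae: "AE_broken_ray (quadrant a b) E
      (\<lambda>L \<gamma>. broken_ray_transform f L \<gamma> = broken_ray_transform g L \<gamma>)"
  shows "AE u in lborel. u \<in> ball 0 1 \<longrightarrow> even_extension a b f u = even_extension a b g u"
proof -
  have meas: "h \<in> borel_measurable (surface_measure (quadrant a b))" if "h \<in> square_integrable (quadrant a b)" for h
    using that by (simp add: square_integrable_def)
  have int: "set_integrable lborel (ball 0 1) (even_extension a b h)" if "h \<in> square_integrable (quadrant a b)" for h
    by (rule integrable_even_extension[OF square_integrable_imp_integrable[OF quadrant_sets that]])
  show ?thesis
  proof (rule circle_integrals_determine)
    show "3 \<le> DIM(real ^ 'n)" using dim by simp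
    show "AE z in lborel. fst z \<in> ball 0 1 \<and> snd z \<in> ball 0 1 \<longrightarrow>
      circle_integral (even_extension a b f) (fst z) (snd z) = circle_integral (even_extension a b g) (fst z) (snd z)"
      by (rule circle_integrals_agree[OF ac rays meas[OF f] meas[OF g] ae])
  qed (use f g in \<open>auto intro!: even_extension_measurable meas int projective_even_extension\<close>)
qed

section \<open>Injectivity of the broken ray transform\<close>

lemma AE_surface_measure_eq:
  fixes a b :: "'n::finite"
  assumes f: "f \<in> square_integrable (quadrant a b)" and g: "g \<in> square_integrable (quadrant a b)"
    and ext: "AE u in lborel. u \<in> ball 0 1 \<longrightarrow> even_extension a b f u = even_extension a b g u"
  shows "AE x in surface_measure (quadrant a b). f x = g x"
proof -
  let ?F = "even_extension a b f" and ?G = "even_extension a b g"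
  have [measurable]: "?F \<in> borel_measurable borel" "?G \<in> borel_measurable borel"
    using f g by (auto simp: square_integrable_def intro: even_extension_measurable)
  have "axis a 1 \<in> (Basis :: (real ^ 'n) set)" by (simp add: axis_in_Basis_iff)
  from AE_lborel_inner_neq[OF this, of 0] have "AE u in lborel. (u :: real ^ 'n) $ a \<noteq> 0"
    by eventually_elim (simp add: inner_axis)
  with ext have "AE u in lborel. u \<in> ball 0 1 \<longrightarrow> ?F (sgn u) = ?G (sgn u) \<and> sgn u $ a \<noteq> 0"
    by eventually_elim (simp add: projective_sgn[OF projective_even_extension] sgn_nth_eq_0)
  then have "AE x in sphere_measure. ?F x = ?G x \<and> x $ a \<noteq> 0"
    by (rule AE_sphere_measureI[rotated]) measurable
  then show ?thesis
    unfolding AE_surface_measure_iff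
    by eventually_elim (metis even_extension_eq)
qed

lemma brt_injective_AE_if_rays:
  fixes a b c :: "'n::finite"
  assumes dim: "3 \<le> CARD('n)" and ac: "a \<noteq> c"
    and rays: "\<And>x v. orthonormal_pair x v \<Longrightarrow> 0 < x $ a \<Longrightarrow> 0 < x $ b \<Longrightarrow>
      x $ a * v $ c \<noteq> x $ c * v $ a \<Longrightarrow> folded_circle_through a b E x v"
    and C: "C \<subseteq> square_integrable (quadrant a b)"
  shows "brt_injective_AE (quadrant a b) E C"
  unfolding brt_injective_AE_def
proof (intro ballI impI)
  fix f g assume "f \<in> C" "g \<in> C" and ae: "AE_broken_ray (quadrant a b) E
      (\<lambda>L \<gamma>. broken_ray_transform f L \<gamma> = broken_ray_transform g L \<gamma>)"
  then have fg: "f \<in> square_integrable (quadrant a b)" "g \<in> square_integrable (quadrant a b)"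
    using C by auto
  show "AE x in surface_measure (quadrant a b). f x = g x"
    by (rule AE_surface_measure_eq[OF fg extensions_agree[OF dim ac rays fg ae]])
qed

lemma smooth_on_mfd_imp_continuous_on:
  assumes "smooth_on_mfd M f"
  shows "continuous_on M f"
  unfolding continuous_on_def
proof
  fix x assume x: "x \<in> M"
  then obtain U F where U: "open U" "x \<in> U" and F: "\<forall>k. Ck_on k U F" "\<forall>y\<in>M \<inter> U. F y = f y"
    using assms unfolding smooth_on_mfd_def by blast
  have "Ck_on 0 U F" using F(1) by blast
  then have "continuous_on U F" by simp
  then have "isCont F x" using continuous_on_eq_continuous_at[OF U(1)] U(2) by blast
  then have lim: "(F \<longlongrightarrow> F x) (at x within M)"
    unfolding isCont_def by (rule tendsto_within_subset) simp
  have ev: "eventually (\<lambda>y. F y = f y) (at x within M)"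
    using U F(2) unfolding eventually_at_topological by blast
  have "F x = f x" using F(2) U(2) x by blast
  then show "(f \<longlongrightarrow> f x) (at x within M)"
    using Lim_transform_eventually[OF lim ev] by simp
qed

lemma continuous_square_integrable:
  fixes f :: "real ^ 'n::finite \<Rightarrow> real"
  assumes f: "continuous_on (quadrant a b) f"
  shows "f \<in> square_integrable (quadrant a b)"
proof -
  let ?M = "quadrant a b"
  interpret finite_measure "surface_measure ?M" by (rule finite_measure_surface_measure) simp
  have "compact ?M"
  proof -
    have "?M = sphere 0 1 \<inter> ?M" by (auto simp: quadrant_def)
    then show ?thesis using compact_Int_closed[OF compact_sphere closed_quadrant] by metis
  qed
  then have "bounded (f ` ?M)" using f compact_continuous_image compact_imp_bounded by blast
  then obtain B where B: "\<And>x. x \<in> ?M \<Longrightarrow> norm (f x) \<le> B" by (auto simp: bounded_iff)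
  have "(\<lambda>x. indicator ?M x *\<^sub>R f x) \<in> borel_measurable borel"
    by (rule borel_measurable_continuous_on_indicator[OF quadrant_sets f])
  then have meas[measurable]: "f \<in> borel_measurable (surface_measure ?M)"
    unfolding surface_measure_def by (subst borel_measurable_restrict_space_iff) auto
  have "integrable (surface_measure ?M) (\<lambda>x. (f x)\<^sup>2)"
  proof (rule integrable_const_bound[of _ "B\<^sup>2"])
    have "norm ((f x)\<^sup>2) \<le> B\<^sup>2" if "x \<in> ?M" for x
      using power_mono[OF B[OF that], of 2] by (simp add: power_abs)
    then show "AE x in surface_measure ?M. norm ((f x)\<^sup>2) \<le> B\<^sup>2"
      by (intro AE_I2) (simp add: surface_measure_def space_restrict_space)
  qed measurable
  then show ?thesis using meas by (simp add: square_integrable_def)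
qed

lemma quadrant_dense_interior:
  fixes x :: "real ^ 'n::finite"
  assumes x: "x \<in> quadrant a b" and U: "open U" "x \<in> U"
  obtains u where "u \<noteq> 0" "sgn u \<in> U" "0 < u $ a" "0 < u $ b"
proof -
  \<comment> \<open>A direction that points into the open quadrant from each of its boundary points.\<close>
  let ?d = "axis a 1 + axis b 1 :: real ^ 'n"
  have x1: "norm x = 1" and x0: "x \<noteq> 0" using x by (auto simp: quadrant_def)
  have "((\<lambda>t. sgn (x + t *\<^sub>R ?d)) \<longlongrightarrow> sgn (x + 0 *\<^sub>R ?d)) (at_right 0)"
    using x0 by (intro tendsto_intros) simp
  moreover have "sgn (x + 0 *\<^sub>R ?d) = x" using x1 by (simp add: sgn_div_norm)
  ultimately have "eventually (\<lambda>t. sgn (x + t *\<^sub>R ?d) \<in> U) (at_right 0)"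
    using U by (metis topological_tendstoD)
  moreover have "eventually (\<lambda>t::real. 0 < t) (at_right 0)" by (rule eventually_at_right_less)
  ultimately have "eventually (\<lambda>t. sgn (x + t *\<^sub>R ?d) \<in> U \<and> 0 < t) (at_right 0)"
    by (rule eventually_conj)
  then obtain t where t: "sgn (x + t *\<^sub>R ?d) \<in> U" "0 < t"
    using eventually_happens[of _ "at_right (0::real)"] by (auto simp: trivial_limit_at_right_real)
  have pos: "0 < (x + t *\<^sub>R ?d) $ a" "0 < (x + t *\<^sub>R ?d) $ b"
    using x t(2) by (auto simp: quadrant_def axis_def add_nonneg_pos)
  then have "x + t *\<^sub>R ?d \<noteq> 0" by (metis zero_index less_irrefl)
  then show ?thesis using that t(1) pos by blast
qed

text \<open>
  Continuous functions that differ at one point differ on a set of positive measure: each point of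
  the quadrant is a limit of points of the open quadrant, over which there is an open cone.
\<close>

lemma continuous_eq_if_extensions_agree:
  fixes a b :: "'n::finite"
  assumes f: "continuous_on (quadrant a b) f" and g: "continuous_on (quadrant a b) g"
    and ext: "AE u in lborel. u \<in> ball 0 1 \<longrightarrow> even_extension a b f u = even_extension a b g u"
    and x: "x \<in> quadrant a b"
  shows "f x = g x"
proof (rule ccontr)
  assume neq: "f x \<noteq> g x"
  let ?M = "quadrant a b"
  have "continuous_on ?M (\<lambda>y. f y - g y)" using f g by (intro continuous_intros)
  then have "openin (top_of_set ?M) (?M \<inter> (\<lambda>y. f y - g y) -` (- {0}))"
    by (rule continuous_openin_preimage_gen) auto
  then obtain U where U: "open U" "?M \<inter> (\<lambda>y. f y - g y) -` (- {0}) = ?M \<inter> U"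
    unfolding openin_open by blast
  have "x \<in> ?M \<inter> (\<lambda>y. f y - g y) -` (- {0})" using x neq by simp
  then have "x \<in> U" unfolding U(2) by simp
  then obtain u0 where u0: "u0 \<noteq> 0" "sgn u0 \<in> U" "0 < u0 $ a" "0 < u0 $ b"
    using quadrant_dense_interior[OF x U(1)] by blast
  define W where "W = (- {0}) \<inter> sgn -` U"
  define V where "V = ball 0 1 \<inter> {u. 0 < u $ a} \<inter> {u. 0 < u $ b} \<inter> W"
  have "open W"
    unfolding W_def by (rule continuous_open_preimage[OF _ _ U(1)]) (auto intro!: continuous_intros)
  then have "open V"
    unfolding V_def by (intro open_Int open_ball open_Collect_less continuous_intros)
  moreover have "(1 / (2 * norm u0)) *\<^sub>R u0 \<in> V"
    using u0 by (simp add: V_def W_def sgn_scaleR)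
  ultimately obtain e where e: "0 < e" "ball ((1 / (2 * norm u0)) *\<^sub>R u0) e \<subseteq> V"
    using open_contains_ball by blast
  have differ: "even_extension a b f u \<noteq> even_extension a b g u" if "u \<in> V" for u
  proof -
    have u: "0 < u $ a" "0 < u $ b" "u \<noteq> 0" "sgn u \<in> U" using that by (auto simp: V_def W_def)
    then have "sgn u \<in> ?M" "sgn u $ a \<noteq> 0" by (auto simp: quadrant_def norm_sgn sgn_nth)
    then have "even_extension a b h (sgn u) = h (sgn u)" for h by (rule even_extension_eq)
    moreover have "sgn u \<in> ?M \<inter> (\<lambda>y. f y - g y) -` (- {0})"
      unfolding U(2) using u(4) \<open>sgn u \<in> ?M\<close> by simp
    then have "f (sgn u) \<noteq> g (sgn u)" by simp
    ultimately show ?thesis by (metis projective_sgn[OF projective_even_extension])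
  qed
  have "AE u in lborel. u \<notin> ball ((1 / (2 * norm u0)) *\<^sub>R u0) e"
    using ext
  proof eventually_elim
    fix u assume "u \<in> ball 0 1 \<longrightarrow> even_extension a b f u = even_extension a b g u"
    then have "u \<notin> V" using differ[of u] by (auto simp: V_def)
    then show "u \<notin> ball ((1 / (2 * norm u0)) *\<^sub>R u0) e" using e(2) by blast
  qed
  then have "emeasure lborel (ball ((1 / (2 * norm u0)) *\<^sub>R u0) e) = 0"
    by (subst (asm) AE_iff_measurable[of "ball ((1 / (2 * norm u0)) *\<^sub>R u0) e"]) auto
  then show False
    using e(1) by (simp add: emeasure_ball unit_ball_vol_pos less_imp_neq[symmetric])
qed

lemma brt_injective_if_rays:
  fixes a b c :: "'n::finite"
  assumes dim: "3 \<le> CARD('n)" and ac: "a \<noteq> c"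
    and rays: "\<And>x v. orthonormal_pair x v \<Longrightarrow> 0 < x $ a \<Longrightarrow> 0 < x $ b \<Longrightarrow>
      x $ a * v $ c \<noteq> x $ c * v $ a \<Longrightarrow> folded_circle_through a b E x v"
    and C: "\<And>f. f \<in> C \<Longrightarrow> continuous_on (quadrant a b) f"
  shows "brt_injective (quadrant a b) E C"
  unfolding brt_injective_def
proof (intro ballI impI)
  fix f g x assume "f \<in> C" "g \<in> C" and eq: "\<forall>L \<gamma>. broken_ray (quadrant a b) E L \<gamma> \<longrightarrow>
      broken_ray_transform f L \<gamma> = broken_ray_transform g L \<gamma>" and x: "x \<in> quadrant a b"
  then have fg: "continuous_on (quadrant a b) f" "continuous_on (quadrant a b) g" using C by auto
  have ae: "AE_broken_ray (quadrant a b) E (\<lambda>L \<gamma>. broken_ray_transform f L \<gamma> = broken_ray_transform g L \<gamma>)"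
    unfolding AE_broken_ray_def
  proof (rule AE_I2)
    fix z :: "(real ^ 'n) \<times> (real ^ 'n)"
    show "case z of (x, v) \<Rightarrow> \<forall>L \<gamma>. broken_ray (quadrant a b) E L \<gamma> \<and>
        (\<exists>t\<in>{0<..<L}. \<gamma> t = x \<and> (\<gamma> has_vector_derivative v) (at t)) \<longrightarrow>
        broken_ray_transform f L \<gamma> = broken_ray_transform g L \<gamma>"
      unfolding case_prod_unfold using eq by blast
  qed
  note sq = continuous_square_integrable[OF fg(1)] continuous_square_integrable[OF fg(2)]
  have "AE u in lborel. u \<in> ball 0 1 \<longrightarrow> even_extension a b f u = even_extension a b g u"
    by (rule extensions_agree[OF dim ac rays sq ae])
  from continuous_eq_if_extensions_agree[OF fg this x] show "f x = g x" .
qed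

theorem proposition26:
  shows "(\<forall>a b :: 'n::finite. 4 \<le> CARD('n) \<and> a \<noteq> b \<longrightarrow>
      brt_injective_AE (quadrant a b) (quadrant_tomography a b)
        {f \<in> square_integrable (quadrant a b).
           essential_support (quadrant a b) f \<inter> closure (quadrant_tomography a b) = {}})
    \<and>
    brt_injective (quadrant (1::3) 2) (quadrant_tomography 1 2)
      {f. smooth_on_mfd (quadrant (1::3) 2) f \<and>
          fun_support (quadrant 1 2) f \<inter> closure (quadrant_tomography 1 2) = {} \<and>
          infinitely_even {x \<in> quadrant 1 2. x $ 2 = 0} (axis 2 1) f}
    \<and>
    (\<exists>\<epsilon>>0. brt_injective hemisphere (hemisphere_tomography \<epsilon>)
      {f. smooth_on_mfd hemisphere f \<and>
          infinitely_even {x \<in> hemisphere. x $ 2 = 0} (axis 2 1) f})"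
proof (intro conjI allI impI)
  fix a b :: 'n assume ab: "4 \<le> CARD('n) \<and> a \<noteq> b"
  show "brt_injective_AE (quadrant a b) (quadrant_tomography a b)
        {f \<in> square_integrable (quadrant a b).
           essential_support (quadrant a b) f \<inter> closure (quadrant_tomography a b) = {}}"
  proof (rule brt_injective_AE_if_rays[of a b])
    show "folded_circle_through a b (quadrant_tomography a b) x v"
      if "orthonormal_pair x v" "0 < x $ a" "0 < x $ b" "x $ a * v $ b \<noteq> x $ b * v $ a" for x v
      using ab that by (intro quadrant_ray_through) auto
  qed (use ab in auto)
next
  show "brt_injective (quadrant (1::3) 2) (quadrant_tomography 1 2)
      {f. smooth_on_mfd (quadrant (1::3) 2) f \<and>
          fun_support (quadrant 1 2) f \<inter> closure (quadrant_tomography 1 2) = {} \<and>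
          infinitely_even {x \<in> quadrant 1 2. x $ 2 = 0} (axis 2 1) f}"
  proof (rule brt_injective_if_rays[of 1 2])
    show "folded_circle_through 1 2 (quadrant_tomography 1 2) x v"
      if "orthonormal_pair x v" "0 < x $ 1" "0 < x $ 2" "x $ 1 * v $ 2 \<noteq> x $ 2 * v $ 1" for x v :: "real ^ 3"
      using that by (intro quadrant_ray_through) auto
  qed (auto intro: smooth_on_mfd_imp_continuous_on)
next
  show "\<exists>\<epsilon>>0. brt_injective hemisphere (hemisphere_tomography \<epsilon>)
      {f. smooth_on_mfd hemisphere f \<and>
          infinitely_even {x \<in> hemisphere. x $ 2 = 0} (axis 2 1) f}"
  \<comment> \<open>Any \<open>\<epsilon> > 1\<close> makes the whole boundary circle the set of tomography.\<close>
  proof (intro exI conjI)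
    show "brt_injective hemisphere (hemisphere_tomography 2)
      {f. smooth_on_mfd hemisphere f \<and>
          infinitely_even {x \<in> hemisphere. x $ 2 = 0} (axis 2 1) f}"
      unfolding hemisphere_eq_quadrant
    proof (rule brt_injective_if_rays[of 2 1])
      show "folded_circle_through 2 2 (hemisphere_tomography 2) x v"
        if "orthonormal_pair x v" "0 < x $ 2" for x v
        using that by (intro hemisphere_ray_through) auto
    qed (auto intro: smooth_on_mfd_imp_continuous_on)
  qed simp
qed

end
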